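(* It is undecidable, given a finite set $\{M_1,\ldots,M_k\}$ of $4\times4$ matrices with integer entries, whether the identity matrix $I_4$ belongs to the multiplicative semigroup generated by $\{M_1,\ldots,M_k\}$ (i.e. whether $I_4$ is a product $M_{l_1}\cdots M_{l_r}$ with $r\ge1$). This remains undecidable when the number of generators is fixed to $k=48$. *)

theory Defs
  imports "HOL-Analysis.Analysis" "HOL-Library.Nat_Bijection"
begin

section \<open>A model of computation: (partial) mu-recursive functions\<close>

datatype recf =
    Zero_f
  | Succ_f
  | Proj_f nat
  | Comp_f recf "recf list"
  | Prec_f recf recf
  | Mn_f recf

text \<open>Big-step evaluation relation: eval f xs y means f applied to arguments xs
  terminates with value y.  (Arities are handled loosely; this is still the usual
  class of partial recursive functions.)\<close>
inductive eval :: "recf \<Rightarrow> nat list \<Rightarrow> nat \<Rightarrow> bool" where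
  zero: "eval Zero_f xs 0"
| succ: "eval Succ_f (x # xs) (Suc x)"
| proj: "i < length xs \<Longrightarrow> eval (Proj_f i) xs (xs ! i)"
| comp: "list_all2 (\<lambda>g y. eval g xs y) gs ys \<Longrightarrow> eval f ys z \<Longrightarrow> eval (Comp_f f gs) xs z"
| prec0: "eval f xs y \<Longrightarrow> eval (Prec_f f g) (0 # xs) y"
| precS: "eval (Prec_f f g) (n # xs) y \<Longrightarrow> eval g (n # y # xs) z
           \<Longrightarrow> eval (Prec_f f g) (Suc n # xs) z"
| mn: "eval f (n # xs) 0 \<Longrightarrow> (\<forall>m<n. \<exists>y. eval f (m # xs) y \<and> y > 0) \<Longrightarrow> eval (Mn_f f) xs n"

text \<open>A decision problem on instances of type 'a, given a coding of instances
  by natural numbers, is decidable if some recursive function computes its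
  characteristic function on (the codes of) all instances in the domain D.\<close>
definition decidable_on :: "('a \<Rightarrow> nat) \<Rightarrow> 'a set \<Rightarrow> ('a \<Rightarrow> bool) \<Rightarrow> bool" where
  "decidable_on code D P \<longleftrightarrow>
     (\<exists>f. \<forall>x\<in>D. eval f [code x] (if P x then 1 else 0))"

section \<open>Integer 4x4 matrices and the identity problem\<close>

type_synonym imat4 = "int ^ 4 ^ 4"

text \<open>Standard injective coding of a matrix (row-major list of its 16 entries)
  and of a finite list of matrices by natural numbers.\<close>
definition code_mat :: "imat4 \<Rightarrow> nat" where
  "code_mat M = list_encode
     (map (\<lambda>(i, j). int_encode (M $ of_nat i $ of_nat j))
        (List.product [0..<4] [0..<4]))"

definition code_mats :: "imat4 list \<Rightarrow> nat" where
  "code_mats Ms = list_encode (map code_mat Ms)"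

text \<open>The identity matrix lies in the semigroup generated by the matrices in Ms:
  it is a product of r \<ge> 1 generators.\<close>
definition identity_in_semigroup :: "imat4 list \<Rightarrow> bool" where
  "identity_in_semigroup Ms \<longleftrightarrow>
     (\<exists>ps. ps \<noteq> [] \<and> set ps \<subseteq> set Ms \<and> foldr (**) ps (mat 1) = mat 1)"

end

theory Submission
  imports Defs "HOL-Library.Product_Plus"
begin

text \<open>Proof idea.  A partial recursive function g is simulated by a queue automaton whose transition
  table is kept in the queue itself, so that the automaton has the same few edges for every g; a run is
  a walk from state p to state q in a labelled graph along which the concatenation U of the written
  words equals the concatenation V of the words read.  The input x enters only as the power x + 2 of
  one letter in the label of a single edge.

  In pairs of elements of a free group, take an edge from s to t with labels u, v as the pair
  (s u t^-1, s v t^-1), add (q y^-1 q^-1, q y^-1 q^-1) for every letter y to compare U with V, and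
  return from q to p by q z p^-1 or q z^-3 p^-1 with a fresh letter z.  A product equal to 1 is
  a product of factors X z^n with n = 1 or n = -3, where X comes from the edges between two returns.
  A quarter of the exponents is negative, and each component has fewer nontrivial X than twice the number
  of negative exponents.  Hence some X is trivial in both components at once, and because no edge has
  an empty second label this X is a walk with U = V.

  The free group embeds into the integer matrices of determinant 1, and block diagonal matrices
  represent the pairs.  Singular matrices fill the list up to 48 distinct members.  If f decided the
  problem, let g halt on x iff f answers 0 on the list that consists of the matrix for the input x
  followed by the list with code x.  Taking for x the code of the 47 matrices that belong to g gives
  a contradiction; no universal machine is needed.\<close>

section \<open>From recursive functions to counter programs\<close>

\<comment> \<open>The obstacle is simultaneity: a product of pairs may cancel along different
  patterns in the two components, and an X that is trivial in only one of them says nothing about U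
  and V. With return exponents 1 and -m, a trivial product of N factors X z^n has N/(m+1) negative
  exponents, hence fewer than 2N/(m+1) nontrivial X in each component. The two counts together leave
  an X trivial in both as soon as m + 1 >= 4; this is the origin of -3. Second labels are nonempty
  and positive so that products of edges and comparison letters can cancel in the second component
  only inside a connected chain; a closed edge with an empty label would already be trivial there.
  First labels may be empty, which is how a queue letter is deleted. A queue fits because U = V says
  that letters are read in the order in which they are written. The interpreter has 28 edges for
  every g. With the input edge, four letters and two returns this makes at most 35 relevant
  matrices, so at least 13 of the 48 are filling.\<close>
inductive_simps eval_simps [simp]:
  "eval Zero_f xs y"
  "eval Succ_f xs y"
  "eval (Proj_f i) xs y"
  "eval (Comp_f f gs) xs y"
  "eval (Prec_f f g) [] y"
  "eval (Prec_f f g) (0 # xs) y"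
  "eval (Prec_f f g) (Suc n # xs) y"
  "eval (Mn_f f) xs y"

lemma eval_deterministic: "eval f xs y \<Longrightarrow> eval f xs z \<Longrightarrow> z = y"
proof (induction arbitrary: z rule: eval.induct)
  case (comp xs gs ys f w)
  obtain ys' where ys': "list_all2 (\<lambda>g y. eval g xs y) gs ys'" "eval f ys' z"
    using comp.prems by auto
  have "ys' = ys"
    using comp.IH(1) ys'(1)
    by (intro nth_equalityI) (auto simp: list_all2_conv_all_nth)
  with ys'(2) comp.IH(2) show ?case by simp
next
  case (mn f n xs)
  then have z: "eval f (z # xs) 0" "\<forall>m<z. \<exists>y. eval f (m # xs) y \<and> y > 0" by auto
  have "\<not> z < n"
  proof
    assume "z < n"
    then obtain y where "y > 0" "\<forall>w. eval f (z # xs) w \<longrightarrow> w = y" using mn.IH(2) by blast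
    with z(1) show False by fastforce
  qed
  moreover have "\<not> n < z"
  proof
    assume "n < z"
    then obtain y where "eval f (n # xs) y" "y > 0" using z(2) by blast
    with mn.IH(1) show False by fastforce
  qed
  ultimately show ?case by simp
next
  case (precS f g n xs y w)
  then show ?case by (metis eval_simps(7))
qed auto

section \<open>A loop language on counters\<close>

datatype com = Inc nat | Dec nat | Seq com com (infixr ";;" 60) | Loop nat com

inductive bs :: "com \<Rightarrow> (nat \<Rightarrow> nat) \<Rightarrow> (nat \<Rightarrow> nat) \<Rightarrow> bool" where
  Inc: "bs (Inc r) s (s(r := Suc (s r)))"
| Dec: "bs (Dec r) s (s(r := s r - 1))"
| Seq: "bs c s t \<Longrightarrow> bs d t u \<Longrightarrow> bs (c ;; d) s u"
| Loop0: "s r = 0 \<Longrightarrow> bs (Loop r c) s s"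
| LoopS: "s r > 0 \<Longrightarrow> bs c (s(r := s r - 1)) t \<Longrightarrow> bs (Loop r c) t u \<Longrightarrow> bs (Loop r c) s u"

inductive_simps bs_simps: "bs (Inc r) s u" "bs (Dec r) s u" "bs (c ;; d) s u"

inductive_cases bs_LoopE: "bs (Loop r c) s u"

lemma bs_Loop0: "s r = 0 \<Longrightarrow> bs (Loop r c) s u \<longleftrightarrow> u = s"
  by (auto elim: bs_LoopE intro: bs.Loop0)

lemma bs_LoopS: "s r > 0 \<Longrightarrow> bs (Loop r c) s u \<longleftrightarrow> (\<exists>t. bs c (s(r := s r - 1)) t \<and> bs (Loop r c) t u)"
  by (auto elim: bs_LoopE intro: bs.LoopS)

text \<open>Termination and uniqueness of the outcome in one equivalence. Composite programs can
  then be evaluated by rewriting, with no separate determinism theorem for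
  \<open>bs\<close>.\<close>

definition yields :: "com \<Rightarrow> (nat \<Rightarrow> nat) \<Rightarrow> (nat \<Rightarrow> nat) \<Rightarrow> bool" where
  "yields c s t \<longleftrightarrow> (\<forall>u. bs c s u \<longleftrightarrow> u = t)"

lemma yieldsD: "yields c s t \<Longrightarrow> bs c s u \<longleftrightarrow> u = t"
  by (simp add: yields_def)

lemma yields_Inc: "yields (Inc r) s (s(r := Suc (s r)))"
  and yields_Dec: "yields (Dec r) s (s(r := s r - 1))"
  by (simp_all add: yields_def bs_simps)

lemma bs_yields_Seq: "yields c s t \<Longrightarrow> bs (c ;; d) s u \<longleftrightarrow> bs d t u"
  by (simp add: yields_def bs_simps)

lemma yields_Seq: "yields c s t \<Longrightarrow> yields d t u \<Longrightarrow> yields (c ;; d) s u"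
  by (simp add: yields_def bs_simps)

lemma yields_Loop0: "s r = 0 \<Longrightarrow> yields (Loop r c) s s"
  by (simp add: yields_def bs_Loop0)

lemma yields_LoopS:
  "s r > 0 \<Longrightarrow> yields c (s(r := s r - 1)) t \<Longrightarrow> yields (Loop r c) t u \<Longrightarrow> yields (Loop r c) s u"
  by (simp add: yields_def bs_LoopS)

text \<open>Every command, even this one, has nonempty code, so that \<open>code_at\<close>
  determines the instruction at its first address.\<close>

definition skip :: com where "skip = Inc 0 ;; Dec 0"

lemma yields_skip: "yields skip s s"
proof -
  have "yields skip s ((s(0 := Suc (s 0)))(0 := (s(0 := Suc (s 0))) 0 - 1))"
    unfolding skip_def by (rule yields_Seq[OF yields_Inc yields_Dec])
  then show ?thesis by simp
qed

definition clr :: "nat \<Rightarrow> com" where "clr r = Loop r (Dec r)"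

text \<open>\<open>Loop\<close> decrements \<open>r\<close> before its body does so again: the
  register falls by two per round, or from 1 to 0 by truncated subtraction. Hence the induction over
  all smaller values.\<close>

lemma yields_clr: "yields (clr r) s (s(r := 0))"
proof (induction "s r" arbitrary: s rule: less_induct)
  case less
  show ?case
  proof (cases "s r = 0")
    case True
    then have "s(r := 0) = s" by auto
    then show ?thesis using yields_Loop0[of s r "Dec r"] True by (simp add: clr_def)
  next
    case False
    define s1 where "s1 = s(r := s r - 1)"
    define s2 where "s2 = s1(r := s1 r - 1)"
    have "yields (clr r) s2 (s2(r := 0))" by (rule less) (use False in \<open>simp add: s2_def s1_def\<close>)
    then have "yields (clr r) s (s2(r := 0))"
      unfolding clr_def using yields_LoopS[of s r "Dec r" s2] yields_Dec[of r s1] False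
      by (simp add: s2_def s1_def)
    then show ?thesis by (simp add: s2_def s1_def)
  qed
qed

definition mv :: "nat \<Rightarrow> nat \<Rightarrow> com" where "mv r t = Loop r (Inc t)"

lemma yields_mv: "r \<noteq> t \<Longrightarrow> yields (mv r t) s (s(r := 0, t := s t + s r))"
proof (induction "s r" arbitrary: s)
  case 0
  then have eq: "s(r := 0, t := s t + s r) = s" by auto
  show ?case unfolding eq mv_def by (rule yields_Loop0) (use 0 in simp)
next
  case (Suc n)
  define s1 where "s1 = s(r := s r - 1)"
  define s2 where "s2 = s1(t := Suc (s1 t))"
  have "yields (mv r t) s2 (s2(r := 0, t := s2 t + s2 r))"
    by (rule Suc.hyps) (use Suc in \<open>auto simp: s2_def s1_def\<close>)
  then have "yields (mv r t) s (s2(r := 0, t := s2 t + s2 r))"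
    unfolding mv_def using yields_LoopS[of s r "Inc t" s2] yields_Inc[of t s1] Suc.hyps(2)
    by (simp add: s2_def s1_def)
  moreover have "s2(r := 0, t := s2 t + s2 r) = s(r := 0, t := s t + s r)"
    using Suc by (auto simp: s2_def s1_def)
  ultimately show ?case by simp
qed

definition cp :: "nat \<Rightarrow> nat \<Rightarrow> nat \<Rightarrow> com" where
  "cp r t tmp = Loop r (Inc t ;; Inc tmp) ;; mv tmp r"

lemma yields_cp:
  assumes "r \<noteq> t" "r \<noteq> tmp" "t \<noteq> tmp" "s tmp = 0"
  shows "yields (cp r t tmp) s (s(t := s t + s r))"
proof -
  have "yields (Loop r (Inc t ;; Inc tmp)) s (s(r := 0, t := s t + s r, tmp := s tmp + s r))" for s
  proof (induction "s r" arbitrary: s)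
    case 0
    then have eq: "s(r := 0, t := s t + s r, tmp := s tmp + s r) = s" by auto
    show ?case unfolding eq by (rule yields_Loop0) (use 0 in simp)
  next
    case (Suc n)
    define s1 where "s1 = s(r := s r - 1)"
    define s2 where "s2 = s1(t := Suc (s1 t), tmp := Suc (s1 tmp))"
    have "yields (Inc t ;; Inc tmp) s1 s2"
      using yields_Seq[OF yields_Inc[of t s1] yields_Inc[of tmp]] assms by (simp add: s2_def)
    moreover have "yields (Loop r (Inc t ;; Inc tmp)) s2 (s2(r := 0, t := s2 t + s2 r, tmp := s2 tmp + s2 r))"
      by (rule Suc.hyps) (use Suc assms in \<open>auto simp: s2_def s1_def\<close>)
    ultimately have "yields (Loop r (Inc t ;; Inc tmp)) s (s2(r := 0, t := s2 t + s2 r, tmp := s2 tmp + s2 r))"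
      using yields_LoopS[of s r _ s2] Suc.hyps(2) by (simp add: s1_def)
    moreover have "s2(r := 0, t := s2 t + s2 r, tmp := s2 tmp + s2 r) = s(r := 0, t := s t + s r, tmp := s tmp + s r)"
      using Suc assms by (auto simp: s2_def s1_def)
    ultimately show ?case by simp
  qed
  note loop = this
  define s1 where "s1 = s(r := 0, t := s t + s r, tmp := s tmp + s r)"
  have "yields (cp r t tmp) s (s1(tmp := 0, r := s1 r + s1 tmp))"
    unfolding cp_def by (rule yields_Seq[OF loop[of s, folded s1_def] yields_mv]) (use assms in simp)
  moreover have "s1(tmp := 0, r := s1 r + s1 tmp) = s(t := s t + s r)"
    using assms by (auto simp: s1_def)
  ultimately show ?thesis by simp
qed

fun cps :: "nat \<Rightarrow> nat \<Rightarrow> nat \<Rightarrow> nat \<Rightarrow> com" where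
  "cps k 0 t tmp = skip"
| "cps k (Suc n) t tmp = cps k n t tmp ;; cp (k + n) (t + n) tmp"

lemma yields_cps:
  assumes "k + n \<le> t" "t + n \<le> tmp" "\<And>r. t \<le> r \<Longrightarrow> r < t + n \<Longrightarrow> s r = 0" "s tmp = 0"
  shows "yields (cps k n t tmp) s (\<lambda>r. if t \<le> r \<and> r < t + n then s (k + (r - t)) else s r)"
  using assms
proof (induction n)
  case 0
  have "(\<lambda>r. if t \<le> r \<and> r < t + 0 then s (k + (r - t)) else s r) = s" by auto
  then show ?case using yields_skip by simp
next
  case (Suc n)
  define s' where "s' = (\<lambda>r. if t \<le> r \<and> r < t + n then s (k + (r - t)) else s r)"
  have "yields (cps k n t tmp) s s'" unfolding s'_def by (rule Suc.IH) (use Suc.prems in auto)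
  moreover have "yields (cp (k + n) (t + n) tmp) s' (s'(t + n := s' (t + n) + s' (k + n)))"
    by (rule yields_cp) (use Suc.prems in \<open>auto simp: s'_def\<close>)
  moreover have "s'(t + n := s' (t + n) + s' (k + n)) =
      (\<lambda>r. if t \<le> r \<and> r < t + Suc n then s (k + (r - t)) else s r)"
    using Suc.prems by (auto simp: s'_def fun_eq_iff)
  ultimately show ?case using yields_Seq by simp
qed

fun clrs :: "nat \<Rightarrow> nat \<Rightarrow> com" where
  "clrs t 0 = skip"
| "clrs t (Suc n) = clrs t n ;; clr (t + n)"

lemma yields_clrs: "yields (clrs t n) s (\<lambda>r. if t \<le> r \<and> r < t + n then 0 else s r)"
proof (induction n)
  case 0
  have "(\<lambda>r. if t \<le> r \<and> r < t + 0 then 0 else s r) = s" by auto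
  then show ?case using yields_skip by simp
next
  case (Suc n)
  have "(\<lambda>r. if t \<le> r \<and> r < t + n then 0 else s r)(t + n := 0) = (\<lambda>r. if t \<le> r \<and> r < t + Suc n then 0 else s r)"
    by (auto simp: fun_eq_iff)
  then show ?case using yields_Seq[OF Suc yields_clr[of "t + n"]] by simp
qed

text \<open>Calling convention: the arguments are in the registers k, ..., k + n - 1, all registers from t
  on are 0 and serve as scratch space, and the result appears in register t.\<close>

definition implements :: "recf \<Rightarrow> nat \<Rightarrow> nat \<Rightarrow> nat \<Rightarrow> com \<Rightarrow> bool" where
  "implements f k n t c \<longleftrightarrow> (\<forall>s. (\<forall>r\<ge>t. s r = 0) \<longrightarrow>
     (\<forall>u. bs c s u \<longleftrightarrow> (\<exists>y. eval f (map s [k..<k + n]) y \<and> u = s(t := y))))"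

lemma implementsD: "implements f k n t c \<Longrightarrow> (\<And>r. r \<ge> t \<Longrightarrow> s r = 0) \<Longrightarrow>
    bs c s u \<longleftrightarrow> (\<exists>y. eval f (map s [k..<k + n]) y \<and> u = s(t := y))"
  by (simp add: implements_def)

text \<open>A recursive function is undefined on too few arguments, and its program has to diverge
  there. The loop restores its own counter, so that every test finds register 0 positive.\<close>

definition fail :: com where "fail = Inc 0 ;; Loop 0 (Inc 0)"

lemma fail: "\<not> bs fail s u"
proof -
  have *: "c = Loop 0 (Inc 0) \<Longrightarrow> s 0 > 0 \<Longrightarrow> False" if "bs c s u" for c s u
    using that
  proof induction
    case (LoopS s r c t u)
    then have "t = (s(0 := s 0 - 1))(0 := Suc ((s(0 := s 0 - 1)) 0))"
      by (simp add: bs_simps)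
    with LoopS show False by simp
  qed auto
  show ?thesis
  proof
    assume "bs fail s u"
    then have "bs (Loop 0 (Inc 0)) (s(0 := Suc (s 0))) u" by (simp add: fail_def bs_simps)
    from *[OF this refl] show False by simp
  qed
qed

lemma implements_fail: "(\<And>xs y. length xs = n \<Longrightarrow> \<not> eval f xs y) \<Longrightarrow> implements f k n t fail"
  by (simp add: implements_def fail)

lemma implements_yields:
  assumes "\<And>s. (\<And>r. r \<ge> t \<Longrightarrow> s r = 0) \<Longrightarrow> \<exists>y. (\<forall>z. eval f (map s [k..<k + n]) z \<longleftrightarrow> z = y) \<and> yields c s (s(t := y))"
  shows "implements f k n t c"
  unfolding implements_def
proof (intro allI impI)
  fix s u :: "nat \<Rightarrow> nat"
  assume "\<forall>r\<ge>t. s r = 0"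
  then obtain y where "\<forall>z. eval f (map s [k..<k + n]) z \<longleftrightarrow> z = y" "yields c s (s(t := y))"
    using assms[of s] by blast
  then show "bs c s u \<longleftrightarrow> (\<exists>y. eval f (map s [k..<k + n]) y \<and> u = s(t := y))"
    by (simp add: yieldsD)
qed

lemma map_upt_cong: "(\<And>i. i < n \<Longrightarrow> s (k + i) = s' (k' + i)) \<Longrightarrow> map s [k..<k + n] = map s' [k'..<k' + n]"
  by (rule nth_equalityI) auto

section \<open>Programs for the constructors of recursive functions\<close>

lemma implements_Zero: "\<exists>c. implements Zero_f k n t c"
proof
  show "implements Zero_f k n t skip"
  proof (rule implements_yields)
    fix s :: "nat \<Rightarrow> nat" assume "\<And>r. r \<ge> t \<Longrightarrow> s r = 0"
    then have "s(t := 0) = s" by auto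
    then show "\<exists>y. (\<forall>z. eval Zero_f (map s [k..<k + n]) z \<longleftrightarrow> z = y) \<and> yields skip s (s(t := y))"
      using yields_skip[of s] by (intro exI[of _ 0]) auto
  qed
qed

lemma implements_Proj: "k + n \<le> t \<Longrightarrow> \<exists>c. implements (Proj_f i) k n t c"
proof (cases "i < n")
  case True
  assume "k + n \<le> t"
  show ?thesis
  proof (rule exI, rule implements_yields)
    fix s :: "nat \<Rightarrow> nat" assume s: "\<And>r. r \<ge> t \<Longrightarrow> s r = 0"
    have "yields (cp (k + i) t (Suc t)) s (s(t := s t + s (k + i)))"
      by (rule yields_cp) (use True \<open>k + n \<le> t\<close> s in auto)
    then show "\<exists>y. (\<forall>z. eval (Proj_f i) (map s [k..<k + n]) z \<longleftrightarrow> z = y) \<and>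
        yields (cp (k + i) t (Suc t)) s (s(t := y))"
      using True s by (intro exI[of _ "s (k + i)"]) auto
  qed
next
  case False
  then show ?thesis by (intro exI[of _ fail] implements_fail) auto
qed

lemma implements_Succ: "k + n \<le> t \<Longrightarrow> \<exists>c. implements Succ_f k n t c"
proof (cases n)
  case (Suc n')
  assume "k + n \<le> t"
  show ?thesis
  proof (rule exI, rule implements_yields)
    fix s :: "nat \<Rightarrow> nat" assume s: "\<And>r. r \<ge> t \<Longrightarrow> s r = 0"
    have "yields (cp k t (Suc t)) s (s(t := s t + s k))"
      by (rule yields_cp) (use Suc \<open>k + n \<le> t\<close> s in auto)
    from yields_Seq[OF this yields_Inc[of t]]
    have "yields (cp k t (Suc t) ;; Inc t) s (s(t := Suc (s k)))" using s by simp
    moreover have "[k..<k + n] = k # [Suc k..<k + n]"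
      by (rule upt_conv_Cons) (simp add: Suc)
    then have "map s [k..<k + n] = s k # map s [Suc k..<k + n]" by (simp only: list.map)
    ultimately show "\<exists>y. (\<forall>z. eval Succ_f (map s [k..<k + n]) z \<longleftrightarrow> z = y) \<and>
        yields (cp k t (Suc t) ;; Inc t) s (s(t := y))"
      by (intro exI[of _ "Suc (s k)"]) auto
  qed
next
  case 0
  then show ?thesis by (intro exI[of _ fail] implements_fail) auto
qed

lemma ex_image_conj: "(\<exists>t. (\<exists>y. A y \<and> t = f y) \<and> B t) \<longleftrightarrow> (\<exists>y. A y \<and> B (f y))"
  by blast

lemma ex_Cons_conj:
  "(\<exists>y. A y \<and> (\<exists>ys. B ys \<and> u = f (y # ys))) \<longleftrightarrow>
   (\<exists>ys. (\<exists>z zs. ys = z # zs \<and> A z \<and> B zs) \<and> u = f ys)"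
  by blast

lemma ex_swap_conj: "(\<exists>y. A y \<and> (\<exists>z. B y z \<and> C z)) \<longleftrightarrow> (\<exists>z. (\<exists>y. A y \<and> B y z) \<and> C z)"
  by blast

definition upd :: "(nat \<Rightarrow> nat) \<Rightarrow> nat \<Rightarrow> nat list \<Rightarrow> nat \<Rightarrow> nat" where
  "upd s t ys = (\<lambda>r. if t \<le> r \<and> r < t + length ys then ys ! (r - t) else s r)"

text \<open>The results pile up from register \<open>t\<close> on: the scratch space moves up by one
  with each further function, and since the arguments lie below \<open>t\<close> the stored results
  do not disturb them.\<close>

lemma implements_list:
  assumes "\<And>g k n t. g \<in> set gs \<Longrightarrow> k + n \<le> t \<Longrightarrow> \<exists>c. implements g k n t c" "k + n \<le> t"
  shows "\<exists>c. \<forall>s. (\<forall>r\<ge>t. s r = 0) \<longrightarrow> (\<forall>u. bs c s u \<longleftrightarrow>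
    (\<exists>ys. list_all2 (\<lambda>g y. eval g (map s [k..<k + n]) y) gs ys \<and> u = upd s t ys))"
  using assms
proof (induction gs arbitrary: t)
  case Nil
  have "upd s t [] = s" for s by (auto simp: upd_def)
  then show ?case by (intro exI[of _ skip]) (simp add: yieldsD[OF yields_skip])
next
  case (Cons g gs)
  obtain c1 where c1: "implements g k n t c1"
    using Cons.prems(1)[OF _ Cons.prems(2), of g] by auto
  have "\<exists>c. \<forall>s. (\<forall>r\<ge>Suc t. s r = 0) \<longrightarrow> (\<forall>u. bs c s u \<longleftrightarrow>
    (\<exists>ys. list_all2 (\<lambda>g y. eval g (map s [k..<k + n]) y) gs ys \<and> u = upd s (Suc t) ys))"
  proof (rule Cons.IH)
    show "\<exists>c. implements g' k' n' t' c" if "g' \<in> set gs" "k' + n' \<le> t'" for g' k' n' t'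
      using Cons.prems(1)[of g' k' n' t'] that by simp
    show "k + n \<le> Suc t" using Cons.prems(2) by simp
  qed
  then obtain c2 where c2: "\<And>s u. (\<forall>r\<ge>Suc t. s r = 0) \<Longrightarrow> bs c2 s u \<longleftrightarrow>
    (\<exists>ys. list_all2 (\<lambda>g y. eval g (map s [k..<k + n]) y) gs ys \<and> u = upd s (Suc t) ys)" by blast
  show ?case
  proof (intro exI[of _ "c1 ;; c2"] allI impI)
    fix s u :: "nat \<Rightarrow> nat" assume s: "\<forall>r\<ge>t. s r = 0"
    have args: "map (s(t := y)) [k..<k + n] = map s [k..<k + n]" for y
      using \<open>k + n \<le> t\<close> by auto
    have up: "upd (s(t := y)) (Suc t) ys = upd s t (y # ys)" for y ys
    proof
      fix r
      show "upd (s(t := y)) (Suc t) ys r = upd s t (y # ys) r"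
      proof (cases "r \<le> t")
        case False
        then obtain i where "r = Suc (t + i)" by (metis less_imp_Suc_add not_le)
        then show ?thesis by (simp add: upd_def)
      qed (auto simp: upd_def)
    qed
    have "bs (c1 ;; c2) s u \<longleftrightarrow> (\<exists>y. eval g (map s [k..<k + n]) y \<and> bs c2 (s(t := y)) u)"
    proof -
      have "bs c1 s v \<longleftrightarrow> (\<exists>y. eval g (map s [k..<k + n]) y \<and> v = s(t := y))" for v
        by (rule implementsD[OF c1]) (use s in auto)
      then show ?thesis unfolding bs_simps(3) by (simp only: ex_image_conj)
    qed
    also have "\<dots> \<longleftrightarrow> (\<exists>y. eval g (map s [k..<k + n]) y \<and>
        (\<exists>ys. list_all2 (\<lambda>g y. eval g (map s [k..<k + n]) y) gs ys \<and> u = upd s t (y # ys)))"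
    proof -
      have "bs c2 (s(t := y)) u \<longleftrightarrow> (\<exists>ys. list_all2 (\<lambda>g y. eval g (map s [k..<k + n]) y) gs ys
          \<and> u = upd s t (y # ys))" for y
        using c2[of "s(t := y)" u] s unfolding args up by simp
      then show ?thesis by (simp only:)
    qed
    also have "\<dots> \<longleftrightarrow> (\<exists>ys. list_all2 (\<lambda>g y. eval g (map s [k..<k + n]) y) (g # gs) ys \<and> u = upd s t ys)"
      unfolding list_all2_Cons1 by (rule ex_Cons_conj)
    finally show "bs (c1 ;; c2) s u \<longleftrightarrow> \<dots>" .
  qed
qed

lemma implements_Comp:
  assumes f: "\<And>k n t. k + n \<le> t \<Longrightarrow> \<exists>c. implements f k n t c"
    and gs: "\<And>g k n t. g \<in> set gs \<Longrightarrow> k + n \<le> t \<Longrightarrow> \<exists>c. implements g k n t c" and "k + n \<le> t"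
  shows "\<exists>c. implements (Comp_f f gs) k n t c"
proof -
  define m where "m = length gs"
  have "\<exists>c. \<forall>s. (\<forall>r\<ge>t. s r = 0) \<longrightarrow> (\<forall>u. bs c s u \<longleftrightarrow>
      (\<exists>ys. list_all2 (\<lambda>g y. eval g (map s [k..<k + n]) y) gs ys \<and> u = upd s t ys))"
    by (rule implements_list[OF gs \<open>k + n \<le> t\<close>])
  then obtain c1 where "\<forall>s. (\<forall>r\<ge>t. s r = 0) \<longrightarrow> (\<forall>u. bs c1 s u \<longleftrightarrow>
      (\<exists>ys. list_all2 (\<lambda>g y. eval g (map s [k..<k + n]) y) gs ys \<and> u = upd s t ys))" ..
  then have c1: "\<And>s u. (\<forall>r\<ge>t. s r = 0) \<Longrightarrow> bs c1 s u \<longleftrightarrow>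
    (\<exists>ys. list_all2 (\<lambda>g y. eval g (map s [k..<k + n]) y) gs ys \<and> u = upd s t ys)"
    by (simp only: simp_thms)
  \<comment> \<open>One register stays free between the results and the scratch space, so that the
    source \<open>t + m + 1\<close> and the target \<open>t\<close> of the final move differ even
    for \<open>m = 0\<close>.\<close>
  obtain c2 where c2: "implements f t m (t + m + 1) c2" using f[of t m "t + m + 1"] by auto
  define c3 where "c3 = clrs t (m + 1) ;; mv (t + m + 1) t"
  have "implements (Comp_f f gs) k n t (c1 ;; c2 ;; c3)"
    unfolding implements_def
  proof (intro allI impI)
    fix s u :: "nat \<Rightarrow> nat" assume s: "\<forall>r\<ge>t. s r = 0"
    have 3: "yields c3 ((upd s t ys)(t + m + 1 := z)) (s(t := z))" if "length ys = m" for ys z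
    proof -
      define s1 where "s1 = (upd s t ys)(t + m + 1 := z)"
      define s2 where "s2 = (\<lambda>r. if t \<le> r \<and> r < t + (m + 1) then 0 else s1 r)"
      have "yields c3 s1 (s2(t + m + 1 := 0, t := s2 t + s2 (t + m + 1)))"
        unfolding c3_def s2_def by (rule yields_Seq[OF yields_clrs yields_mv]) simp
      moreover have "s2(t + m + 1 := 0, t := s2 t + s2 (t + m + 1)) = s(t := z)"
      proof
        fix r
        show "(s2(t + m + 1 := 0, t := s2 t + s2 (t + m + 1))) r = (s(t := z)) r"
          using that s[rule_format, of r] by (cases "r < t") (simp_all add: s2_def s1_def upd_def)
      qed
      ultimately show ?thesis by (simp add: s1_def)
    qed
    have 2: "bs (c2 ;; c3) (upd s t ys) u \<longleftrightarrow> (\<exists>z. eval f ys z \<and> u = s(t := z))" if "length ys = m" for ys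
    proof -
      have "map (upd s t ys) [t..<t + m] = ys"
        using that by (intro nth_equalityI) (auto simp: upd_def)
      moreover have "upd s t ys r = 0" if "r \<ge> t + m + 1" for r
        using that s \<open>length ys = m\<close> by (auto simp: upd_def)
      ultimately have "bs c2 (upd s t ys) v \<longleftrightarrow> (\<exists>z. eval f ys z \<and> v = (upd s t ys)(t + m + 1 := z))" for v
        using implementsD[OF c2, of "upd s t ys" v] by (simp only:)
      then have "bs (c2 ;; c3) (upd s t ys) u \<longleftrightarrow> (\<exists>z. eval f ys z \<and> bs c3 ((upd s t ys)(t + m + 1 := z)) u)"
        unfolding bs_simps(3) by (simp only: ex_image_conj)
      then show ?thesis by (simp only: yieldsD[OF 3[OF that]])
    qed
    have "bs (c1 ;; c2 ;; c3) s u \<longleftrightarrow> (\<exists>ys. list_all2 (\<lambda>g y. eval g (map s [k..<k + n]) y) gs ys \<and>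
        bs (c2 ;; c3) (upd s t ys) u)"
      unfolding bs_simps(3)[of c1] c1[OF s] by (rule ex_image_conj)
    also have "\<dots> \<longleftrightarrow> (\<exists>ys. list_all2 (\<lambda>g y. eval g (map s [k..<k + n]) y) gs ys \<and>
        (\<exists>z. eval f ys z \<and> u = s(t := z)))"
    proof -
      have "bs (c2 ;; c3) (upd s t ys) u \<longleftrightarrow> (\<exists>z. eval f ys z \<and> u = s(t := z))"
        if "list_all2 (\<lambda>g y. eval g (map s [k..<k + n]) y) gs ys" for ys
        using 2 list_all2_lengthD[OF that] by (simp add: m_def)
      then show ?thesis by (intro ex_cong1 conj_cong refl)
    qed
    also have "\<dots> \<longleftrightarrow> (\<exists>y. eval (Comp_f f gs) (map s [k..<k + n]) y \<and> u = s(t := y))"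
      unfolding eval_simps by (rule ex_swap_conj)
    finally show "bs (c1 ;; c2 ;; c3) s u \<longleftrightarrow> \<dots>" .
  qed
  then show ?thesis by blast
qed

text \<open>Primitive recursion from 0 upwards with an accumulator, the order in which a loop
  computes it; \<open>eval\<close> unfolds it from the last step.\<close>

fun iter :: "recf \<Rightarrow> nat list \<Rightarrow> nat \<Rightarrow> nat \<Rightarrow> nat \<Rightarrow> nat \<Rightarrow> bool" where
  "iter g xs 0 i acc y \<longleftrightarrow> y = acc"
| "iter g xs (Suc m) i acc y \<longleftrightarrow> (\<exists>z. eval g (i # acc # xs) z \<and> iter g xs m (Suc i) z y)"

lemma iter_snoc: "iter g xs (Suc m) i acc y \<longleftrightarrow> (\<exists>z. iter g xs m i acc z \<and> eval g ((i + m) # z # xs) y)"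
proof (induction m arbitrary: i acc)
  case (Suc m)
  have "iter g xs (Suc (Suc m)) i acc y \<longleftrightarrow> (\<exists>w. eval g (i # acc # xs) w \<and> iter g xs (Suc m) (Suc i) w y)"
    by simp
  also have "\<dots> \<longleftrightarrow> (\<exists>z. iter g xs (Suc m) i acc z \<and> eval g ((i + Suc m) # z # xs) y)"
    unfolding Suc by auto
  finally show ?case .
qed auto

lemma eval_Prec_iter: "eval (Prec_f f g) (m # xs) y \<longleftrightarrow> (\<exists>y0. eval f xs y0 \<and> iter g xs m 0 y0 y)"
proof (induction m arbitrary: y)
  case (Suc m)
  have "eval (Prec_f f g) (Suc m # xs) y \<longleftrightarrow> (\<exists>w. eval (Prec_f f g) (m # xs) w \<and> eval g (m # w # xs) y)"
    by simp
  also have "\<dots> \<longleftrightarrow> (\<exists>y0. eval f xs y0 \<and> iter g xs (Suc m) 0 y0 y)"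
    unfolding Suc iter_snoc by auto
  finally show ?case .
qed simp

lemma implements_Prec:
  assumes f: "\<And>k n t. k + n \<le> t \<Longrightarrow> \<exists>c. implements f k n t c"
    and g: "\<And>k n t. k + n \<le> t \<Longrightarrow> \<exists>c. implements g k n t c" and "k + n \<le> t"
  shows "\<exists>c. implements (Prec_f f g) k n t c"
proof (cases n)
  case 0
  then show ?thesis by (intro exI[of _ fail] implements_fail) auto
next
  case (Suc n')
  define T where "T = t + n' + 3"
  have kt: "k + 1 + n' \<le> t" using assms(3) Suc by simp
  obtain cf where cf: "implements f (k + 1) n' (t + 2) cf" using f[of "k + 1" n' "t + 2"] kt by auto
  obtain cg where cg: "implements g (t + 1) (n' + 2) T cg" using g[of "t + 1" "n' + 2" T] by (auto simp: T_def)
  \<comment> \<open>Register \<open>t\<close> counts the remaining rounds. Index, accumulator and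
    copied parameters follow in the order in which \<open>g\<close> takes its arguments, so that
    \<open>cg\<close> works on consecutive registers.\<close>
  define S where "S s rem i acc = (\<lambda>r. if r = t then rem else if r = t + 1 then i else if r = t + 2 then acc
      else if t + 3 \<le> r \<and> r < t + 3 + n' then s (k + 1 + (r - (t + 3))) else s r)"
    for s :: "nat \<Rightarrow> nat" and rem i acc :: nat
  define init where "init = cps (k + 1) n' (t + 3) T ;; cp k t T"
  define tl where "tl = clr (t + 2) ;; mv T (t + 2) ;; Inc (t + 1)"
  define fin where "fin = clr (t + 1) ;; clrs (t + 3) n' ;; mv (t + 2) t"
  have "implements (Prec_f f g) k n t (cf ;; init ;; Loop t (cg ;; tl) ;; fin)"
    unfolding implements_def
  proof (intro allI impI)
    fix s u :: "nat \<Rightarrow> nat" assume "\<forall>r\<ge>t. s r = 0"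
    then have s0: "s r = 0" if "r \<ge> t" for r using that by simp
    define xs where "xs = map s [k + 1..<k + 1 + n']"
    have init: "yields init (s(t + 2 := y0)) (S s (s k) 0 y0)" for y0
    proof -
      define s1 where "s1 = s(t + 2 := y0)"
      define s2 where "s2 = (\<lambda>r. if t + 3 \<le> r \<and> r < t + 3 + n' then s1 (k + 1 + (r - (t + 3))) else s1 r)"
      have "yields (cps (k + 1) n' (t + 3) T) s1 s2"
        unfolding s2_def by (rule yields_cps) (use kt in \<open>auto simp: T_def s1_def s0\<close>)
      moreover have "yields (cp k t T) s2 (s2(t := s2 t + s2 k))"
        by (rule yields_cp) (use kt in \<open>auto simp: T_def s1_def s2_def s0\<close>)
      moreover have "s2(t := s2 t + s2 k) = S s (s k) 0 y0"
        using kt by (intro ext) (auto simp: s2_def s1_def S_def s0)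
      ultimately show ?thesis unfolding init_def s1_def using yields_Seq by simp
    qed
    have tl: "yields tl ((S s rem i acc)(T := z)) (S s rem (Suc i) z)" for rem i acc z
    proof -
      define s1 where "s1 = (S s rem i acc)(T := z)"
      define s2 where "s2 = s1(t + 2 := 0)"
      define s3 where "s3 = s2(T := 0, t + 2 := s2 (t + 2) + s2 T)"
      have "yields tl s1 (s3(t + 1 := Suc (s3 (t + 1))))"
        unfolding tl_def s3_def s2_def
        by (rule yields_Seq[OF yields_clr yields_Seq[OF yields_mv yields_Inc]]) (simp add: T_def)
      moreover have "s3(t + 1 := Suc (s3 (t + 1))) = S s rem (Suc i) z"
        by (intro ext) (auto simp: s3_def s2_def s1_def S_def s0 T_def)
      ultimately show ?thesis by (simp add: s1_def)
    qed
    have args: "map (S s rem i acc) [t + 1..<t + 1 + (n' + 2)] = i # acc # xs" for rem i acc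
    proof -
      have "[t + 1..<t + 1 + (n' + 2)] = (t + 1) # (t + 2) # [t + 3..<t + 3 + n']"
        by (simp add: upt_conv_Cons numeral_3_eq_3)
      moreover have "map (S s rem i acc) [t + 3..<t + 3 + n'] = xs"
        unfolding xs_def by (rule map_upt_cong) (simp add: S_def)
      ultimately show ?thesis by (simp add: S_def)
    qed
    have body: "bs (cg ;; tl) (S s rem i acc) v \<longleftrightarrow> (\<exists>z. eval g (i # acc # xs) z \<and> v = S s rem (Suc i) z)"
      for rem i acc v
    proof -
      have "bs cg (S s rem i acc) w \<longleftrightarrow> (\<exists>z. eval g (i # acc # xs) z \<and> w = (S s rem i acc)(T := z))" for w
        unfolding args[symmetric, of i acc rem]
        by (rule implementsD[OF cg]) (auto simp: S_def T_def s0)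
      then show ?thesis unfolding bs_simps(3) by (simp only: ex_image_conj yieldsD[OF tl])
    qed
    have loop: "bs (Loop t (cg ;; tl)) (S s rem i acc) v \<longleftrightarrow> (\<exists>y. iter g xs rem i acc y \<and> v = S s 0 (i + rem) y)"
      for rem i acc v
    proof (induction rem arbitrary: i acc)
      case 0
      have "(S s 0 i acc) t = 0" by (simp add: S_def)
      then show ?case by (simp add: bs_Loop0)
    next
      case (Suc rem)
      have "(S s (Suc rem) i acc) t = Suc rem" "(S s (Suc rem) i acc)(t := rem) = S s rem i acc"
        by (auto simp: S_def)
      then have "bs (Loop t (cg ;; tl)) (S s (Suc rem) i acc) v \<longleftrightarrow>
          (\<exists>w. bs (cg ;; tl) (S s rem i acc) w \<and> bs (Loop t (cg ;; tl)) w v)"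
        by (simp add: bs_LoopS)
      also have "\<dots> \<longleftrightarrow> (\<exists>z. eval g (i # acc # xs) z \<and> (\<exists>y. iter g xs rem (Suc i) z y \<and> v = S s 0 (Suc i + rem) y))"
        by (simp only: body ex_image_conj Suc)
      also have "\<dots> \<longleftrightarrow> (\<exists>y. (\<exists>z. eval g (i # acc # xs) z \<and> iter g xs rem (Suc i) z y) \<and> v = S s 0 (Suc i + rem) y)"
        by (rule ex_swap_conj)
      finally show ?case by simp
    qed
    have fin: "yields fin (S s 0 i y) (s(t := y))" for i y
    proof -
      define s2 where "s2 = (\<lambda>r. if t + 3 \<le> r \<and> r < t + 3 + n' then 0 else ((S s 0 i y)(t + 1 := 0)) r)"
      have "yields fin (S s 0 i y) (s2(t + 2 := 0, t := s2 t + s2 (t + 2)))"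
        unfolding fin_def s2_def by (rule yields_Seq[OF yields_clr yields_Seq[OF yields_clrs yields_mv]]) simp
      moreover have "s2(t + 2 := 0, t := s2 t + s2 (t + 2)) = s(t := y)"
        by (intro ext) (auto simp: s2_def S_def s0)
      ultimately show ?thesis by simp
    qed
    have cf': "bs cf s v \<longleftrightarrow> (\<exists>y0. eval f xs y0 \<and> v = s(t + 2 := y0))" for v
      unfolding xs_def by (rule implementsD[OF cf]) (simp add: s0)
    have "[k..<k + n] = k # [k + 1..<k + 1 + n']" using Suc by (simp add: upt_conv_Cons)
    then have args': "map s [k..<k + n] = s k # xs" unfolding xs_def by (simp only: list.map)
    have "bs (cf ;; init ;; Loop t (cg ;; tl) ;; fin) s u \<longleftrightarrow>
        (\<exists>y0. eval f xs y0 \<and> bs (Loop t (cg ;; tl) ;; fin) (S s (s k) 0 y0) u)"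
      unfolding bs_simps(3)[of cf] cf' ex_image_conj bs_yields_Seq[OF init] ..
    also have "\<dots> \<longleftrightarrow> (\<exists>y0. eval f xs y0 \<and> (\<exists>y. iter g xs (s k) 0 y0 y \<and> u = s(t := y)))"
      unfolding bs_simps(3)[of "Loop t (cg ;; tl)"] loop ex_image_conj yieldsD[OF fin] ..
    also have "\<dots> \<longleftrightarrow> (\<exists>y. (\<exists>y0. eval f xs y0 \<and> iter g xs (s k) 0 y0 y) \<and> u = s(t := y))"
      by (rule ex_swap_conj)
    finally show "bs (cf ;; init ;; Loop t (cg ;; tl) ;; fin) s u \<longleftrightarrow>
        (\<exists>y. eval (Prec_f f g) (map s [k..<k + n]) y \<and> u = s(t := y))"
      unfolding args' eval_Prec_iter .
  qed
  then show ?thesis by blast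
qed

lemma implements_Mn:
  assumes f: "\<And>k n t. k + n \<le> t \<Longrightarrow> \<exists>c. implements f k n t c" and "k + n \<le> t"
  shows "\<exists>c. implements (Mn_f f) k n t c"
proof -
  define T where "T = t + n + 2"
  obtain cf where cf: "implements f (t + 1) (n + 1) T cf" using f[of "t + 1" "n + 1" T] by (auto simp: T_def)
  \<comment> \<open>Register \<open>t\<close> is the flag that keeps the search running, and
    \<open>t + 1\<close> holds the candidate.\<close>
  define S where "S s fl m = (\<lambda>r. if r = t then fl else if r = t + 1 then m
      else if t + 2 \<le> r \<and> r < t + 2 + n then s (k + (r - (t + 2))) else s r)"
    for s :: "nat \<Rightarrow> nat" and fl m :: nat
  define init where "init = cps k n (t + 2) T ;; Inc t"
  \<comment> \<open>A loop in the role of a conditional: its body clears \<open>T\<close> and so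
    runs at most once. It sets the flag again only if the value of \<open>f\<close> at the candidate
    is positive.\<close>
  define L where "L = Loop T (clr T ;; Inc t ;; Inc (t + 1))"
  define fin where "fin = clrs (t + 2) n ;; mv (t + 1) t"
  have "implements (Mn_f f) k n t (init ;; Loop t (cf ;; L) ;; fin)"
    unfolding implements_def
  proof (intro allI impI)
    fix s u :: "nat \<Rightarrow> nat" assume "\<forall>r\<ge>t. s r = 0"
    then have s0: "s r = 0" if "r \<ge> t" for r using that by simp
    define xs where "xs = map s [k..<k + n]"
    have init: "yields init s (S s 1 0)"
    proof -
      define s2 where "s2 = (\<lambda>r. if t + 2 \<le> r \<and> r < t + 2 + n then s (k + (r - (t + 2))) else s r)"
      have "yields (cps k n (t + 2) T) s s2"
        unfolding s2_def by (rule yields_cps) (use assms(2) in \<open>auto simp: T_def s0\<close>)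
      moreover have "s2(t := Suc (s2 t)) = S s 1 0"
        by (intro ext) (auto simp: s2_def S_def s0)
      ultimately show ?thesis unfolding init_def using yields_Seq[OF _ yields_Inc[of t s2]] by simp
    qed
    have L: "yields L ((S s 0 m)(T := z)) (if z = 0 then S s 0 m else S s 1 (Suc m))" for m z
    proof (cases "z = 0")
      case True
      have "(S s 0 m)(T := 0) = S s 0 m" by (intro ext) (simp add: S_def T_def s0)
      moreover have "yields L ((S s 0 m)(T := 0)) ((S s 0 m)(T := 0))"
        unfolding L_def by (rule yields_Loop0) simp
      ultimately show ?thesis using True by simp
    next
      case False
      define s1 where "s1 = ((S s 0 m)(T := z))(T := ((S s 0 m)(T := z)) T - 1)"
      define s2 where "s2 = s1(T := 0)"
      define s3 where "s3 = s2(t := Suc (s2 t))"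
      define s4 where "s4 = s3(t + 1 := Suc (s3 (t + 1)))"
      have d1: "yields (clr T ;; Inc t ;; Inc (t + 1)) s1 s4"
        unfolding s4_def s3_def s2_def by (rule yields_Seq[OF yields_clr yields_Seq[OF yields_Inc yields_Inc]])
      have s4: "s4 = S s 1 (Suc m)"
        by (intro ext) (auto simp: s4_def s3_def s2_def s1_def S_def T_def s0)
      have d2: "yields L s4 s4"
        unfolding L_def by (rule yields_Loop0) (simp add: s4 S_def T_def s0)
      have "yields L ((S s 0 m)(T := z)) s4"
        unfolding L_def
      proof (rule yields_LoopS)
        show "((S s 0 m)(T := z)) T > 0" using False by simp
        show "yields (clr T ;; Inc t ;; Inc (t + 1)) (((S s 0 m)(T := z))(T := ((S s 0 m)(T := z)) T - 1)) s4"
          using d1 unfolding s1_def .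
        show "yields (Loop T (clr T ;; Inc t ;; Inc (t + 1))) s4 s4" using d2 unfolding L_def .
      qed
      then show ?thesis using False unfolding s4 by (simp only: if_False)
    qed
    have args: "map (S s 0 m) [t + 1..<t + 1 + (n + 1)] = m # xs" for m
    proof -
      have "[t + 1..<t + 1 + (n + 1)] = (t + 1) # [t + 2..<t + 2 + n]"
        by (simp add: upt_conv_Cons)
      moreover have "map (S s 0 m) [t + 2..<t + 2 + n] = xs"
        unfolding xs_def by (rule map_upt_cong) (simp add: S_def)
      ultimately show ?thesis by (simp add: S_def)
    qed
    have body: "bs (cf ;; L) (S s 0 m) v \<longleftrightarrow>
        (\<exists>z. eval f (m # xs) z \<and> v = (if z = 0 then S s 0 m else S s 1 (Suc m)))" for m v
    proof -
      have "bs cf (S s 0 m) w \<longleftrightarrow> (\<exists>z. eval f (m # xs) z \<and> w = (S s 0 m)(T := z))" for w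
        unfolding args[symmetric, of m]
        by (rule implementsD[OF cf]) (auto simp: S_def T_def s0)
      then show ?thesis unfolding bs_simps(3) by (simp only: ex_image_conj yieldsD[OF L])
    qed
    define W where "W = Loop t (cf ;; L)"
    have S1: "(S s 1 m) t = 1" "(S s 1 m)(t := 0) = S s 0 m" "(S s 0 m) t = 0" for m
      by (auto simp: S_def)
    have W0: "bs W (S s 0 m) v \<longleftrightarrow> v = S s 0 m" for m v
      unfolding W_def by (rule bs_Loop0) (simp add: S_def)
    have W1: "bs W (S s 1 m) v \<longleftrightarrow> (\<exists>z. eval f (m # xs) z \<and> (if z = 0 then v = S s 0 m else bs W (S s 1 (Suc m)) v))"
      for m v
    proof -
      have "bs W (S s 1 m) v \<longleftrightarrow> (\<exists>w. bs (cf ;; L) (S s 0 m) w \<and> bs W w v)"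
        unfolding W_def using bs_LoopS[of "S s 1 m" t "cf ;; L" v] S1[of m] by simp
      also have "\<dots> \<longleftrightarrow> (\<exists>z. eval f (m # xs) z \<and> bs W (if z = 0 then S s 0 m else S s 1 (Suc m)) v)"
        by (simp only: body ex_image_conj)
      finally show ?thesis by (simp only: if_distrib[of "\<lambda>w. bs W w v"] W0)
    qed
    \<comment> \<open>The number of rounds is not known in advance, so this direction goes by
      induction on the derivation of \<open>bs\<close>.\<close>
    have down: "\<exists>N\<ge>m. eval f (N # xs) 0 \<and> (\<forall>j. m \<le> j \<and> j < N \<longrightarrow> (\<exists>y. eval f (j # xs) y \<and> y > 0)) \<and> v = S s 0 N"
      if "bs W (S s 1 m) v" for m v
    proof -
      have "c = W \<Longrightarrow> a = S s 1 m \<Longrightarrow> \<exists>N\<ge>m. eval f (N # xs) 0 \<and>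
          (\<forall>j. m \<le> j \<and> j < N \<longrightarrow> (\<exists>y. eval f (j # xs) y \<and> y > 0)) \<and> b = S s 0 N"
        if "bs c a b" for c a b
        using that
      proof (induction arbitrary: m)
        case (Loop0 a r c)
        then show ?case using S1(1) by (simp add: W_def)
      next
        case (LoopS a r c w b)
        have eqs: "r = t" "c = cf ;; L" using LoopS.prems by (auto simp: W_def)
        have "bs (cf ;; L) (S s 0 m) w" using LoopS.hyps(2) LoopS.prems(2) S1[of m] eqs by simp
        then obtain z where z: "eval f (m # xs) z" "w = (if z = 0 then S s 0 m else S s 1 (Suc m))"
          unfolding body by blast
        show ?case
        proof (cases "z = 0")
          case True
          then have "bs W (S s 0 m) b" using LoopS.hyps(3) LoopS.prems(1) z(2) by simp
          then have "b = S s 0 m" by (simp only: W0)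
          then show ?thesis using z(1) True by (intro exI[of _ m]) auto
        next
          case False
          then obtain N where N: "N \<ge> Suc m" "eval f (N # xs) 0"
            "\<forall>j. Suc m \<le> j \<and> j < N \<longrightarrow> (\<exists>y. eval f (j # xs) y \<and> y > 0)" "b = S s 0 N"
            using LoopS.IH(2)[of "Suc m"] LoopS.prems(1) z(2) by auto
          have "\<exists>y. eval f (j # xs) y \<and> y > 0" if "m \<le> j" "j < N" for j
            using N(3) z(1) False that by (cases "j = m") auto
          then show ?thesis using N by (intro exI[of _ N]) simp
        qed
      qed (simp_all add: W_def)
      from this[OF that refl refl] show ?thesis .
    qed
    \<comment> \<open>Here the result \<open>N\<close> of the search is given, and the induction
      counts back from it.\<close>
    have up: "bs W (S s 1 (N - d)) (S s 0 N)"
      if a1: "eval f (N # xs) 0" and a2: "\<forall>j<N. \<exists>y. eval f (j # xs) y \<and> y > 0" and a3: "d \<le> N" for N d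
      using a3
    proof (induction d)
      case 0
      then show ?case unfolding W1[of "N - 0"] using a1 by (intro exI[of _ 0]) simp
    next
      case (Suc d)
      obtain y where y: "eval f ((N - Suc d) # xs) y" "y > 0"
        using a2[rule_format, of "N - Suc d"] Suc.prems by auto
      have e: "Suc (N - Suc d) = N - d" using Suc.prems by simp
      have "bs W (S s 1 (N - d)) (S s 0 N)" by (rule Suc.IH) (use Suc.prems in simp)
      then have "if y = 0 then S s 0 N = S s 0 (N - Suc d) else bs W (S s 1 (Suc (N - Suc d))) (S s 0 N)"
        using y(2) unfolding e by (metis less_numeral_extra(3))
      with y(1) show ?case unfolding W1[of "N - Suc d"] by (intro exI[of _ y] conjI)
    qed
    have W: "bs W (S s 1 0) v \<longleftrightarrow> (\<exists>y. eval (Mn_f f) xs y \<and> v = S s 0 y)" for v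
    proof
      assume "bs W (S s 1 0) v"
      from down[OF this] show "\<exists>y. eval (Mn_f f) xs y \<and> v = S s 0 y" by auto
    next
      assume "\<exists>y. eval (Mn_f f) xs y \<and> v = S s 0 y"
      then obtain y where "eval f (y # xs) 0" "\<forall>j<y. \<exists>w. eval f (j # xs) w \<and> w > 0" "v = S s 0 y" by auto
      with up[of y y] show "bs W (S s 1 0) v" by simp
    qed
    have fin: "yields fin (S s 0 y) (s(t := y))" for y
    proof -
      define s2 where "s2 = (\<lambda>r. if t + 2 \<le> r \<and> r < t + 2 + n then 0 else (S s 0 y) r)"
      have "yields fin (S s 0 y) (s2(t + 1 := 0, t := s2 t + s2 (t + 1)))"
        unfolding fin_def s2_def by (rule yields_Seq[OF yields_clrs yields_mv]) simp
      moreover have "s2(t + 1 := 0, t := s2 t + s2 (t + 1)) = s(t := y)"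
        by (intro ext) (auto simp: s2_def S_def s0)
      ultimately show ?thesis by simp
    qed
    show "bs (init ;; Loop t (cf ;; L) ;; fin) s u \<longleftrightarrow>
        (\<exists>y. eval (Mn_f f) (map s [k..<k + n]) y \<and> u = s(t := y))"
      unfolding xs_def[symmetric] bs_yields_Seq[OF init] W_def[symmetric] bs_simps(3)[of W] W ex_image_conj
        yieldsD[OF fin] ..
  qed
  then show ?thesis by blast
qed

theorem implements_recf: "k + n \<le> t \<Longrightarrow> \<exists>c. implements f k n t c"
proof (induction f arbitrary: k n t)
  case (Comp_f f gs)
  then show ?case by (intro implements_Comp)
next
  case (Prec_f f g)
  then show ?case by (intro implements_Prec)
next
  case (Mn_f f)
  then show ?case by (intro implements_Mn)
qed (simp_all add: implements_Zero implements_Succ implements_Proj)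

definition input_store :: "nat \<Rightarrow> nat \<Rightarrow> nat" where
  "input_store x = (\<lambda>r. 0)(0 := x)"

text \<open>Clearing the input and the result makes the final store independent of the run. This
  permits one fixed word as the final configuration of the queue automaton.\<close>

theorem counter_program:
  "\<exists>c. \<forall>x u. bs c (input_store x) u \<longleftrightarrow> (\<exists>y. eval f [x] y) \<and> u = (\<lambda>r. 0)"
proof -
  obtain c where c: "implements f 0 1 1 c" using implements_recf[of 0 1 1 f] by auto
  define d where "d = c ;; clr 0 ;; clr 1"
  have *: "bs d (input_store x) u \<longleftrightarrow> (\<exists>y. eval f [x] y) \<and> u = (\<lambda>r. 0)" for x u
  proof -
    have 1: "bs c (input_store x) v \<longleftrightarrow> (\<exists>y. eval f [x] y \<and> v = (input_store x)(1 := y))" for v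
      using implementsD[OF c, of "input_store x" v] by (simp add: input_store_def)
    have 2: "yields (clr 0 ;; clr 1) ((input_store x)(1 := y)) (\<lambda>r. 0)" for y
    proof -
      have "(((input_store x)(1 := y))(0 := 0))(1 := 0) = (\<lambda>r. 0)"
        by (intro ext) (simp add: input_store_def)
      then show ?thesis using yields_Seq[OF yields_clr[of 0 "(input_store x)(1 := y)"] yields_clr[of 1]] by simp
    qed
    show ?thesis unfolding d_def bs_simps(3)[of c] 1 ex_image_conj yieldsD[OF 2] by blast
  qed
  then show "\<exists>c. \<forall>x u. bs c (input_store x) u \<longleftrightarrow> (\<exists>y. eval f [x] y) \<and> u = (\<lambda>r. 0)" by blast
qed

section \<open>From counter programs to counter machines\<close>

text \<open>The last arguments are the jump targets; for DJZ, first the one for register content 0.\<close>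

datatype instr = INC nat nat | DJZ nat nat nat

fun clen :: "com \<Rightarrow> nat" where
  "clen (Inc r) = 1"
| "clen (Dec r) = 1"
| "clen (c ;; d) = clen c + clen d"
| "clen (Loop r c) = Suc (clen c)"

text \<open>\<open>off\<close> is the address of the first instruction and \<open>ex\<close> the
  address at which execution continues. A decrement is a test with equal targets; the body of a loop
  continues at the test of the loop.\<close>

fun compile :: "com \<Rightarrow> nat \<Rightarrow> nat \<Rightarrow> instr list" where
  "compile (Inc r) off ex = [INC r ex]"
| "compile (Dec r) off ex = [DJZ r ex ex]"
| "compile (c ;; d) off ex = compile c off (off + clen c) @ compile d (off + clen c) ex"
| "compile (Loop r c) off ex = DJZ r ex (Suc off) # compile c (Suc off) off"

lemma length_compile [simp]: "length (compile c off ex) = clen c"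
  by (induction c arbitrary: off ex) auto

lemma clen_pos: "clen c > 0"
  by (induction c) auto

fun istep :: "instr \<Rightarrow> (nat \<Rightarrow> nat) \<Rightarrow> nat \<times> (nat \<Rightarrow> nat)" where
  "istep (INC r l) s = (l, s(r := Suc (s r)))"
| "istep (DJZ r lz lp) s = (if s r = 0 then (lz, s) else (lp, s(r := s r - 1)))"

lemma istep_Dec: "istep (DJZ r l l) s = (l, s(r := s r - 1))"
  by (auto simp: fun_eq_iff)

fun reach :: "instr list \<Rightarrow> nat \<Rightarrow> nat \<times> (nat \<Rightarrow> nat) \<Rightarrow> nat \<times> (nat \<Rightarrow> nat) \<Rightarrow> bool" where
  "reach P 0 a b \<longleftrightarrow> a = b"
| "reach P (Suc k) a b \<longleftrightarrow> fst a < length P \<and> reach P k (istep (P ! fst a) (snd a)) b"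

lemma reach_trans: "reach P j a b \<Longrightarrow> reach P k b c \<Longrightarrow> reach P (j + k) a c"
  by (induction j arbitrary: a) auto

definition code_at :: "instr list \<Rightarrow> nat \<Rightarrow> com \<Rightarrow> nat \<Rightarrow> bool" where
  "code_at P off c ex \<longleftrightarrow> (\<exists>pre post. P = pre @ compile c off ex @ post \<and> length pre = off)"

lemma code_at_nth: "code_at P off c ex \<Longrightarrow> off < length P \<and> P ! off = hd (compile c off ex)"
  using clen_pos[of c] by (cases "compile c off ex") (auto simp: code_at_def dest: arg_cong[of _ _ length])

lemma code_at_SeqD:
  assumes "code_at P off (c ;; d) ex"
  shows "code_at P off c (off + clen c)" "code_at P (off + clen c) d ex"
proof -
  obtain pre post where P: "P = pre @ compile (c ;; d) off ex @ post" "length pre = off"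
    using assms by (auto simp: code_at_def)
  show "code_at P off c (off + clen c)" unfolding code_at_def
    using P by (intro exI[of _ pre] exI[of _ "compile d (off + clen c) ex @ post"]) simp
  show "code_at P (off + clen c) d ex" unfolding code_at_def
    using P by (intro exI[of _ "pre @ compile c off (off + clen c)"] exI[of _ post]) simp
qed

lemma code_at_LoopD:
  assumes "code_at P off (Loop r c) ex"
  shows "code_at P (Suc off) c off"
proof -
  obtain pre post where P: "P = pre @ compile (Loop r c) off ex @ post" "length pre = off"
    using assms by (auto simp: code_at_def)
  then show ?thesis unfolding code_at_def
    by (intro exI[of _ "pre @ [DJZ r ex (Suc off)]"] exI[of _ post]) simp
qed

lemma reach_if_bs: "bs c s u \<Longrightarrow> code_at P off c ex \<Longrightarrow> \<exists>k. reach P k (off, s) (ex, u)"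
proof (induction arbitrary: off ex rule: bs.induct)
  case (Inc r s)
  then show ?case using code_at_nth[OF Inc] by (intro exI[of _ 1]) (simp add: fun_upd_def)
next
  case (Dec r s)
  then show ?case using code_at_nth[OF Dec]
    by (intro exI[of _ 1]) (simp add: istep_Dec fun_upd_def del: istep.simps)
next
  case (Seq c s t d u)
  from Seq.IH(1)[OF code_at_SeqD(1)[OF Seq.prems]] Seq.IH(2)[OF code_at_SeqD(2)[OF Seq.prems]]
  show ?case using reach_trans by blast
next
  case (Loop0 s r c)
  then show ?case using code_at_nth[OF Loop0(2)] by (intro exI[of _ 1]) simp
next
  case (LoopS s r c t u)
  obtain j where j: "reach P j (Suc off, s(r := s r - 1)) (off, t)"
    using LoopS.IH(1)[OF code_at_LoopD[OF LoopS.prems]] by blast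
  obtain k where k: "reach P k (off, t) (ex, u)"
    using LoopS.IH(2)[OF LoopS.prems] by blast
  have "reach P (Suc j) (off, s) (off, t)"
    using j LoopS.hyps(1) code_at_nth[OF LoopS.prems] by simp
  from reach_trans[OF this k] show ?case by blast
qed

text \<open>A run that gets to the end of the program has to leave the code of \<open>c\<close>
  through its exit. The bound on \<open>j\<close> carries the inner induction over the rounds of a
  loop.\<close>

lemma bs_if_reach:
  "reach P k (off, s) (length P, u) \<Longrightarrow> code_at P off c ex \<Longrightarrow>
   \<exists>t j. j < k \<and> bs c s t \<and> reach P j (ex, t) (length P, u)"
proof (induction c arbitrary: k off ex s)
  case (Inc r)
  then obtain j where "k = Suc j" using code_at_nth[OF Inc(2)] by (cases k) auto
  with Inc code_at_nth[OF Inc(2)] show ?case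
    by (intro exI[of _ "s(r := Suc (s r))"] exI[of _ j]) (simp add: bs_simps fun_upd_def)
next
  case (Dec r)
  then obtain j where "k = Suc j" using code_at_nth[OF Dec(2)] by (cases k) auto
  then show ?case using Dec code_at_nth[OF Dec(2)]
    by (intro exI[of _ "s(r := s r - 1)"] exI[of _ j]) (simp add: bs_simps istep_Dec fun_upd_def del: istep.simps)
next
  case (Seq c d)
  obtain t j where 1: "j < k" "bs c s t" "reach P j (off + clen c, t) (length P, u)"
    using Seq.IH(1)[OF Seq.prems(1) code_at_SeqD(1)[OF Seq.prems(2)]] by blast
  obtain w i where 2: "i < j" "bs d t w" "reach P i (ex, w) (length P, u)"
    using Seq.IH(2)[OF 1(3) code_at_SeqD(2)[OF Seq.prems(2)]] by blast
  show ?case using 1 2 bs.Seq[of c s t d w] by (intro exI[of _ w] exI[of _ i]) simp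
next
  case (Loop r c)
  show ?case using Loop.prems(1)
  proof (induction k arbitrary: s rule: less_induct)
    case (less k)
    note at = code_at_nth[OF Loop.prems(2)]
    then obtain j where k: "k = Suc j" using less.prems by (cases k) auto
    show ?case
    proof (cases "s r = 0")
      case True
      then have "reach P j (ex, s) (length P, u)" using less.prems at k by simp
      then show ?thesis using bs.Loop0[of s r c] True k by (intro exI[of _ s] exI[of _ j]) simp
    next
      case False
      then have "reach P j (Suc off, s(r := s r - 1)) (length P, u)" using less.prems at k by simp
      from Loop.IH[OF this code_at_LoopD[OF Loop.prems(2)]] obtain t i where
        1: "i < j" "bs c (s(r := s r - 1)) t" "reach P i (off, t) (length P, u)" by blast
      obtain w l where 2: "l < i" "bs (Loop r c) t w" "reach P l (ex, w) (length P, u)"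
        using less.IH[OF _ 1(3)] 1(1) k by auto
      have "bs (Loop r c) s w" using bs.LoopS[OF _ 1(2) 2(2)] False by simp
      then show ?thesis using 1 2 k by (intro exI[of _ w] exI[of _ l]) simp
    qed
  qed
qed

fun iregs :: "instr \<Rightarrow> nat set" where
  "iregs (INC r l) = {r}" | "iregs (DJZ r l l') = {r}"
fun itargets :: "instr \<Rightarrow> nat set" where
  "itargets (INC r l) = {l}" | "itargets (DJZ r l l') = {l, l'}"

lemma compile_targets:
  "off + clen c \<le> N \<Longrightarrow> ex \<le> N \<Longrightarrow> i \<in> set (compile c off ex) \<Longrightarrow> itargets i \<subseteq> {..N}"
proof (induction c arbitrary: off ex)
  case (Seq c d)
  then consider "i \<in> set (compile c off (off + clen c))" | "i \<in> set (compile d (off + clen c) ex)" by auto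
  then show ?case
    using Seq.IH(1)[of off "off + clen c"] Seq.IH(2)[of "off + clen c" ex] Seq.prems(1,2) by cases simp_all
next
  case (Loop r c)
  then consider "i = DJZ r ex (Suc off)" | "i \<in> set (compile c (Suc off) off)" by auto
  then show ?case using Loop.IH[of "Suc off" off] Loop.prems(1,2) by cases simp_all
qed auto

theorem counter_machine:
  "\<exists>P. (\<forall>i\<in>set P. itargets i \<subseteq> {..length P}) \<and>
    (\<forall>x. (\<exists>y. eval f [x] y) \<longleftrightarrow> (\<exists>k u. reach P k (0, input_store x) (length P, u))) \<and>
    (\<forall>x k u. reach P k (0, input_store x) (length P, u) \<longrightarrow> u = (\<lambda>r. 0))"
proof -
  obtain c where c: "\<And>x u. bs c (input_store x) u \<longleftrightarrow> (\<exists>y. eval f [x] y) \<and> u = (\<lambda>r. 0)"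
    using counter_program[of f] by metis
  define P where "P = compile c 0 (clen c)"
  have len: "length P = clen c" by (simp add: P_def)
  have at: "code_at P 0 c (length P)"
    unfolding code_at_def len by (intro exI[of _ "[]"]) (simp add: P_def)
  have bs: "bs c (input_store x) u" if r: "reach P k (0, input_store x) (length P, u)" for x k u
  proof -
    obtain t j where *: "bs c (input_store x) t" "reach P j (length P, t) (length P, u)"
      using bs_if_reach[OF r at] by blast
    then have "u = t" by (cases j) auto
    with * show ?thesis by simp
  qed
  show ?thesis
  proof (intro exI[of _ P] conjI ballI allI impI iffI)
    show "itargets i \<subseteq> {..length P}" if "i \<in> set P" for i
      using compile_targets[of 0 c "length P" "length P" i] that by (simp add: P_def)
    show "\<exists>k u. reach P k (0, input_store x) (length P, u)" if "\<exists>y. eval f [x] y" for x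
      using reach_if_bs[OF _ at, of "input_store x" "\<lambda>r. 0"] c[of x] that by blast
    show "\<exists>y. eval f [x] y" if "\<exists>k u. reach P k (0, input_store x) (length P, u)" for x
      using bs c[of x] that by blast
    show "u = (\<lambda>r. 0)" if "reach P k (0, input_store x) (length P, u)" for x k u
      using bs[OF that] c[of x] by blast
  qed
qed

section \<open>From counter machines to queue automata\<close>

text \<open>Unary contents, each closed by \<open>False\<close>, so that a finite control finds a
  register by counting terminators.\<close>

definition cells :: "(nat \<Rightarrow> nat) \<Rightarrow> nat \<Rightarrow> nat \<Rightarrow> bool list" where
  "cells s i j = concat (map (\<lambda>r. replicate (s r) True @ [False]) [i..<j])"

lemma cells_Cons: "i < j \<Longrightarrow> cells s i j = replicate (s i) True @ False # cells s (Suc i) j"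
  by (simp add: cells_def upt_conv_Cons)

lemma cells_snoc: "i \<le> j \<Longrightarrow> cells s i (Suc j) = cells s i j @ replicate (s j) True @ [False]"
  by (simp add: cells_def)

lemma cells_append: "i \<le> j \<Longrightarrow> j \<le> k \<Longrightarrow> cells s i k = cells s i j @ cells s j k"
  using upt_add_eq_append[of i j "k - j"] by (simp add: cells_def)

lemma cells_empty [simp]: "cells s i i = []"
  by (simp add: cells_def)

lemma cells_cong: "(\<And>r. i \<le> r \<Longrightarrow> r < j \<Longrightarrow> s r = s' r) \<Longrightarrow> cells s i j = cells s' i j"
  unfolding cells_def by (intro arg_cong[of _ _ concat] map_cong) auto

text \<open>A configuration (q, x # X) of a queue automaton with transition function d is followed by
  (q', X @ w), where d q x = (q', w).\<close>

fun qr :: "(nat \<Rightarrow> bool \<Rightarrow> nat \<times> bool list) \<Rightarrow> (nat \<Rightarrow> bool) \<Rightarrow> nat \<Rightarrow> nat \<times> bool list \<Rightarrow> nat \<times> bool list \<Rightarrow> bool" where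
  "qr d ok 0 a b \<longleftrightarrow> a = b"
| "qr d ok (Suc k) a b \<longleftrightarrow> ok (fst a) \<and> snd a \<noteq> [] \<and>
     qr d ok k (fst (d (fst a) (hd (snd a))), tl (snd a) @ snd (d (fst a) (hd (snd a)))) b"

lemma qr_trans: "qr d ok j a b \<Longrightarrow> qr d ok k b c \<Longrightarrow> qr d ok (j + k) a c"
  by (induction j arbitrary: a) auto

definition qrs where "qrs d ok a b \<longleftrightarrow> (\<exists>k. qr d ok k a b)"
text \<open>Strict progress in every instruction later makes the length of an accepting walk a bound
  for the run of the counter machine.\<close>

definition qrp where "qrp d ok a b \<longleftrightarrow> (\<exists>k>0. qr d ok k a b)"

lemma qrs_refl: "qrs d ok a a"
  unfolding qrs_def by (rule exI[of _ 0]) simp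

lemma qrs_trans: "qrs d ok a b \<Longrightarrow> qrs d ok b c \<Longrightarrow> qrs d ok a c"
  unfolding qrs_def using qr_trans by blast

lemma qrs_qrp: "qrs d ok a b \<Longrightarrow> qrp d ok b c \<Longrightarrow> qrp d ok a c"
  unfolding qrs_def qrp_def by (metis add_gr_0 qr_trans)

lemma qrp_qrs: "qrp d ok a b \<Longrightarrow> qrs d ok b c \<Longrightarrow> qrp d ok a c"
  unfolding qrs_def qrp_def by (metis add_gr_0 qr_trans)

lemma qrp_qrs': "qrp d ok a b \<Longrightarrow> qrs d ok a b"
  unfolding qrs_def qrp_def by blast

lemma qrp_step: "ok q \<Longrightarrow> d q x = (q', w) \<Longrightarrow> qrp d ok (q, x # X) (q', X @ w)"
  unfolding qrp_def by (rule exI[of _ 1]) simp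

lemma qrs_copy:
  assumes "ok q" "d q True = (q, [True])"
  shows "qrs d ok (q, replicate n True @ Y) (q, Y @ replicate n True)"
proof (induction n arbitrary: Y)
  case 0
  then show ?case by (simp add: qrs_refl)
next
  case (Suc n)
  have "qrs d ok (q, True # replicate n True @ Y) (q, (replicate n True @ Y) @ [True])"
    by (rule qrp_qrs'[OF qrp_step]) (use assms in auto)
  moreover have "qrs d ok (q, replicate n True @ (Y @ [True])) (q, (Y @ [True]) @ replicate n True)"
    by (rule Suc)
  ultimately have "qrs d ok (q, True # replicate n True @ Y) (q, Y @ True # replicate n True)"
    using qrs_trans[of d ok _ "(q, replicate n True @ Y @ [True])"] by simp
  then show ?case by simp
qed

locale machine =
  fixes P :: "instr list" and K :: nat
  assumes targets: "i \<in> set P \<Longrightarrow> itargets i \<subseteq> {..length P}"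
    and regs: "i \<in> set P \<Longrightarrow> iregs i \<subseteq> {..<K}"
    and K: "K > 0"
begin

text \<open>States are numbers because they will index a table; parity separates the two modes. Once
  all \<open>K\<close> registers have been rotated the queue is back in order, and
  \<open>gto\<close> enters the start of the next instruction.\<close>

definition stA :: "nat \<Rightarrow> nat \<Rightarrow> nat" where "stA pc i = 2 * (pc * Suc K + i)"
definition stG :: "nat \<Rightarrow> nat \<Rightarrow> nat" where "stG pc i = Suc (2 * (pc * Suc K + i))"
definition gto :: "nat \<Rightarrow> nat \<Rightarrow> nat" where "gto l i = (if i = K then stA l 0 else stG l i)"

text \<open>In state stA pc i, the automaton has passed i registers and is looking for the register of
  the instruction at pc; in state stG pc i it only rotates the remaining registers before going on
  with the instruction at pc.\<close>

definition d :: "nat \<Rightarrow> bool \<Rightarrow> nat \<times> bool list" where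
  "d q x = (let pc = q div 2 div Suc K; i = q div 2 mod Suc K in
     if odd q then if x then (q, [True]) else (gto pc (Suc i), [False])
     else (case P ! pc of
         INC r l \<Rightarrow> if x then (q, [True]) else if i = r then (gto l (Suc i), [True, False]) else (stA pc (Suc i), [False])
       | DJZ r lz lp \<Rightarrow> if i = r then if x then (stG lp i, []) else (gto lz (Suc i), [False])
           else if x then (q, [True]) else (stA pc (Suc i), [False])))"

definition M :: nat where "M = 2 * (Suc (length P) * Suc K)"
definition qf :: nat where "qf = stA (length P) 0"
definition ok :: "nat \<Rightarrow> bool" where "ok q \<longleftrightarrow> q < M \<and> q \<noteq> qf"

lemma decode: "i \<le> K \<Longrightarrow> (pc * Suc K + i) div Suc K = pc" "i \<le> K \<Longrightarrow> (pc * Suc K + i) mod Suc K = i"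
  by (subst div_mult_self3; simp) (subst mod_mult_self3; simp)

lemma parts: "stA pc i div 2 = pc * Suc K + i" "even (stA pc i)"
    "stG pc i div 2 = pc * Suc K + i" "odd (stG pc i)"
  by (simp_all add: stA_def stG_def)

lemma d_A: "i \<le> K \<Longrightarrow> d (stA pc i) x = (case P ! pc of
         INC r l \<Rightarrow> if x then (stA pc i, [True]) else if i = r then (gto l (Suc i), [True, False]) else (stA pc (Suc i), [False])
       | DJZ r lz lp \<Rightarrow> if i = r then if x then (stG lp i, []) else (gto lz (Suc i), [False])
           else if x then (stA pc i, [True]) else (stA pc (Suc i), [False]))"
  unfolding d_def Let_def parts by (simp only: decode parts if_False not_not simp_thms)

lemma d_G: "i \<le> K \<Longrightarrow> d (stG pc i) x = (if x then (stG pc i, [True]) else (gto pc (Suc i), [False]))"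
  unfolding d_def Let_def parts by (simp only: decode parts if_True not_False_eq_True)

lemma bound: "pc \<le> length P \<Longrightarrow> i \<le> K \<Longrightarrow> pc * Suc K + i < Suc (length P) * Suc K"
  using mult_le_mono1[of pc "length P" "Suc K"] by simp

lemma ok_A: "pc < length P \<Longrightarrow> i \<le> K \<Longrightarrow> ok (stA pc i)"
  using bound[of pc i] mult_le_mono1[of "Suc pc" "length P" "Suc K"]
  by (auto simp: ok_def M_def stA_def qf_def)

lemma ok_G: "pc \<le> length P \<Longrightarrow> i \<le> K \<Longrightarrow> ok (stG pc i)"
  using bound[of pc i] unfolding ok_def M_def stG_def qf_def stA_def by presburger

lemma run_G: "pc \<le> length P \<Longrightarrow> i \<le> K \<Longrightarrow>
    qrs d ok (gto pc i, cells s i K @ Y) (stA pc 0, Y @ cells s i K)"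
proof (induction "K - i" arbitrary: i Y)
  case 0
  then have i: "i = K" by simp
  show ?case unfolding i by (simp add: gto_def qrs_refl)
next
  case (Suc n)
  then have i: "i < K" by simp
  let ?T = "replicate (s i) True" and ?C = "cells s (Suc i) K"
  have 1: "qrs d ok (stG pc i, ?T @ False # ?C @ Y) (stG pc i, False # ?C @ Y @ ?T)"
    using qrs_copy[of ok "stG pc i" d "s i" "False # ?C @ Y"] Suc.prems by (simp add: ok_G d_G)
  have 2: "qrs d ok (stG pc i, False # ?C @ Y @ ?T) (gto pc (Suc i), ?C @ Y @ ?T @ [False])"
    using qrp_qrs'[OF qrp_step[of ok "stG pc i" d False "gto pc (Suc i)" "[False]" "?C @ Y @ ?T"]] Suc.prems
    by (simp add: ok_G d_G)
  have 3: "qrs d ok (gto pc (Suc i), ?C @ Y @ ?T @ [False]) (stA pc 0, Y @ ?T @ False # ?C)"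
    using Suc.hyps(1)[of "Suc i" "Y @ ?T @ [False]"] Suc.hyps(2) Suc.prems i by simp
  have "qrs d ok (stG pc i, cells s i K @ Y) (stA pc 0, Y @ cells s i K)"
    using qrs_trans[OF qrs_trans[OF 1 2] 3] unfolding cells_Cons[OF i] by simp
  then show ?case using i by (simp add: gto_def)
qed

lemma run_A:
  assumes "pc < length P" "r \<in> iregs (P ! pc)" "j \<le> r"
  shows "qrs d ok (stA pc 0, cells s 0 K) (stA pc j, cells s j K @ cells s 0 j)"
  using assms(3)
proof (induction j)
  case 0
  then show ?case by (simp add: qrs_refl)
next
  case (Suc j)
  have "r < K" using regs[of "P ! pc"] assms(1,2) by auto
  then have j: "j < K" "j \<noteq> r" using Suc.prems by simp_all
  have dA: "d (stA pc j) True = (stA pc j, [True])" "d (stA pc j) False = (stA pc (Suc j), [False])"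
    using j assms(2) by (cases "P ! pc"; simp add: d_A)+
  let ?T = "replicate (s j) True" and ?C = "cells s (Suc j) K" and ?D = "cells s 0 j"
  have 1: "qrs d ok (stA pc j, ?T @ False # ?C @ ?D) (stA pc j, False # ?C @ ?D @ ?T)"
    using qrs_copy[of ok "stA pc j" d "s j" "False # ?C @ ?D"] assms(1) j dA by (simp add: ok_A)
  have 2: "qrs d ok (stA pc j, False # ?C @ ?D @ ?T) (stA pc (Suc j), ?C @ ?D @ ?T @ [False])"
    using qrp_qrs'[OF qrp_step[of ok "stA pc j" d False "stA pc (Suc j)" "[False]" "?C @ ?D @ ?T"]] assms(1) j dA
    by (simp add: ok_A)
  have 3: "qrs d ok (stA pc j, cells s j K @ cells s 0 j) (stA pc (Suc j), cells s (Suc j) K @ cells s 0 (Suc j))"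
    using qrs_trans[OF 1 2] unfolding cells_Cons[OF j(1)] cells_snoc[OF le0] by simp
  show ?case by (rule qrs_trans[OF Suc.IH 3]) (use Suc.prems in simp)
qed

lemma run_instr:
  assumes "pc < length P" "istep (P ! pc) s = (pc', s')"
  shows "qrp d ok (stA pc 0, cells s 0 K) (stA pc' 0, cells s' 0 K)"
proof -
  obtain r where r: "iregs (P ! pc) = {r}" by (cases "P ! pc") auto
  have rK: "r < K" using regs[of "P ! pc"] assms(1) r by auto
  have tg: "itargets (P ! pc) \<subseteq> {..length P}" using targets assms(1) by simp
  have pass: "qrs d ok (stA pc 0, cells s 0 K) (stA pc r, cells s r K @ cells s 0 r)"
    by (rule run_A[OF assms(1), where r = r]) (use r in simp_all)
  have s': "cells s' 0 r = cells s 0 r" "cells s' (Suc r) K = cells s (Suc r) K"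
    using assms(2) r by (cases "P ! pc"; auto intro!: cells_cong split: if_splits)+
  have cells': "cells s' 0 K = cells s 0 r @ cells s' r K" "cells s' r K = replicate (s' r) True @ False # cells s (Suc r) K"
    using cells_append[of 0 r K s'] cells_Cons[OF rK, of s'] s' rK by simp_all
  show ?thesis
  proof (cases "P ! pc")
    case (INC r' l)
    then have [simp]: "r' = r" "pc' = l" "s' r = Suc (s r)" using r assms(2) by auto
    have dA: "d (stA pc r) True = (stA pc r, [True])" "d (stA pc r) False = (gto l (Suc r), [True, False])"
      using rK INC by (simp_all add: d_A)
    let ?T = "replicate (s r) True" and ?C = "cells s (Suc r) K" and ?D = "cells s 0 r"
    have 1: "qrs d ok (stA pc r, ?T @ False # ?C @ ?D) (stA pc r, False # ?C @ ?D @ ?T)"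
      using qrs_copy[of ok "stA pc r" d "s r" "False # ?C @ ?D"] assms(1) rK dA by (simp add: ok_A)
    have 2: "qrp d ok (stA pc r, False # ?C @ ?D @ ?T) (gto l (Suc r), ?C @ ?D @ ?T @ [True, False])"
      using qrp_step[of ok "stA pc r" d False "gto l (Suc r)" "[True, False]" "?C @ ?D @ ?T"] assms(1) rK dA
      by (simp add: ok_A)
    have 3: "qrs d ok (gto l (Suc r), ?C @ ?D @ ?T @ [True, False]) (stA l 0, ?D @ ?T @ True # False # ?C)"
      using run_G[of l "Suc r" s "?D @ ?T @ [True, False]"] tg INC rK by simp
    have "?D @ ?T @ True # False # ?C = cells s' 0 K"
      unfolding cells' by (simp add: replicate_app_Cons_same)
    then have "qrp d ok (stA pc r, cells s r K @ ?D) (stA l 0, cells s' 0 K)"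
      using qrp_qrs[OF qrs_qrp[OF 1 2] 3] unfolding cells_Cons[OF rK, of s] by simp
    with pass show ?thesis by (simp add: qrs_qrp)
  next
    case (DJZ r' lz lp)
    then have [simp]: "r' = r" using r by simp
    have dA: "d (stA pc r) True = (stG lp r, [])" "d (stA pc r) False = (gto lz (Suc r), [False])"
      using rK DJZ by (simp_all add: d_A)
    show ?thesis
    proof (cases "s r")
      case 0
      then have [simp]: "pc' = lz" "s' = s" using DJZ assms(2) by auto
      let ?C = "cells s (Suc r) K" and ?D = "cells s 0 r"
      have 1: "qrp d ok (stA pc r, False # ?C @ ?D) (gto lz (Suc r), ?C @ ?D @ [False])"
        using qrp_step[of ok "stA pc r" d False "gto lz (Suc r)" "[False]" "?C @ ?D"] assms(1) rK dA
        by (simp add: ok_A)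
      have 2: "qrs d ok (gto lz (Suc r), ?C @ ?D @ [False]) (stA lz 0, ?D @ False # ?C)"
        using run_G[of lz "Suc r" s "?D @ [False]"] tg DJZ rK by simp
      have "qrp d ok (stA pc r, cells s r K @ ?D) (stA lz 0, cells s' 0 K)"
        using qrp_qrs[OF 1 2] unfolding cells_Cons[OF rK, of s] cells' using 0 by simp
      with pass show ?thesis by (simp add: qrs_qrp)
    next
      case (Suc n)
      then have [simp]: "pc' = lp" "s' r = n" using DJZ assms(2) by auto
      let ?C = "cells s' r K" and ?D = "cells s 0 r"
      \<comment> \<open>Only the first cell of register \<open>r\<close> is removed. The index stays
        \<open>r\<close> because the other cells of this register are still to be rotated.\<close>
      have 1: "qrp d ok (stA pc r, True # ?C @ ?D) (stG lp r, ?C @ ?D)"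
        using qrp_step[of ok "stA pc r" d True "stG lp r" "[]" "?C @ ?D"] assms(1) rK dA
        by (simp add: ok_A)
      have g: "gto lp r = stG lp r" using rK by (simp add: gto_def)
      have 2: "qrs d ok (stG lp r, ?C @ ?D) (stA lp 0, ?D @ ?C)"
        using run_G[of lp r s' ?D] tg DJZ rK unfolding g by simp
      have C: "cells s r K = True # ?C"
        unfolding cells'(2) cells_Cons[OF rK, of s] using Suc by simp
      have "qrp d ok (stA pc r, cells s r K @ ?D) (stA lp 0, cells s' 0 K)"
        using qrp_qrs[OF 1 2] unfolding cells'(1) C by simp
      with pass show ?thesis by (simp add: qrs_qrp)
    qed
  qed
qed

end

section \<open>Free groups\<close>

type_synonym letter = "nat \<times> bool"

definition flip :: "letter \<Rightarrow> letter" where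
  "flip x = (fst x, \<not> snd x)"

lemma flip_flip [simp]: "flip (flip x) = x"
  by (simp add: flip_def)

lemma flip_Pair [simp]: "flip (n, b) = (n, \<not> b)"
  by (simp add: flip_def)

lemma flip_neq [simp]: "flip x \<noteq> x" "x \<noteq> flip x"
  by (cases x; simp)+

fun push :: "letter \<Rightarrow> letter list \<Rightarrow> letter list" where
  "push x [] = [x]"
| "push x (y # w) = (if y = flip x then w else x # y # w)"

fun reduced :: "letter list \<Rightarrow> bool" where
  "reduced [] = True"
| "reduced [x] = True"
| "reduced (x # y # w) = (y \<noteq> flip x \<and> reduced (y # w))"

lemma reduced_Cons: "reduced (x # w) \<longleftrightarrow> reduced w \<and> (w = [] \<or> hd w \<noteq> flip x)"
  by (cases w) auto

lemma reduced_push: "reduced w \<Longrightarrow> reduced (push x w)"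
  by (cases w) (auto simp: reduced_Cons)

lemma push_Cons: "reduced (x # w) \<Longrightarrow> push x w = x # w"
  by (cases w) auto

lemma push_push_flip: "reduced w \<Longrightarrow> push x (push (flip x) w) = w"
  by (cases w) (auto simp: push_Cons reduced_Cons)

abbreviation act :: "letter list \<Rightarrow> letter list \<Rightarrow> letter list" where
  "act w r \<equiv> foldr push w r"

lemma reduced_act: "reduced r \<Longrightarrow> reduced (act w r)"
  by (induction w) (auto simp: reduced_push)

lemma act_push: "reduced r \<Longrightarrow> act (push x w) r = push x (act w r)"
  by (cases w) (auto simp: push_push_flip reduced_act)

text \<open>Van der Waerden's argument: words act on reduced words through \<open>push\<close>, and
  reducing a word does not change its action because \<open>push x\<close> and
  \<open>push (flip x)\<close> undo each other. Associativity follows without a confluence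
  proof.\<close>

lemma act_act: "reduced c \<Longrightarrow> act (act a b) c = act a (act b c)"
  by (induction a) (auto simp: act_push)

lemma act_eq_append: "reduced (a @ b) \<Longrightarrow> act a b = a @ b"
  by (induction a) (auto simp: reduced_Cons push_Cons)

lemma act_inverse: "reduced r \<Longrightarrow> act (map flip (rev w)) (act w r) = r"
proof (induction w arbitrary: r)
  case (Cons x w)
  have "push (flip x) (push x (act w r)) = act w r"
    using push_push_flip[of "act w r" "flip x"] Cons.prems by (simp add: reduced_act)
  then show ?case using Cons by simp
qed simp

lemma set_push: "set (push x w) \<subseteq> insert x (set w)"
  by (cases w) auto

lemma set_act: "set (act a b) \<subseteq> set a \<union> set b"
  by (induction a) (use set_push in fastforce)+

typedef fg = "{w. reduced w}" morphisms Rep Abs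
  by (rule exI[of _ "[]"]) simp

lemma reduced_Rep [simp]: "reduced (Rep g)"
  using Rep by auto

lemma Rep_Abs [simp]: "reduced w \<Longrightarrow> Rep (Abs w) = w"
  by (simp add: Abs_inverse)

definition wd :: "letter list \<Rightarrow> fg" where
  "wd w = Abs (act w [])"

lemma Rep_wd: "Rep (wd w) = act w []"
  by (simp add: wd_def reduced_act)

lemma Rep_wd_reduced: "reduced w \<Longrightarrow> Rep (wd w) = w"
  using act_eq_append[of w "[]"] by (simp add: Rep_wd)

text \<open>\<open>group_add\<close> does not assume commutativity, so the free group is written
  additively, and \<open>sum_list\<close> is an ordered product.\<close>

instantiation fg :: group_add
begin
definition "0 = wd []"
definition "a + b = Abs (act (Rep a) (Rep b))"
definition "- a = wd (map flip (rev (Rep a)))"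
definition "a - b = a + - (b :: fg)"

lemma Rep_plus: "Rep (a + b) = act (Rep a) (Rep b)"
  by (simp add: plus_fg_def reduced_act)

lemma Rep_zero: "Rep 0 = []"
  by (simp add: zero_fg_def Rep_wd)

instance
proof
  fix a b c :: fg
  show "a + b + c = a + (b + c)"
    by (simp add: Rep_inject[symmetric] Rep_plus act_act)
  show "0 + a = a"
    by (simp add: Rep_inject[symmetric] Rep_plus Rep_zero)
  show "a + 0 = a"
    using act_eq_append[of "Rep a" "[]"] by (simp add: Rep_inject[symmetric] Rep_plus Rep_zero)
  show "- a + a = 0"
    using act_inverse[of "[]" "Rep a"] act_act[of "Rep a" "map flip (rev (Rep a))" "[]"]
      act_eq_append[of "Rep a" "[]"]
    by (simp add: Rep_inject[symmetric] Rep_plus Rep_zero uminus_fg_def Rep_wd act_act)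
  show "a + - b = a - b" by (simp add: minus_fg_def)
qed
end

lemma wd_append: "wd (u @ v) = wd u + wd v"
  by (simp add: Rep_inject[symmetric] Rep_plus Rep_wd act_act reduced_act)

lemma wd_Nil [simp]: "wd [] = 0"
  by (simp add: zero_fg_def)

lemma wd_Rep [simp]: "wd (Rep g) = g"
  by (simp add: Rep_inject[symmetric] Rep_wd_reduced)

lemma Rep_eq_Nil [simp]: "Rep g = [] \<longleftrightarrow> g = 0"
  by (metis Rep_zero Rep_inject)

definition lt :: "nat \<Rightarrow> fg" where
  "lt n = wd [(n, True)]"

lemma wd_flip: "wd [flip x] = - wd [x]"
proof -
  have "wd [flip x] + wd [x] = 0"
    by (simp add: wd_append[symmetric] Rep_inject[symmetric] Rep_wd Rep_zero)
  then show ?thesis by (simp add: eq_neg_iff_add_eq_0)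
qed

lemma wd_True: "wd [(n, True)] = lt n" and wd_False: "wd [(n, False)] = - lt n"
  using wd_flip[of "(n, True)"] by (simp_all add: lt_def)

lemma wd_Cons: "wd (x # w) = wd [x] + wd w"
  using wd_append[of "[x]" w] by simp

definition pos :: "nat \<Rightarrow> letter" where "pos n = (n, True)"
definition neg :: "nat \<Rightarrow> letter" where "neg n = (n, False)"

definition pw :: "nat list \<Rightarrow> fg" where
  "pw u = wd (map pos u)"

lemma reduced_same_sign: "\<forall>x\<in>set w. snd x = b \<Longrightarrow> reduced w"
proof (induction w)
  case (Cons x w)
  then show ?case by (cases w; cases x) (auto simp: reduced_Cons)
qed simp

lemma reduced_pos [simp]: "reduced (map pos u)"
  by (rule reduced_same_sign[of _ True]) (auto simp: pos_def)

text \<open>Positive words are reduced as they stand, so the free monoid embeds and equality of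
  labels in the group is equality of words.\<close>

lemma pw_inject [simp]: "pw u = pw v \<longleftrightarrow> u = v"
proof -
  have "inj pos" by (auto simp: inj_def pos_def)
  have "pw u = pw v \<longleftrightarrow> map pos u = map pos v"
    unfolding pw_def by (metis Rep_wd_reduced reduced_pos)
  then show ?thesis using \<open>inj pos\<close> by (simp add: inj_map_eq_map)
qed

lemma pw_append: "pw (u @ v) = pw u + pw v"
  by (simp add: pw_def wd_append)

lemma pw_Nil [simp]: "pw [] = 0"
  by (simp add: pw_def)

lemma wd_neg: "wd (map neg w) = - pw (rev w)"
proof (induction w)
  case (Cons x w)
  have "wd (map neg (x # w)) = - lt x + wd (map neg w)"
    using wd_append[of "[neg x]" "map neg w"] by (simp add: neg_def wd_False)
  also have "\<dots> = - (pw (rev w) + lt x)" by (simp add: Cons minus_add)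
  also have "pw (rev w) + lt x = pw (rev (x # w))"
    by (simp add: pw_append) (simp add: pw_def pos_def wd_True)
  finally show ?case .
qed simp

section \<open>Exponent sums and absence of a letter\<close>

definition lex :: "nat \<Rightarrow> letter \<Rightarrow> int" where
  "lex n x = (if fst x = n then if snd x then 1 else - 1 else 0)"

definition expo :: "nat \<Rightarrow> fg \<Rightarrow> int" where
  "expo n g = (\<Sum>x\<leftarrow>Rep g. lex n x)"

lemma lex_push: "sum_list (map (lex n) (push x w)) = lex n x + sum_list (map (lex n) w)"
  by (cases w) (auto simp: lex_def flip_def)

lemma lex_act: "sum_list (map (lex n) (act a b)) = sum_list (map (lex n) a) + sum_list (map (lex n) b)"
  by (induction a) (auto simp: lex_push)

lemma expo_add [simp]: "expo n (a + b) = expo n a + expo n b"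
  by (simp add: expo_def Rep_plus lex_act)

lemma expo_zero [simp]: "expo n 0 = 0"
  by (simp add: expo_def Rep_zero)

lemma expo_minus [simp]: "expo n (- a) = - expo n a"
  using expo_add[of n "- a" a] by simp

lemma expo_diff [simp]: "expo n (a - b) = expo n a - expo n b"
  using expo_add[of n a "- b"] by simp

lemma expo_wd: "expo n (wd w) = sum_list (map (lex n) w)"
  by (simp add: expo_def Rep_wd lex_act)

lemma expo_lt [simp]: "expo n (lt m) = (if m = n then 1 else 0)"
  by (simp add: lt_def expo_wd lex_def)

text \<open>Membership in the free factor generated by the letters other than
  \<open>n\<close>.\<close>

definition nolt :: "nat \<Rightarrow> fg \<Rightarrow> bool" where
  "nolt n g \<longleftrightarrow> n \<notin> fst ` set (Rep g)"

lemma nolt_wd: "n \<notin> fst ` set w \<Longrightarrow> nolt n (wd w)"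
  unfolding nolt_def Rep_wd using set_act[of w "[]"] by auto

lemma nolt_add: "nolt n a \<Longrightarrow> nolt n b \<Longrightarrow> nolt n (a + b)"
  unfolding nolt_def Rep_plus using image_mono[OF set_act[of "Rep a" "Rep b"], of fst]
  by (auto simp: image_Un)

lemma nolt_zero [simp]: "nolt n 0"
  by (simp add: nolt_def Rep_zero)

lemma nolt_minus: "nolt n a \<Longrightarrow> nolt n (- a)"
  unfolding uminus_fg_def by (rule nolt_wd) (force simp: nolt_def flip_def)

lemma nolt_diff: "nolt n a \<Longrightarrow> nolt n b \<Longrightarrow> nolt n (a - b)"
  using nolt_add[of n a "- b"] by (simp add: nolt_minus)

lemma nolt_lt [simp]: "n \<noteq> m \<Longrightarrow> nolt n (lt m)"
  by (simp add: lt_def nolt_wd)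

lemma nolt_sum_list: "\<forall>g\<in>set gs. nolt n g \<Longrightarrow> nolt n (sum_list gs)"
  by (induction gs) (auto simp: nolt_add)

section \<open>Cancellation in a free product with an infinite cyclic group\<close>

definition zp :: "nat \<Rightarrow> int \<Rightarrow> fg" where
  "zp z m = wd (replicate (nat \<bar>m\<bar>) (z, m > 0))"

lemma reduced_replicate [simp]: "reduced (replicate k x)"
  by (rule reduced_same_sign[of _ "snd x"]) auto

lemma Rep_zp: "Rep (zp z m) = replicate (nat \<bar>m\<bar>) (z, m > 0)"
  by (simp add: zp_def Rep_wd_reduced)

lemma zp_Suc: "zp z (m + 1) = lt z + zp z m"
proof -
  have "Rep (lt z + zp z m) = push (z, True) (replicate (nat \<bar>m\<bar>) (z, m > 0))"
    by (simp add: Rep_plus Rep_zp lt_def Rep_wd)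
  also have "\<dots> = replicate (nat \<bar>m + 1\<bar>) (z, m + 1 > 0)"
  proof (cases "m \<ge> 0")
    case True
    then have "nat \<bar>m + 1\<bar> = Suc (nat \<bar>m\<bar>)" by simp
    with True show ?thesis by (cases "nat \<bar>m\<bar>") auto
  next
    case False
    then have "nat \<bar>m\<bar> = Suc (nat \<bar>m + 1\<bar>)" by simp
    with False show ?thesis by (cases "m + 1 = 0") auto
  qed
  finally show ?thesis by (simp add: Rep_inject[symmetric] Rep_zp)
qed

lemma zp_0 [simp]: "zp z 0 = 0"
  by (simp add: zp_def)

lemma zp_pred: "zp z (m - 1) = - lt z + zp z m"
proof -
  have "zp z m = lt z + zp z (m - 1)" using zp_Suc[of z "m - 1"] by simp
  then show ?thesis by (simp only: minus_add_cancel)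
qed

lemma zp_add: "zp z (m + n) = zp z m + zp z n"
proof (induction m rule: int_induct[where k = 0])
  case (step1 i)
  have "i + 1 + n = (i + n) + 1" by simp
  then have "zp z (i + 1 + n) = lt z + zp z (i + n)" by (simp only: zp_Suc)
  then show ?case using step1 by (simp only: zp_Suc add.assoc)
next
  case (step2 i)
  have "i - 1 + n = (i + n) - 1" by simp
  then have "zp z (i - 1 + n) = - lt z + zp z (i + n)" by (simp only: zp_pred)
  then show ?case using step2 by (simp only: zp_pred add.assoc)
qed simp

lemma expo_zp [simp]: "expo z (zp z m) = m"
  by (auto simp: expo_def Rep_zp lex_def sum_list_replicate)

text \<open>The triple \<open>(x, m, k)\<close> stands for the factor x z^m. The weight
  \<open>k\<close> counts nonpositive exponents that went into \<open>m\<close>, a number which the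
  sum of exponents would lose.\<close>

type_synonym item = "fg \<times> int \<times> nat"

definition ival :: "nat \<Rightarrow> item list \<Rightarrow> fg" where
  "ival z its = (\<Sum>(x, m, k)\<leftarrow>its. x + zp z m)"

definition nus :: "item list \<Rightarrow> nat" where
  "nus its = (\<Sum>(x, m, k)\<leftarrow>its. k)"

definition bads :: "item list \<Rightarrow> nat" where
  "bads its = length (filter (\<lambda>(x, m, k). x \<noteq> 0) its)"

definition item_ok :: "nat \<Rightarrow> item \<Rightarrow> bool" where
  "item_ok z = (\<lambda>(x, m, k). nolt z x \<and> (m \<le> 0 \<longrightarrow> k \<ge> 1))"

lemma ival_Cons [simp]: "ival z ((x, m, k) # its) = x + zp z m + ival z its"
  and ival_Nil [simp]: "ival z [] = 0"
  and ival_append: "ival z (xs @ ys) = ival z xs + ival z ys"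
  by (simp_all add: ival_def)

lemma nus_simps [simp]: "nus ((x, m, k) # its) = k + nus its" "nus [] = 0"
    "nus (xs @ ys) = nus xs + nus ys"
  by (simp_all add: nus_def)

lemma bads_simps [simp]: "bads ((x, m, k) # its) = (if x = 0 then 0 else 1) + bads its"
    "bads [] = 0" "bads (xs @ ys) = bads xs + bads ys"
  by (simp_all add: bads_def)

lemma reduced_append:
  "reduced a \<Longrightarrow> reduced b \<Longrightarrow> a = [] \<or> b = [] \<or> hd b \<noteq> flip (last a) \<Longrightarrow> reduced (a @ b)"
  by (induction a rule: reduced.induct) (auto simp: reduced_Cons)

lemma Rep_add_append: "reduced (Rep a @ Rep b) \<Longrightarrow> Rep (a + b) = Rep a @ Rep b"
  by (simp add: Rep_plus act_eq_append)

text \<open>The normal form theorem for a free product with an infinite cyclic group: alternating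
  nontrivial syllables do not cancel. The claim about the first letter is what the induction uses at
  the junction with the preceding power of \<open>z\<close>.\<close>

lemma ival_normal_form:
  assumes "\<forall>(x, m, k)\<in>set its. nolt z x \<and> x \<noteq> 0 \<and> m \<noteq> 0" "its \<noteq> []"
  shows "Rep (ival z its) \<noteq> [] \<and> fst (hd (Rep (ival z its))) \<noteq> z"
  using assms
proof (induction its)
  case (Cons it its)
  obtain x m k where it: "it = (x, m, k)" by (cases it)
  have x: "nolt z x" "Rep x \<noteq> []" "m \<noteq> 0" using Cons.prems it by auto
  have fstx: "fst y \<noteq> z" if "y \<in> set (Rep x)" for y
    using x(1) that unfolding nolt_def by auto
  have tail: "its = [] \<or> Rep (ival z its) \<noteq> [] \<and> fst (hd (Rep (ival z its))) \<noteq> z"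
    using Cons by auto
  define w where "w = Rep (zp z m) @ Rep (ival z its)"
  have zne: "Rep (zp z m) = replicate (nat \<bar>m\<bar>) (z, m > 0)" "nat \<bar>m\<bar> \<noteq> 0"
    using x(3) by (auto simp: Rep_zp)
  have "reduced w" unfolding w_def
    by (rule reduced_append) (use tail zne in \<open>auto simp: flip_def\<close>)
  moreover from this have w: "Rep (zp z m + ival z its) = w"
    unfolding w_def by (rule Rep_add_append)
  moreover have hdw: "fst (hd w) = z" "w \<noteq> []" unfolding w_def using zne
    by (cases "nat \<bar>m\<bar>"; auto)+
  ultimately have "reduced (Rep x @ Rep (zp z m + ival z its))"
  proof (intro reduced_append, goal_cases)
    case 3
    then show ?case using fstx[of "last (Rep x)"] x(2) by (auto simp: flip_def)
  qed auto
  then have "Rep (ival z (it # its)) = Rep x @ w"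
    using Rep_add_append w it by (simp add: add.assoc)
  then show ?case using x(2) fstx by (auto simp: hd_append)
qed simp

lemma add_zero_swap: "a + b = (0::'a::group_add) \<Longrightarrow> b + a = 0"
  by (metis neg_eq_iff_add_eq_0 left_minus)

lemma zp_inject_nolt: "x + zp z m = 0 \<Longrightarrow> nolt z x \<Longrightarrow> x = 0 \<and> m = 0"
proof -
  assume *: "x + zp z m = 0" "nolt z x"
  then have "expo z x = - m" using expo_add[of z x "zp z m"] by simp
  moreover have "\<forall>y\<in>set (Rep x). lex z y = 0" using *(2) by (auto simp: nolt_def lex_def)
  then have "expo z x = 0" unfolding expo_def by (simp cong: map_cong)
  ultimately show ?thesis using * by simp
qed

text \<open>Every block of a noncrossing cancellation pattern that consists of powers of z has
  exponent sum 0 and hence contains a nonpositive exponent; counting these bounds the number of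
  nontrivial factors outside the cyclic group.\<close>

lemma bads_bound:
  assumes "its \<noteq> []" "\<forall>it\<in>set its. item_ok z it" "ival z its = 0"
  shows "bads its + 2 \<le> 2 * nus its"
  using assms
proof (induction "length its" arbitrary: its rule: less_induct)
  case less
  show ?case
  proof (cases "length its = 1")
    case True
    then obtain x m k where its: "its = [(x, m, k)]"
      by (metis One_nat_def length_0_conv length_Suc_conv prod_cases3)
    then have "x + zp z m = 0" "nolt z x" "m \<le> 0 \<longrightarrow> k \<ge> 1"
      using less.prems by (auto simp: item_ok_def)
    then show ?thesis using its zp_inject_nolt[of x z m] by auto
  next
    case False
    have "\<not> (\<forall>(x, m, k)\<in>set its. nolt z x \<and> x \<noteq> 0 \<and> m \<noteq> 0)"
    proof
      assume "\<forall>(x, m, k)\<in>set its. nolt z x \<and> x \<noteq> 0 \<and> m \<noteq> 0"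
      then have "Rep (ival z its) \<noteq> []"
        using ival_normal_form[of its z] less.prems(1) by blast
      then show False using less.prems(3) by simp
    qed
    then obtain it where "it \<in> set its" "\<not> (case it of (x, m, k) \<Rightarrow> nolt z x \<and> x \<noteq> 0 \<and> m \<noteq> 0)"
      by blast
    then obtain x m k where it: "(x, m, k) \<in> set its" "x = 0 \<or> m = 0"
      using less.prems(2) by (cases it) (auto simp: item_ok_def)
    then obtain xs ys where xy: "its = xs @ (x, m, k) # ys" by (meson split_list)
    \<comment> \<open>A trivial product stays trivial under cyclic rotation, so the degenerate item
      can be merged with either neighbour even if it is the first or the last one.\<close>
    define rot where "rot = ys @ xs"
    have "(ival z xs) + (x + zp z m + ival z ys) = 0"
      using less.prems(3) by (simp add: xy ival_append)
    from add_zero_swap[OF this] have v: "x + zp z m + ival z rot = 0"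
      by (simp add: rot_def ival_append add.assoc)
    have rot: "\<forall>it\<in>set rot. item_ok z it" "item_ok z (x, m, k)"
        "bads its = (if x = 0 then 0 else 1) + bads rot" "nus its = k + nus rot"
        "length its = Suc (length rot)" "rot \<noteq> []"
      using less.prems False by (auto simp: xy rot_def)
    show ?thesis
    proof (cases "m = 0")
      case True
      obtain y m' k' r where r: "rot = (y, m', k') # r" using rot(6) by (cases rot) auto
      have "k \<ge> 1" using rot(2) True by (simp add: item_ok_def)
      \<comment> \<open>With z^0 between them, \<open>x\<close> and \<open>y\<close> merge. At most
        two nontrivial entries disappear, and dropping the weight \<open>k\<close>, at least 1, pays
        for both.\<close>
      have "bads ((x + y, m', k') # r) + 2 \<le> 2 * nus ((x + y, m', k') # r)"
      proof (rule less.hyps)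
        show "\<forall>it\<in>set ((x + y, m', k') # r). item_ok z it"
          using rot(1,2) r by (auto simp: item_ok_def nolt_add)
        show "ival z ((x + y, m', k') # r) = 0"
          using v True r by (simp add: add.assoc)
      qed (use rot r in auto)
      then show ?thesis using \<open>k \<ge> 1\<close> rot r by (auto split: if_splits)
    next
      case False
      then have x: "x = 0" using it by simp
      obtain r y m' k' where r: "rot = r @ [(y, m', k')]"
        using rot(6) by (metis append_butlast_last_id prod_cases3)
      have v2: "ival z rot + zp z m = 0" using v x add_zero_swap by auto
      \<comment> \<open>With \<open>x = 0\<close> two powers of \<open>z\<close> merge and their
        weights add. A nonpositive sum has a nonpositive summand, so the merged item is still
        admissible.\<close>
      have "bads (r @ [(y, m' + m, k' + k)]) + 2 \<le> 2 * nus (r @ [(y, m' + m, k' + k)])"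
      proof (rule less.hyps)
        show "\<forall>it\<in>set (r @ [(y, m' + m, k' + k)]). item_ok z it"
          using rot(1,2) r by (auto simp: item_ok_def)
        show "ival z (r @ [(y, m' + m, k' + k)]) = 0"
          using v2 r by (simp add: ival_append zp_add add.assoc)
      qed (use rot r in auto)
      then show ?thesis using rot r x by auto
    qed
  qed
qed

section \<open>From walks in a labelled graph to trivial products\<close>

type_synonym edge = "nat \<times> nat list \<times> nat list \<times> nat"

fun walk :: "nat \<Rightarrow> edge list \<Rightarrow> nat \<Rightarrow> bool" where
  "walk s [] t \<longleftrightarrow> s = t"
| "walk s ((s', u, v, t') # es) t \<longleftrightarrow> s' = s \<and> walk t' es t"

fun eU :: "edge \<Rightarrow> nat list" where "eU (s, u, v, t) = u"
fun eV :: "edge \<Rightarrow> nat list" where "eV (s, u, v, t) = v"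

text \<open>The generators before they become group elements: an edge, the comparison of one letter
  at \<open>q\<close>, and a return from \<open>q\<close> to \<open>p\<close> with a power of
  \<open>z\<close>.\<close>

datatype tok = Ed edge | Lp nat | Rt int

locale graph =
  fixes E :: "edge set" and S :: "nat set" and p q z :: nat
  assumes edges: "(s, u, v, t) \<in> E \<Longrightarrow>
      s \<notin> S \<and> t \<notin> S \<and> s \<noteq> q \<and> s \<noteq> z \<and> t \<noteq> z \<and> set u \<subseteq> S \<and> set v \<subseteq> S \<and> v \<noteq> []"
    and fresh: "p \<notin> S" "q \<notin> S" "z \<notin> S" "p \<noteq> q" "p \<noteq> z" "q \<noteq> z"
begin

fun src :: "tok \<Rightarrow> nat" where
  "src (Ed (s, u, v, t)) = s" | "src (Lp x) = q" | "src (Rt n) = q"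
fun dst :: "tok \<Rightarrow> nat" where
  "dst (Ed (s, u, v, t)) = t" | "dst (Lp x) = q" | "dst (Rt n) = p"

fun lab1 :: "tok \<Rightarrow> letter list" where
  "lab1 (Ed (s, u, v, t)) = map pos u" | "lab1 (Lp x) = [neg x]" | "lab1 (Rt n) = []"
fun lab2 :: "tok \<Rightarrow> letter list" where
  "lab2 (Ed (s, u, v, t)) = map pos v" | "lab2 (Lp x) = [neg x]" | "lab2 (Rt n) = []"

fun mid :: "tok \<Rightarrow> fg" where
  "mid (Rt n) = zp z n" | "mid _ = 0"

definition val1 :: "tok \<Rightarrow> fg" where "val1 k = lt (src k) + (wd (lab1 k) + mid k) - lt (dst k)"
definition val2 :: "tok \<Rightarrow> fg" where "val2 k = lt (src k) + (wd (lab2 k) + mid k) - lt (dst k)"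

definition inner :: "tok set" where "inner = Ed ` E \<union> Lp ` S"
definition toks :: "tok set" where "toks = inner \<union> {Rt 1, Rt (- 3)}"

abbreviation vals1 :: "tok list \<Rightarrow> fg" where "vals1 w \<equiv> sum_list (map val1 w)"
abbreviation vals2 :: "tok list \<Rightarrow> fg" where "vals2 w \<equiv> sum_list (map val2 w)"

fun chain :: "nat \<Rightarrow> tok list \<Rightarrow> nat \<Rightarrow> bool" where
  "chain s [] t \<longleftrightarrow> s = t"
| "chain s (k # w) t \<longleftrightarrow> src k = s \<and> chain (dst k) w t"

lemma inner_cases:
  assumes "k \<in> inner"
  obtains (edge) s u v t where "k = Ed (s, u, v, t)" "(s, u, v, t) \<in> E"
  | (loop) x where "k = Lp x" "x \<in> S"
  using assms unfolding inner_def by (metis Un_iff image_iff prod_cases4)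

lemma inner_props:
  assumes "k \<in> inner"
  shows "src k \<notin> S" "dst k \<notin> S" "src k \<noteq> z" "dst k \<noteq> z" "fst ` set (lab2 k) \<subseteq> S"
    "fst ` set (lab1 k) \<subseteq> S" "mid k = 0" "reduced (lab2 k)" "lab2 k \<noteq> []"
    "src k = q \<Longrightarrow> dst k = q \<and> (\<forall>x\<in>set (lab2 k). \<not> snd x)"
    "src k \<noteq> q \<Longrightarrow> \<forall>x\<in>set (lab2 k). snd x"
  using assms
  by (cases rule: inner_cases; use edges fresh in \<open>fastforce simp: pos_def neg_def\<close>)+

lemma reduced_block:
  assumes "reduced \<tau>" "fst ` set \<tau> \<subseteq> S" "s \<notin> S" "t \<notin> S" "reduced \<rho>"
    "\<rho> = [] \<or> (\<exists>s' \<rho>'. \<rho> = (s', True) # \<rho>' \<and> s' \<noteq> t)" "\<tau> \<noteq> [] \<or> s \<noteq> t"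
  shows "reduced ((s, True) # \<tau> @ (t, False) # \<rho>)"
proof -
  have 1: "reduced ((t, False) # \<rho>)" using assms by (auto simp: reduced_Cons)
  have 2: "reduced (\<tau> @ (t, False) # \<rho>)"
  proof (rule reduced_append[OF assms(1) 1])
    show "\<tau> = [] \<or> (t, False) # \<rho> = [] \<or> hd ((t, False) # \<rho>) \<noteq> flip (last \<tau>)"
      using assms(2,4) last_in_set[of \<tau>] by (auto simp: flip_def image_subset_iff)
  qed
  have "hd (\<tau> @ (t, False) # \<rho>) \<noteq> flip (s, True)"
    using assms(2,3,7) by (cases \<tau>) auto
  then show ?thesis using 2 by (simp add: reduced_Cons)
qed

lemma act_same_sign:
  "\<forall>x\<in>set a \<union> set b. snd x = c \<Longrightarrow> act a b = a @ b"
  by (rule act_eq_append, rule reduced_same_sign[of _ c]) auto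

text \<open>\<open>R\<close> is the longest connected beginning of \<open>w\<close> and \<tau> its
  reduced label. What follows starts at a vertex other than \<open>t\<close>, so nothing cancels
  across the gap. Labels at \<open>q\<close> are negative and all others positive; hence \<tau> can
  vanish only if \<open>R\<close> leads from another vertex to \<open>q\<close>, and then the two
  vertex letters around it differ and do not cancel either.\<close>

lemma vals2_normal_form:
  assumes "set w \<subseteq> inner" "w \<noteq> []"
  shows "\<exists>R rest t \<tau>. w = R @ rest \<and> R \<noteq> [] \<and> chain (src (hd w)) R t \<and> t \<notin> S \<and>
    reduced \<tau> \<and> fst ` set \<tau> \<subseteq> S \<and> wd (concat (map lab2 R)) = wd \<tau> \<and>
    (src (hd w) = q \<longrightarrow> t = q \<and> \<tau> \<noteq> [] \<and> (\<forall>x\<in>set \<tau>. \<not> snd x)) \<and>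
    (src (hd w) \<noteq> q \<and> t \<noteq> q \<longrightarrow> \<tau> \<noteq> [] \<and> (\<forall>x\<in>set \<tau>. snd x)) \<and>
    Rep (vals2 w) = (src (hd w), True) # \<tau> @ (t, False) # Rep (vals2 rest) \<and>
    (rest = [] \<or> src (hd rest) \<noteq> t \<and> (\<exists>\<rho>. Rep (vals2 rest) = (src (hd rest), True) # \<rho>))"
  using assms
proof (induction w)
  case (Cons k w)
  note k = inner_props[of k]
  have kin: "k \<in> inner" using Cons.prems by simp
  have ne: "\<tau> \<noteq> [] \<or> src k \<noteq> t" if "src k = q \<longrightarrow> t = q \<and> \<tau> \<noteq> [] \<and> (\<forall>x\<in>set \<tau>. \<not> snd x)"
     "src k \<noteq> q \<and> t \<noteq> q \<longrightarrow> \<tau> \<noteq> [] \<and> (\<forall>x\<in>set \<tau>. snd x)" for \<tau> :: "letter list" and t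
    using that by auto
  have step: "Rep (vals2 (k # w)) = (src k, True) # \<tau> @ (t, False) # \<rho>"
    if "wd (lab2 k @ (dst k, False) # Rep (vals2 w)) = wd (\<tau> @ (t, False) # \<rho>)"
       "reduced ((src k, True) # \<tau> @ (t, False) # \<rho>)" for \<tau> \<rho> t
  proof -
    have "vals2 (k # w) = lt (src k) + (wd (lab2 k) + (- lt (dst k) + vals2 w))"
      using k(7)[OF kin] by (simp add: val2_def add.assoc diff_conv_add_uminus del: add_uminus_conv_diff)
    also have "\<dots> = lt (src k) + wd (lab2 k @ (dst k, False) # Rep (vals2 w))"
      by (simp only: wd_append wd_Cons[of "(dst k, False)"] wd_False wd_Rep)
    also have "\<dots> = wd ((src k, True) # \<tau> @ (t, False) # \<rho>)"
      by (simp only: that(1) wd_Cons[of "(src k, True)"] wd_True)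
    finally show ?thesis using that(2) Rep_wd_reduced by simp
  qed
  show ?case
  proof (cases "w = [] \<or> src (hd w) \<noteq> dst k")
    case True
    have w: "\<exists>\<rho>. Rep (vals2 w) = (src (hd w), True) # \<rho>" if "w \<noteq> []"
      using Cons that by fastforce
    have *: "Rep (vals2 w) = [] \<or> (\<exists>s' \<rho>'. Rep (vals2 w) = (s', True) # \<rho>' \<and> s' \<noteq> dst k)"
      using w True by (cases "w = []") auto
    have "Rep (vals2 (k # w)) = (src k, True) # lab2 k @ (dst k, False) # Rep (vals2 w)"
      by (rule step[OF refl], rule reduced_block) (use k[OF kin] * in auto)
    then show ?thesis
      using k[OF kin] True w by (intro exI[of _ "[k]"] exI[of _ w] exI[of _ "dst k"] exI[of _ "lab2 k"]) auto
  next
    case False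
    then have hd: "set w \<subseteq> inner" "w \<noteq> []" "src (hd w) = dst k" using Cons.prems by auto
    from Cons.IH[OF hd(1,2), unfolded hd(3)] obtain R rest t \<tau> where IH: "w = R @ rest" "R \<noteq> []" "chain (dst k) R t" "t \<notin> S"
      "reduced \<tau>" "fst ` set \<tau> \<subseteq> S" "wd (concat (map lab2 R)) = wd \<tau>"
      "dst k = q \<longrightarrow> t = q \<and> \<tau> \<noteq> [] \<and> (\<forall>x\<in>set \<tau>. \<not> snd x)"
      "dst k \<noteq> q \<and> t \<noteq> q \<longrightarrow> \<tau> \<noteq> [] \<and> (\<forall>x\<in>set \<tau>. snd x)"
      "Rep (vals2 w) = (dst k, True) # \<tau> @ (t, False) # Rep (vals2 rest)"
      "rest = [] \<or> src (hd rest) \<noteq> t \<and> (\<exists>\<rho>. Rep (vals2 rest) = (src (hd rest), True) # \<rho>)"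
      by blast
    define \<tau>' where "\<tau>' = act (lab2 k) \<tau>"
    have \<tau>': "reduced \<tau>'" "fst ` set \<tau>' \<subseteq> S" "wd \<tau>' = wd (lab2 k) + wd \<tau>"
      using IH(5,6) k(5)[OF kin] set_act[of "lab2 k" \<tau>]
      by (auto simp: \<tau>'_def reduced_act Rep_inject[symmetric] Rep_plus Rep_wd act_act image_subset_iff)
    have c1: "src k = q \<longrightarrow> t = q \<and> \<tau>' \<noteq> [] \<and> (\<forall>x\<in>set \<tau>'. \<not> snd x)"
    proof
      assume "src k = q"
      then have *: "t = q" "\<forall>x\<in>set (lab2 k) \<union> set \<tau>. snd x = False"
        using k(10)[OF kin] IH(8) by auto
      show "t = q \<and> \<tau>' \<noteq> [] \<and> (\<forall>x\<in>set \<tau>'. \<not> snd x)"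
        using * k(9)[OF kin] unfolding \<tau>'_def act_same_sign[OF *(2)] by auto
    qed
    have c2: "src k \<noteq> q \<and> t \<noteq> q \<longrightarrow> \<tau>' \<noteq> [] \<and> (\<forall>x\<in>set \<tau>'. snd x)"
    proof
      assume "src k \<noteq> q \<and> t \<noteq> q"
      then have *: "\<forall>x\<in>set (lab2 k) \<union> set \<tau>. snd x = True"
        using k(11)[OF kin] IH(8,9) by auto
      show "\<tau>' \<noteq> [] \<and> (\<forall>x\<in>set \<tau>'. snd x)"
        using * k(9)[OF kin] unfolding \<tau>'_def act_same_sign[OF *] by auto
    qed
    have r: "Rep (vals2 rest) = [] \<or> (\<exists>s' \<rho>'. Rep (vals2 rest) = (s', True) # \<rho>' \<and> s' \<noteq> t)"
      using IH(11) by auto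
    have "Rep (vals2 (k # w)) = (src k, True) # \<tau>' @ (t, False) # Rep (vals2 rest)"
    proof (rule step)
      have "wd (lab2 k @ (dst k, False) # Rep (vals2 w))
          = wd (lab2 k) + (- lt (dst k) + (lt (dst k) + (wd \<tau> + wd ((t, False) # Rep (vals2 rest)))))"
        unfolding IH(10) by (simp only: wd_append wd_Cons[of "(dst k, False)"] wd_Cons[of "(dst k, True)"] wd_False wd_True)
      also have "\<dots> = wd (\<tau>' @ (t, False) # Rep (vals2 rest))"
        by (simp only: wd_append \<tau>'(3) add.assoc minus_add_cancel)
      finally show "wd (lab2 k @ (dst k, False) # Rep (vals2 w)) = wd (\<tau>' @ (t, False) # Rep (vals2 rest))" .
      show "reduced ((src k, True) # \<tau>' @ (t, False) # Rep (vals2 rest))"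
        by (rule reduced_block[OF \<tau>'(1,2) k(1)[OF kin] IH(4) reduced_Rep r ne[OF c1 c2]])
    qed
    moreover have "wd (concat (map lab2 (k # R))) = wd \<tau>'"
      using IH(7) \<tau>'(3) by (simp add: wd_append)
    moreover have "k # w = (k # R) @ rest" "chain (src k) (k # R) t" using IH(1,3) by simp_all
    ultimately show ?thesis
      unfolding list.sel using c1 c2 \<tau>'(1,2) IH(4,11) by blast
  qed
qed simp

text \<open>The normal form of p q^-1 has just two letters, which leaves no place for a label or for
  a second block.\<close>

lemma vals2_eq_imp_chain:
  assumes "set w \<subseteq> inner" "vals2 w = lt p - lt q"
  shows "chain p w q \<and> wd (concat (map lab2 w)) = 0"
proof -
  have Rpq: "Rep (lt p - lt q) = [(p, True), (q, False)]"
  proof -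
    have "lt p - lt q = wd [(p, True), (q, False)]"
      by (simp only: wd_Cons[of "(p, True)"] wd_True wd_False diff_conv_add_uminus)
    then show ?thesis using fresh by (simp add: Rep_wd_reduced)
  qed
  then have "w \<noteq> []" using assms(2) by (auto simp: Rep_zero)
  from vals2_normal_form[OF assms(1) this] obtain R rest t \<tau> where
    *: "w = R @ rest" "chain (src (hd w)) R t" "fst ` set \<tau> \<subseteq> S" "wd (concat (map lab2 R)) = wd \<tau>"
       "(p, True) # [(q, False)] = (src (hd w), True) # \<tau> @ (t, False) # Rep (vals2 rest)"
       "rest = [] \<or> src (hd rest) \<noteq> t \<and> (\<exists>\<rho>. Rep (vals2 rest) = (src (hd rest), True) # \<rho>)"
    unfolding assms(2) Rpq by blast
  have "\<tau> = []" using *(3,5) fresh by (cases \<tau>) auto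
  then show ?thesis using * by auto
qed

lemma chain_vals1:
  "set w \<subseteq> inner \<Longrightarrow> chain s w t \<Longrightarrow> vals1 w = lt s + wd (concat (map lab1 w)) - lt t"
proof (induction w arbitrary: s)
  case (Cons k w)
  then have *: "src k = s" "vals1 w = lt (dst k) + wd (concat (map lab1 w)) - lt t" "mid k = 0"
    using inner_props(7)[of k] by auto
  have "vals1 (k # w) = lt s + wd (lab1 k) + - lt (dst k) + (lt (dst k) + wd (concat (map lab1 w)) - lt t)"
    using * by (simp add: val1_def add.assoc)
  also have "\<dots> = lt s + wd (concat (map lab1 (k # w))) - lt t"
    by (simp add: wd_append add.assoc diff_conv_add_uminus minus_add_cancel del: add_uminus_conv_diff)
  finally show ?case .
qed simp

text \<open>No edge leaves \<open>q\<close>, so the comparison letters form a final segment, and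
  they are the same in both components. Each total label is a positive word times the inverse of one
  common word.\<close>

lemma chain_split:
  assumes "set w \<subseteq> inner" "chain s w q"
  shows "\<exists>es xs. set es \<subseteq> E \<and> walk s es q \<and>
    concat (map lab1 w) = map pos (concat (map eU es)) @ map neg xs \<and>
    concat (map lab2 w) = map pos (concat (map eV es)) @ map neg xs"
  using assms
proof (induction w arbitrary: s)
  case Nil
  then show ?case by (intro exI[of _ "[]"]) auto
next
  case (Cons k w)
  then obtain es xs where IH: "set es \<subseteq> E" "walk (dst k) es q"
    "concat (map lab1 w) = map pos (concat (map eU es)) @ map neg xs"
    "concat (map lab2 w) = map pos (concat (map eV es)) @ map neg xs" by auto blast
  have "k \<in> inner" using Cons.prems by simp
  then show ?case
  proof (cases rule: inner_cases)
    case (edge s' u v t)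
    then show ?thesis using IH Cons.prems
      by (intro exI[of _ "(s', u, v, t) # es"] exI[of _ xs]) auto
  next
    case (loop x)
    then have "es = []" using IH(1,2) edges by (cases es) fastforce+
    then show ?thesis using IH Cons.prems loop
      by (intro exI[of _ "[]"] exI[of _ "x # xs"]) auto
  qed
qed

lemma walk_if_inner_word:
  assumes "set w \<subseteq> inner" "vals1 w = lt p - lt q" "vals2 w = lt p - lt q"
  shows "\<exists>es. set es \<subseteq> E \<and> walk p es q \<and> concat (map eU es) = concat (map eV es)"
proof -
  from vals2_eq_imp_chain[OF assms(1,3)] have c: "chain p w q" "wd (concat (map lab2 w)) = 0" by auto
  obtain es xs where *: "set es \<subseteq> E" "walk p es q"
    "concat (map lab1 w) = map pos (concat (map eU es)) @ map neg xs"
    "concat (map lab2 w) = map pos (concat (map eV es)) @ map neg xs"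
    using chain_split[OF assms(1) c(1)] by blast
  have "lt p + wd (concat (map lab1 w)) - lt q = lt p - lt q"
    using chain_vals1[OF assms(1) c(1)] assms(2) by simp
  then have "wd (concat (map lab1 w)) = 0"
    by (metis add_left_cancel add.right_neutral diff_add_cancel)
  then have "pw (concat (map eU es)) = pw (rev xs)" "pw (concat (map eV es)) = pw (rev xs)"
    using c(2) unfolding *(3,4) by (simp_all add: wd_append wd_neg pw_def[symmetric])
  then show ?thesis using * by auto
qed

lemma split_at_returns:
  assumes "set ts \<subseteq> toks" "last ts \<notin> inner" "ts \<noteq> []"
  shows "\<exists>ws. ws \<noteq> [] \<and> ts = concat (map (\<lambda>(w, n). w @ [Rt n]) ws) \<and>
    (\<forall>(w, n)\<in>set ws. set w \<subseteq> inner \<and> (n = 1 \<or> n = - 3))"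
  using assms
proof (induction ts)
  case (Cons k ts)
  show ?case
  proof (cases "k \<in> inner")
    case True
    then have "ts \<noteq> []" using Cons.prems by auto
    then have "last ts \<notin> inner" using Cons.prems by simp
    with Cons \<open>ts \<noteq> []\<close> obtain ws' where ws': "ws' \<noteq> []" "ts = concat (map (\<lambda>(w, n). w @ [Rt n]) ws')"
      "\<forall>(w, n)\<in>set ws'. set w \<subseteq> inner \<and> (n = 1 \<or> n = - 3)" by auto
    obtain w n ws where "ws' = (w, n) # ws" using ws'(1) by (metis neq_Nil_conv surj_pair)
    note ws' = ws'[unfolded this]
    show ?thesis using True ws' by (intro exI[of _ "(k # w, n) # ws"]) auto
  next
    case False
    then obtain n where k: "k = Rt n" "n = 1 \<or> n = - 3" using Cons.prems(1) by (auto simp: toks_def)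
    show ?thesis
    proof (cases "ts = []")
      case True
      then show ?thesis using k by (intro exI[of _ "[([], n)]"]) auto
    next
      case False
      with Cons obtain ws where "ws \<noteq> []" "ts = concat (map (\<lambda>(w, n). w @ [Rt n]) ws)"
        "\<forall>(w, n)\<in>set ws. set w \<subseteq> inner \<and> (n = 1 \<or> n = - 3)" by auto
      then show ?thesis using k by (intro exI[of _ "([], n) # ws"]) auto
    qed
  qed
qed simp

text \<open>Conjugation by \<open>p\<close> turns the tokens between two returns into X = p^-1 w q,
  so that the product alternates between such X and powers of \<open>z\<close>. Only the exponent -3
  carries weight.\<close>

definition items :: "(tok \<Rightarrow> fg) \<Rightarrow> (tok list \<times> int) list \<Rightarrow> item list" where
  "items v ws = map (\<lambda>(w, n). (- lt p + sum_list (map v w) + lt q, n, if n = 1 then 0 else 1)) ws"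

lemma ival_items:
  assumes "\<And>n. v (Rt n) = lt q + zp z n - lt p"
  shows "ival z (items v ws) = - lt p + sum_list (map v (concat (map (\<lambda>(w, n). w @ [Rt n]) ws))) + lt p"
proof (induction ws)
  case (Cons wn ws)
  obtain w n where wn: "wn = (w, n)" by (cases wn)
  have "ival z (items v (wn # ws)) = - lt p + (sum_list (map v w) + (lt q + (zp z n + ival z (items v ws))))"
    by (simp add: wn items_def add.assoc)
  also have "\<dots> = - lt p + sum_list (map v (concat (map (\<lambda>(w, n). w @ [Rt n]) (wn # ws)))) + lt p"
    unfolding Cons by (simp add: wn assms add.assoc diff_conv_add_uminus del: add_uminus_conv_diff)
  finally show ?case .
qed (simp add: items_def)

lemma Rt_vals: "val1 (Rt n) = lt q + zp z n - lt p" "val2 (Rt n) = lt q + zp z n - lt p"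
  by (simp_all add: val1_def val2_def)

lemma nolt_vals:
  assumes "set w \<subseteq> inner"
  shows "nolt z (vals1 w)" "nolt z (vals2 w)"
proof -
  have v: "nolt z (val1 k) \<and> nolt z (val2 k)" if "k \<in> inner" for k
    using inner_props(3,4,5,6,7)[OF that] fresh unfolding val1_def val2_def
    by (auto intro!: nolt_diff nolt_add nolt_wd)
  show "nolt z (vals1 w)" by (rule nolt_sum_list) (use v assms in force)
  show "nolt z (vals2 w)" by (rule nolt_sum_list) (use v assms in force)
qed

text \<open>The exponent sum of \<open>z\<close> vanishes, so each -3 is balanced by three exponents
  1.\<close>

lemma items_count:
  assumes "ival z (items v ws) = 0" "\<forall>(w, n)\<in>set ws. n = 1 \<or> n = - 3"
    "\<forall>(w, n)\<in>set ws. nolt z (sum_list (map v w))"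
  shows "length ws = 4 * nus (items v ws)"
proof -
  have "expo z (ival z (items v ws)) = int (length ws) - 4 * int (nus (items v ws))"
    using assms(2,3)
  proof (induction ws)
    case (Cons wn ws)
    obtain w n where wn: "wn = (w, n)" by (cases wn)
    have "expo z (sum_list (map v w)) = 0"
    proof -
      have "\<forall>y\<in>set (Rep (sum_list (map v w))). lex z y = 0"
        using Cons.prems wn by (auto simp: nolt_def lex_def)
      then show ?thesis unfolding expo_def by (simp cong: map_cong)
    qed
    with Cons show ?case using fresh by (auto simp: wn items_def)
  qed (simp add: items_def)
  with assms(1) show ?thesis by simp
qed

lemma inner_sum_nonzero:
  assumes "set w \<subseteq> inner" "w \<noteq> []"
  shows "vals2 w \<noteq> 0"
proof -
  obtain \<rho> where "Rep (vals2 w) = (src (hd w), True) # \<rho>"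
    using vals2_normal_form[OF assms] by blast
  then show ?thesis by (metis Rep_zero list.distinct(1))
qed

lemma walk_if_trivial:
  assumes "set ts \<subseteq> toks" "ts \<noteq> []" "vals1 ts = 0" "vals2 ts = 0"
  shows "\<exists>es. set es \<subseteq> E \<and> walk p es q \<and> concat (map eU es) = concat (map eV es)"
proof -
  \<comment> \<open>Without a return the second component would be nontrivial. Hence there is a
    return, and rotation puts it last.\<close>
  obtain r where r: "r \<in> set ts" "r \<notin> inner"
    using inner_sum_nonzero[of ts] assms by blast
  then obtain xs ys where "ts = xs @ r # ys" by (meson split_list)
  then have ts: "ts = (xs @ [r]) @ ys" by simp
  define ts' where "ts' = ys @ (xs @ [r])"
  have "vals1 (xs @ [r]) + vals1 ys = 0" "vals2 (xs @ [r]) + vals2 ys = 0"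
    using assms(3,4) unfolding ts by (simp_all only: map_append sum_list.append)
  from this[THEN add_zero_swap] have v: "vals1 ts' = 0" "vals2 ts' = 0"
    unfolding ts'_def by (simp_all only: map_append sum_list.append)
  have "set ts' \<subseteq> toks" "ts' \<noteq> []" "last ts' \<notin> inner" using assms(1) ts r by (auto simp: ts'_def)
  from split_at_returns[OF this(1,3,2)] obtain ws where ws: "ws \<noteq> []"
    "ts' = concat (map (\<lambda>(w, n). w @ [Rt n]) ws)"
    "\<And>w n. (w, n) \<in> set ws \<Longrightarrow> set w \<subseteq> inner \<and> (n = 1 \<or> n = - 3)" by blast
  define I1 I2 where "I1 = items val1 ws" and "I2 = items val2 ws"
  have i0: "ival z I1 = 0" "ival z I2 = 0"
    unfolding I1_def I2_def ival_items[OF Rt_vals(1)] ival_items[OF Rt_vals(2)] ws(2)[symmetric] v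
    by simp_all
  have ok: "\<forall>it\<in>set I1. item_ok z it" "\<forall>it\<in>set I2. item_ok z it"
    using ws(3) nolt_vals fresh
    by (auto simp: I1_def I2_def items_def item_ok_def intro!: nolt_add nolt_minus)
  have ne: "I1 \<noteq> []" "I2 \<noteq> []" using ws(1) by (auto simp: I1_def I2_def items_def)
  have b: "bads I1 + 2 \<le> 2 * nus I1" "bads I2 + 2 \<le> 2 * nus I2"
    using bads_bound[OF ne(1) ok(1) i0(1)] bads_bound[OF ne(2) ok(2) i0(2)] by auto
  have n: "length ws = 4 * nus I1" "length ws = 4 * nus I2"
    using i0 ws(3) nolt_vals unfolding I1_def I2_def by (auto intro!: items_count)
  define X1 X2 where "X1 = (\<lambda>w. - lt p + vals1 w + lt q)" and "X2 = (\<lambda>w. - lt p + vals2 w + lt q)"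
  have "\<exists>w n. (w, n) \<in> set ws \<and> X1 w = 0 \<and> X2 w = 0"
  proof (rule ccontr)
    assume "\<not> ?thesis"
    then have "\<forall>(w, n)\<in>set ws. X1 w \<noteq> 0 \<or> X2 w \<noteq> 0" by blast
    \<comment> \<open>The number N of factors is four times the weight, so the bounds allow at most
      N/2 - 2 nontrivial X in each component, together fewer than N.\<close>
    then have "length ws \<le> bads I1 + bads I2"
      unfolding I1_def I2_def
    proof (induction ws)
      case (Cons wn ws)
      obtain w n where "wn = (w, n)" by (cases wn)
      with Cons have "length ws \<le> bads (items val1 ws) + bads (items val2 ws)" "X1 w \<noteq> 0 \<or> X2 w \<noteq> 0"
        by auto
      with \<open>wn = (w, n)\<close> show ?case by (auto simp: items_def X1_def X2_def)
    qed simp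
    with b n show False by simp
  qed
  then obtain w n where w: "(w, n) \<in> set ws" "X1 w = 0" "X2 w = 0" by blast
  have eq: "a = lt p - lt q" if "- lt p + a + lt q = 0" for a
  proof -
    have "a = lt p + (- lt p + a + lt q) - lt q" by (simp add: add.assoc[symmetric])
    then show ?thesis using that by simp
  qed
  have "vals1 w = lt p - lt q" "vals2 w = lt p - lt q"
    using eq[of "vals1 w"] eq[of "vals2 w"] w(2,3) by (auto simp: X1_def X2_def)
  then show ?thesis using walk_if_inner_word ws(3) w by blast
qed

lemma trivial_if_walk:
  assumes "set es \<subseteq> E" "walk p es q" "concat (map eU es) = concat (map eV es)"
  shows "\<exists>ts. set ts \<subseteq> toks \<and> ts \<noteq> [] \<and> vals1 ts = 0 \<and> vals2 ts = 0"
proof -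
  define xs where "xs = concat (map eU es)"
  have pathval: "sum_list (map val1 (map Ed es)) = lt s + pw (concat (map eU es)) - lt t \<and>
      sum_list (map val2 (map Ed es)) = lt s + pw (concat (map eV es)) - lt t"
    if "walk s es t" for s t es
    using that
  proof (induction es arbitrary: s)
    case (Cons e es)
    obtain s' u v t' where e: "e = (s', u, v, t')" by (cases e)
    show ?case using Cons.IH[of t'] Cons.prems
      by (simp add: e val1_def val2_def pw_append pw_def[symmetric] add.assoc diff_conv_add_uminus
          minus_add_cancel del: add_uminus_conv_diff)
  qed simp
  have loops: "sum_list (map val1 (map Lp xs)) = lt q - pw (rev xs) - lt q \<and>
      sum_list (map val2 (map Lp xs)) = lt q - pw (rev xs) - lt q" for xs
  proof (induction xs)
    case (Cons x xs)
    have "- pw (rev (x # xs)) = - lt x + - pw (rev xs)"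
      using wd_neg[of "x # xs"] wd_neg[of xs] wd_Cons[of "neg x" "map neg xs"] by (simp add: neg_def wd_False)
    then show ?case using Cons
      by (simp add: val1_def val2_def neg_def wd_False add.assoc diff_conv_add_uminus
          minus_add_cancel del: add_uminus_conv_diff)
  qed simp
  \<comment> \<open>The edges produce the same positive word in both components; the comparison
    letters cancel it from its end, hence the reversal.\<close>
  define w where "w = map Ed es @ map Lp (rev xs)"
  have "set xs \<subseteq> S" using assms(1) edges unfolding xs_def by fastforce
  then have "set w \<subseteq> toks" using assms(1) by (auto simp: w_def toks_def inner_def)
  have vw: "vals1 w = lt p - lt q" "vals2 w = lt p - lt q"
    using pathval[OF assms(2)] loops[of "rev xs"] assms(3)[symmetric]
    by (simp_all add: w_def xs_def[symmetric] add.assoc diff_conv_add_uminus minus_add_cancel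
        del: add_uminus_conv_diff)
  define r where "r n = w @ [Rt n]" for n
  have vr: "vals1 (r n) = lt p + zp z n - lt p" "vals2 (r n) = lt p + zp z n - lt p" for n
    by (simp_all add: r_def vw Rt_vals add.assoc diff_conv_add_uminus minus_add_cancel
        del: add_uminus_conv_diff)
  have z4: "zp z 1 + (zp z 1 + (zp z 1 + zp z (- 3))) = 0"
    by (simp only: zp_add[symmetric]) simp
  \<comment> \<open>Three returns with exponent 1 balance one with exponent -3.\<close>
  define ts where "ts = r 1 @ r 1 @ r 1 @ r (- 3)"
  have "vals1 ts = lt p + (zp z 1 + (zp z 1 + (zp z 1 + zp z (- 3)))) - lt p"
       "vals2 ts = lt p + (zp z 1 + (zp z 1 + (zp z 1 + zp z (- 3)))) - lt p"
    by (simp_all add: ts_def vr add.assoc diff_conv_add_uminus minus_add_cancel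
        del: add_uminus_conv_diff)
  then have "vals1 ts = 0" "vals2 ts = 0" unfolding z4 by simp_all
  moreover have "set ts \<subseteq> toks" "ts \<noteq> []"
    using \<open>set w \<subseteq> toks\<close> by (auto simp: ts_def r_def toks_def)
  ultimately show ?thesis by blast
qed

end

section \<open>A faithful representation by integer matrices\<close>

datatype m2 = M2 int int int int

instantiation m2 :: monoid_mult
begin
definition "1 = M2 1 0 0 1"
fun times_m2 :: "m2 \<Rightarrow> m2 \<Rightarrow> m2" where
  "M2 a b c d * M2 a' b' c' d' = M2 (a * a' + b * c') (a * b' + b * d') (c * a' + d * c') (c * b' + d * d')"
instance
proof
  fix x y w :: m2
  show "x * y * w = x * (y * w)" by (cases x; cases y; cases w) (simp add: algebra_simps)
  show "1 * x = x" "x * 1 = x" by (cases x; simp add: one_m2_def)+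
qed
end

text \<open>The letter n stands for the conjugate of the elementary matrix with rows (1, 2), (0, 1) by
  the n-th power of its transpose.\<close>

definition par :: "int \<Rightarrow> int \<Rightarrow> m2" where
  "par n e = M2 (1 - 4 * e * n) (2 * e) (- (8 * e * (n * n))) (1 + 4 * e * n)"

definition ym :: "letter \<Rightarrow> m2" where
  "ym x = par (int (fst x)) (if snd x then 1 else - 1)"

definition ev :: "letter list \<Rightarrow> m2" where
  "ev w = prod_list (map ym w)"

lemma ym_flip: "ym x * ym (flip x) = 1"
proof -
  have "par n e * par n (- e) = 1" for n e
    by (simp add: par_def one_m2_def) algebra
  from this[of _ 1] this[of _ "- 1"] show ?thesis by (cases x) (simp add: ym_def)
qed

lemma ev_push: "ev (push x w) = ym x * ev w"
proof (cases w)
  case (Cons y w')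
  have "ym x * (ym (flip x) * ev w') = ev w'" by (simp add: mult.assoc[symmetric] ym_flip)
  then show ?thesis using Cons by (auto simp: ev_def)
qed (simp add: ev_def)

lemma ev_act: "ev (act a b) = ev a * ev b"
proof (induction a)
  case (Cons x a)
  then show ?case by (simp add: ev_push mult.assoc) (simp add: ev_def mult.assoc)
qed (simp add: ev_def)

definition rep :: "fg \<Rightarrow> m2" where
  "rep g = ev (Rep g)"

lemma rep_add: "rep (a + b) = rep a * rep b"
  by (simp add: rep_def Rep_plus ev_act)

lemma rep_zero: "rep 0 = 1"
  by (simp add: rep_def Rep_zero ev_def)

lemma rep_wd: "rep (wd w) = ev w"
  by (simp add: rep_def Rep_wd ev_act) (simp add: ev_def)

section \<open>Ping-pong on integer vectors\<close>

fun app :: "m2 \<Rightarrow> int \<times> int \<Rightarrow> int \<times> int" where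
  "app (M2 a b c d) (x, y) = (a * x + b * y, c * x + d * y)"

lemma app_mult: "app (A * B) v = app A (app B v)"
  by (cases A; cases B; cases v) (simp add: algebra_simps)

text \<open>The shear y - 2nx undoes the conjugation. In the new coordinates the region is the part
  of the double sector 0 < |y'| < |x| where x and y' have equal signs for a letter and opposite
  signs for an inverse. The start vector (0, 1) lies in no region.\<close>

fun region :: "letter \<Rightarrow> int \<times> int \<Rightarrow> bool" where
  "region (n, e) (x, y) \<longleftrightarrow> (let y' = y - 2 * int n * x; x' = (if e then x else - x) in
     0 < y' \<and> y' < x' \<or> x' < y' \<and> y' < 0)"

lemma abs_double: "k \<noteq> 0 \<Longrightarrow> \<bar>x\<bar> \<le> \<bar>k * x\<bar>" for k x :: int
  using mult_right_mono[of 1 "\<bar>k\<bar>" "\<bar>x\<bar>"] by (simp add: abs_mult)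

lemma ping_pong: "reduced (l # w) \<Longrightarrow> region l (app (ev (l # w)) (0, 1))"
proof (induction w arbitrary: l)
  case Nil
  obtain n e where l: "l = (n, e)" by (cases l)
  show ?case by (cases e) (auto simp: l ev_def ym_def par_def Let_def)
next
  case (Cons l' w)
  obtain n e where l: "l = (n, e)" by (cases l)
  obtain m e' where l': "l' = (m, e')" by (cases l')
  obtain x y where v: "app (ev (l' # w)) (0, 1) = (x, y)" by (cases "app (ev (l' # w)) (0, 1)")
  have r: "region (m, e') (x, y)"
    using Cons.IH[of l'] Cons.prems v l' by (simp del: region.simps)
  define t where "t = y - 2 * int n * x"
  define t' where "t' = y - 2 * int m * x"
  have r': "0 < t' \<and> t' < (if e' then x else - x) \<or> (if e' then x else - x) < t' \<and> t' < 0"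
    using r by (simp add: t'_def Let_def)
  define x' where "x' = (if e then x else - x)"
  \<comment> \<open>In sheared coordinates the letter adds 2t to x'. For equal \<open>n\<close>
    reducedness gives equal signs of x' and t; otherwise the two shears differ by at least 2|x|, so
    |t| > |x|. Either way x' + 2t lies beyond t on the same side of 0.\<close>
  have pre: "0 < t \<and> - t < x' \<or> t < 0 \<and> x' < - t"
  proof (cases "m = n")
    case True
    then have "e' = e" using Cons.prems l l' by (auto simp: reduced_Cons)
    then show ?thesis using r' True by (auto simp: t_def t'_def x'_def)
  next
    case False
    define k where "k = int m - int n"
    have "\<bar>x\<bar> \<le> \<bar>k * x\<bar>" using False by (intro abs_double) (simp add: k_def)
    moreover have "t = t' + 2 * (k * x)" by (simp add: t_def t'_def k_def algebra_simps)
    moreover have "\<bar>t'\<bar> < \<bar>x\<bar>" using r' by (auto split: if_splits)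
    ultimately show ?thesis unfolding x'_def by (simp split: if_split) linarith
  qed
  have "app (ev (l # l' # w)) (0, 1) = app (ym l) (x, y)"
    using v by (simp add: ev_def app_mult)
  also have "\<dots> = (let x'' = x + (if e then 2 else - 2) * t in (x'', t + 2 * int n * x''))"
    by (cases e) (simp_all add: l ym_def par_def Let_def t_def, algebra+)
  finally show ?case using pre by (auto simp: l Let_def x'_def split: if_splits)
qed

lemma rep_eq_1: "rep g = 1 \<longleftrightarrow> g = 0"
proof
  assume *: "rep g = 1"
  show "g = 0"
  proof (cases "Rep g")
    case (Cons l w)
    then have "region l (app (rep g) (0, 1))"
      using ping_pong[of l w] reduced_Rep[of g] by (simp add: rep_def)
    then show ?thesis using * by (cases l) (auto simp: one_m2_def Let_def split: if_splits)
  qed simp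
qed (simp add: rep_zero)

lemma rep_inject: "rep a = rep b \<longleftrightarrow> a = b"
proof
  assume "rep a = rep b"
  then have "rep (a + - b) = rep (b + - b)" by (simp only: rep_add)
  then have "a - b = 0" by (simp add: rep_zero rep_eq_1)
  then show "a = b" by simp
qed simp

section \<open>Block matrices and singular filling\<close>

fun blk :: "m2 \<Rightarrow> m2 \<Rightarrow> imat4" where
  "blk (M2 a b c d) (M2 a' b' c' d') = (\<chi> i j.
     if i = 0 then if j = 0 then a else if j = 1 then b else 0
     else if i = 1 then if j = 0 then c else if j = 1 then d else 0
     else if i = 2 then if j = 2 then a' else if j = 3 then b' else 0
     else if j = 2 then c' else if j = 3 then d' else 0)"

lemma blk_mult: "blk A B ** blk C D = blk (A * C) (B * D)"
  by (cases A; cases B; cases C; cases D)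
     (simp add: vec_eq_iff matrix_matrix_mult_def sum_4 forall_4)

lemma blk_one: "blk 1 1 = mat 1"
  by (simp add: one_m2_def vec_eq_iff mat_def forall_4)

lemma blk_inject: "blk A B = blk C D \<longleftrightarrow> A = C \<and> B = D"
  by (cases A; cases B; cases C; cases D)
     (auto simp add: vec_eq_iff forall_4)

definition rep4 :: "fg \<times> fg \<Rightarrow> imat4" where
  "rep4 g = blk (rep (fst g)) (rep (snd g))"

lemma foldr_rep4: "foldr (**) (map rep4 gs) (mat 1) = rep4 (sum_list gs)"
proof (induction gs)
  case Nil
  then show ?case by (simp add: rep4_def rep_zero blk_one)
next
  case (Cons g gs)
  then show ?case by (simp add: rep4_def rep_add blk_mult)
qed

lemma rep4_inject: "rep4 g = rep4 g' \<longleftrightarrow> g = g'"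
  by (auto simp: rep4_def blk_inject rep_inject prod_eq_iff)

lemma rep4_eq_1: "rep4 g = mat 1 \<longleftrightarrow> g = 0"
  using rep4_inject[of g 0] by (simp add: rep4_def rep_zero blk_one)

lemma det_foldr: "det (foldr (**) ps (mat 1)) = prod_list (map det ps)" for ps :: "imat4 list"
  by (induction ps) (simp_all add: det_mul)

text \<open>Infinitely many singular matrices; a product equal to the identity has determinant 1 and
  contains none of them.\<close>

definition junk :: "nat \<Rightarrow> imat4" where
  "junk k = (\<chi> i j. if i = 0 \<and> j = 0 then int k else 0)"

lemma det_junk: "det (junk k) = 0"
  by (rule det_zero_row(1)[of 1]) (simp add: junk_def row_def vec_eq_iff)

lemma inj_junk: "inj junk"
proof (rule injI)
  fix k l assume "junk k = junk l"
  then have "junk k $ 0 $ 0 = junk l $ 0 $ 0" by simp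
  then show "k = l" by (simp add: junk_def)
qed

lemma identity_in_semigroup_iff:
  "identity_in_semigroup Ms \<longleftrightarrow> (\<exists>ps. ps \<noteq> [] \<and> set ps \<subseteq> set Ms - range junk \<and> foldr (**) ps (mat 1) = mat 1)"
proof -
  have "junk k \<notin> set ps" if "foldr (**) ps (mat 1) = (mat 1 :: imat4)" for ps k
  proof
    assume "junk k \<in> set ps"
    then have "prod_list (map det ps) = 0" by (auto simp: prod_list_zero_iff det_junk intro!: image_eqI)
    then show False using arg_cong[OF that, of det] by (simp add: det_foldr det_I)
  qed
  then have "set ps \<subseteq> set Ms - range junk \<longleftrightarrow> set ps \<subseteq> set Ms"
    if "foldr (**) ps (mat 1) = (mat 1 :: imat4)" for ps using that by blast
  then show ?thesis unfolding identity_in_semigroup_def by metis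
qed

lemma nolt_expo: "nolt n g \<Longrightarrow> expo n g = 0"
proof -
  assume "nolt n g"
  then have "\<forall>y\<in>set (Rep g). lex n y = 0" by (auto simp: nolt_def lex_def)
  then show ?thesis unfolding expo_def by (simp cong: map_cong)
qed

text \<open>The value of a token depends on \<open>p\<close>, \<open>q\<close>, \<open>z\<close>
  only and not on the edge set, so the matrices of the fixed tokens are the same for all input
  edges.\<close>

definition tokpair :: "nat \<Rightarrow> nat \<Rightarrow> nat \<Rightarrow> tok \<Rightarrow> fg \<times> fg" where
  "tokpair p q z k = (graph.val1 p q z k, graph.val2 p q z k)"

lemma rep4_not_junk: "rep4 g \<notin> range junk"
proof
  assume "rep4 g \<in> range junk"
  then obtain k where "rep4 g = junk k" by blast
  then have "rep4 g ** rep4 (- g) = junk k ** rep4 (- g)" by simp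
  then have "mat 1 = junk k ** rep4 (- g)"
    using foldr_rep4[of "[g, - g]"] rep4_eq_1[of 0] foldr_rep4[of "[]"]
    by (simp add: matrix_mul_rid)
  from arg_cong[OF this, of det] show False by (simp add: det_mul det_junk det_I)
qed

lemma set_subset_image_conv: "set ys \<subseteq> f ` A \<longleftrightarrow> (\<exists>xs. set xs \<subseteq> A \<and> ys = map f xs)"
proof -
  have "ys \<in> lists (f ` A) \<longleftrightarrow> ys \<in> map f ` lists A" by (simp only: lists_image)
  then show ?thesis unfolding lists_eq_set by blast
qed

lemma ex_image_conv:
  "(\<exists>y. P y \<and> (\<exists>x. A x \<and> y = f x) \<and> Q y) \<longleftrightarrow> (\<exists>x. P (f x) \<and> A x \<and> Q (f x))"
  by blast

lemma (in graph) identity_iff_walk: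
  assumes "set Ms - range junk = rep4 ` tokpair p q z ` toks"
  shows "identity_in_semigroup Ms \<longleftrightarrow>
    (\<exists>es. set es \<subseteq> E \<and> walk p es q \<and> concat (map eU es) = concat (map eV es))"
proof -
  have sum: "sum_list (map (tokpair p q z) ts) = (vals1 ts, vals2 ts)" for ts
    by (induction ts) (simp_all add: tokpair_def zero_prod_def)
  have "identity_in_semigroup Ms \<longleftrightarrow>
      (\<exists>ts. ts \<noteq> [] \<and> set ts \<subseteq> toks \<and> foldr (**) (map (\<lambda>k. rep4 (tokpair p q z k)) ts) (mat 1) = mat 1)"
  proof -
    have lists: "set ps \<subseteq> set Ms - range junk \<longleftrightarrow>
        (\<exists>ts. set ts \<subseteq> toks \<and> ps = map (\<lambda>k. rep4 (tokpair p q z k)) ts)" for ps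
      unfolding assms image_image by (rule set_subset_image_conv)
    have "identity_in_semigroup Ms \<longleftrightarrow> (\<exists>ts. map (\<lambda>k. rep4 (tokpair p q z k)) ts \<noteq> [] \<and> set ts \<subseteq> toks \<and>
        foldr (**) (map (\<lambda>k. rep4 (tokpair p q z k)) ts) (mat 1) = mat 1)"
      unfolding identity_in_semigroup_iff lists by (rule ex_image_conv)
    then show ?thesis by (simp only: map_is_Nil_conv)
  qed
  also have "\<dots> \<longleftrightarrow> (\<exists>ts. ts \<noteq> [] \<and> set ts \<subseteq> toks \<and> vals1 ts = 0 \<and> vals2 ts = 0)"
    unfolding map_map[symmetric, of rep4 "tokpair p q z", unfolded comp_def] foldr_rep4 rep4_eq_1 sum
    by (simp only: zero_prod_def prod.inject)
  also have "\<dots> \<longleftrightarrow> (\<exists>es. set es \<subseteq> E \<and> walk p es q \<and> concat (map eU es) = concat (map eV es))"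
    using walk_if_trivial trivial_if_walk by blast
  finally show ?thesis .
qed

text \<open>Every edge must read a letter: of the \<open>x + 2\<close> zeros one is read by this
  edge itself and one by the edge that leaves vertex 5.\<close>

definition inp :: "nat \<Rightarrow> edge" where
  "inp x = (4, replicate (x + 2) 0, [0], 5)"

definition inpmat :: "nat \<Rightarrow> imat4" where
  "inpmat x = rep4 (tokpair 4 15 16 (Ed (inp x)))"

text \<open>Four comparison letters and two returns leave room for 41 fixed edges among 47 matrices.
  Vertices 4 and 15 are \<open>p\<close> and \<open>q\<close>, and 16 is the letter
  \<open>z\<close>. The list \<open>Ms\<close> is chosen before \<open>x\<close>, as the diagonal
  argument requires.\<close>

lemma semigroup_of_graph:
  assumes fin: "finite E" "card E \<le> 41"
    and E_edges: "\<And>s u v t. (s, u, v, t) \<in> E \<Longrightarrow>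
      4 \<le> s \<and> 4 \<le> t \<and> s \<noteq> 15 \<and> s \<noteq> 16 \<and> t \<noteq> 16 \<and> t \<noteq> 5 \<and> set u \<subseteq> {..<4} \<and> set v \<subseteq> {..<4} \<and> v \<noteq> []"
  shows "\<exists>Ms. distinct Ms \<and> length Ms = 47 \<and> (\<forall>x. inpmat x \<notin> set Ms \<and>
    (identity_in_semigroup (inpmat x # Ms) \<longleftrightarrow>
      (\<exists>es. set es \<subseteq> insert (inp x) E \<and> walk 4 es 15 \<and> concat (map eU es) = concat (map eV es))))"
proof -
  have graph: "graph (insert (inp x) E) {..<4} 4 15 16" for x
  proof
    fix s u v t assume "(s, u, v, t) \<in> insert (inp x) E"
    then show "s \<notin> {..<4} \<and> t \<notin> {..<4} \<and> s \<noteq> 15 \<and> s \<noteq> 16 \<and> t \<noteq> 16 \<and>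
        set u \<subseteq> {..<4} \<and> set v \<subseteq> {..<4} \<and> v \<noteq> []"
      using E_edges[of s u v t] by (auto simp: inp_def)
  qed simp_all
  define base where "base = Ed ` E \<union> Lp ` {..<4} \<union> {Rt 1, Rt (- 3)}"
  have toks: "graph.toks (insert (inp x) E) {..<4} = insert (Ed (inp x)) base" for x
  proof -
    interpret graph "insert (inp x) E" "{..<4}" 4 15 16 by (rule graph)
    show ?thesis by (auto simp: toks_def inner_def base_def)
  qed
  define B where "B = rep4 ` tokpair 4 15 16 ` base"
  have "finite base" using fin by (simp add: base_def)
  then have "finite B" by (simp add: B_def)
  have "card base \<le> card (Ed ` E) + card (Lp ` {..<4}) + card {Rt 1, Rt (- 3)}"
    unfolding base_def by (meson card_Un_le le_trans add_le_mono1)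
  also have "\<dots> \<le> 47"
    using card_image_le[of E Ed] card_image_le[of "{..<4}" Lp] fin by simp
  finally have "card B \<le> 47"
    unfolding B_def using card_image_le[OF \<open>finite base\<close>, of "rep4 \<circ> tokpair 4 15 16"]
    by (simp add: image_comp)
  have Bj: "rep4 g \<notin> range junk" for g
    by (rule rep4_not_junk)
  then have disj: "B \<inter> range junk = {}" unfolding B_def by blast
  obtain J where J: "J \<subseteq> range junk" "finite J" "card J = 47 - card B"
    using infinite_arbitrarily_large[OF range_inj_infinite[OF inj_junk], of "47 - card B"] by blast
  have "card (B \<union> J) = 47"
  proof -
    have "B \<inter> J = {}" using disj J(1) by blast
    then show ?thesis using card_Un_disjoint[OF \<open>finite B\<close> J(2)] J(3) \<open>card B \<le> 47\<close> by simp
  qed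
  obtain Ms where Ms: "set Ms = B \<union> J" "distinct Ms"
    using finite_distinct_list[of "B \<union> J"] \<open>finite B\<close> J(2) by blast
  have "length Ms = 47" using distinct_card[OF Ms(2)] Ms(1) \<open>card (B \<union> J) = 47\<close> by simp
  moreover have "inpmat x \<notin> set Ms" for x
  proof
    assume "inpmat x \<in> set Ms"
    moreover have "inpmat x \<notin> range junk" unfolding inpmat_def by (rule Bj)
    ultimately have "inpmat x \<in> B" using Ms(1) J(1) by blast
    then obtain k where k: "k \<in> base" "tokpair 4 15 16 (Ed (inp x)) = tokpair 4 15 16 k"
      unfolding B_def inpmat_def image_iff bex_simps rep4_inject by blast
    interpret graph "insert (inp x) E" "{..<4}" 4 15 16 by (rule graph)
    \<comment> \<open>Letter 5 singles out the input edge: no other edge enters vertex 5, so no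
      other token has a negative exponent sum of 5 in the first component.\<close>
    have lab: "expo 5 (wd (lab1 k)) = 0" if "k \<in> inner" for k
      using inner_props(6)[OF that] by (intro nolt_expo nolt_wd) auto
    have "Ed (inp x) \<in> inner" by (simp add: inner_def)
    from lab[OF this] inner_props(7)[OF this] have "expo 5 (val1 (Ed (inp x))) = - 1"
      unfolding val1_def by (simp add: inp_def)
    moreover have "expo 5 (val1 k) \<ge> 0"
    proof (cases "k \<in> inner")
      case True
      have "dst k \<noteq> 5" using k(1) E_edges by (auto simp: base_def)
      then show ?thesis using lab[OF True] inner_props(7)[OF True] by (simp add: val1_def)
    next
      case False
      then obtain n where "k = Rt n" using k(1) by (auto simp: base_def inner_def)
      moreover have "expo 5 (zp 16 n) = 0"
        by (rule nolt_expo) (auto simp: nolt_def Rep_zp)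
      ultimately show ?thesis by (simp add: val1_def)
    qed
    ultimately show False using k(2) by (simp add: tokpair_def)
  qed
  moreover have "identity_in_semigroup (inpmat x # Ms) \<longleftrightarrow>
      (\<exists>es. set es \<subseteq> insert (inp x) E \<and> walk 4 es 15 \<and> concat (map eU es) = concat (map eV es))" for x
  proof (rule graph.identity_iff_walk[OF graph])
    have "inpmat x \<notin> range junk" unfolding inpmat_def by (rule Bj)
    moreover have "insert m (B \<union> J) - R = insert m B" if "m \<notin> R" "J \<subseteq> R" "B \<inter> R = {}" for m R
      using that by blast
    ultimately have "set (inpmat x # Ms) - range junk = insert (inpmat x) B"
      using J(1) disj by (simp add: Ms(1))
    moreover have "insert (inpmat x) B = rep4 ` tokpair 4 15 16 ` insert (Ed (inp x)) base"
      unfolding inpmat_def B_def image_insert ..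
    ultimately show "set (inpmat x # Ms) - range junk
        = rep4 ` tokpair 4 15 16 ` graph.toks (insert (inp x) E) {..<4}"
      by (simp only: toks)
  qed
  ultimately show ?thesis using Ms(2) by (intro exI[of _ Ms]) simp
qed

text \<open>Letter 0 is represented by the unipotent matrix with rows (1, 2), (0, 1), whose powers
  are linear in the exponent. Hence all entries of the input matrix are affine in \<open>x\<close>,
  which makes its code easy to compute.\<close>

lemma rep_input:
  "rep (lt 4 + pw (replicate m 0) - lt 5) =
   M2 (85 - 6000 * int m) (570 * int m - 8) (712 - 51200 * int m) (4864 * int m - 67)"
proof -
  have ev: "ev (map pos (replicate m 0)) = M2 1 (2 * int m) 0 1" for m
  proof (induction m)
    case 0
    then show ?case by (simp add: ev_def one_m2_def)
  next
    case (Suc m)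
    have "ev (map pos (replicate (Suc m) 0)) = M2 1 2 0 1 * ev (map pos (replicate m 0))"
      by (simp add: ev_def pos_def ym_def par_def)
    then show ?case using Suc by simp
  qed
  have reps: "rep (lt 4) = ym (4, True)" "rep (- lt 5) = ym (5, False)"
    "rep (pw (replicate m 0)) = M2 1 (2 * int m) 0 1"
    using rep_wd[of "[(4, True)]"] rep_wd[of "[(5, False)]"] rep_wd[of "map pos (replicate m 0)"]
    by (simp_all only: wd_True wd_False pw_def ev) (simp_all add: ev_def)
  have "rep (lt 4 + pw (replicate m 0) - lt 5) = rep (lt 4 + pw (replicate m 0) + - lt 5)"
    by simp
  also have "\<dots> = M2 (- 15) 2 (- 128) 17 * M2 1 (2 * int m) 0 1 * M2 21 (- 2) 200 (- 19)"
    by (simp only: rep_add reps) (simp add: ym_def par_def)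
  also have "\<dots> = M2 (85 - 6000 * int m) (570 * int m - 8) (712 - 51200 * int m) (4864 * int m - 67)"
    by simp
  finally show ?thesis .
qed

lemma inpmat_eq:
  "inpmat x = blk (M2 (- 11915 - 6000 * int x) (1132 + 570 * int x)
       (- 101688 - 51200 * int x) (9661 + 4864 * int x)) (M2 (- 5915) 562 (- 50488) 4797)"
proof -
  interpret graph "{}" "{..<4}" 4 15 16
    by unfold_locales simp_all
  have "val1 (Ed (inp x)) = lt 4 + pw (replicate (x + 2) 0) - lt 5"
    "val2 (Ed (inp x)) = lt 4 + pw (replicate 1 0) - lt 5"
    by (simp_all add: val1_def val2_def inp_def pw_def)
  then show ?thesis
    unfolding inpmat_def tokpair_def rep4_def fst_conv snd_conv by (simp only: rep_input) simp
qed

section \<open>From queue automata to labelled graphs\<close>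

text \<open>A walk along which the first and the second labels have the same concatenation is a run of a queue
  automaton which reads the second and appends the first label of each edge.  Letters: 0 and 1 code the cells of the simulated automaton, 2 separates the entries
  of its transition table, and 3 marks the end of the table.\<close>

definition graph_edges :: "nat list \<Rightarrow> nat list \<Rightarrow> nat list \<Rightarrow> edge set" where
  "graph_edges tab fin ini = set [
     (5, [3], [0], 6), (6, [0, 0, 1], [0], 6), (6, ini, [3], 7),
     (7, [], [0], 8), (7, [], [1], 11),
     (8, [0], [0], 8), (8, [1], [1], 8), (8, [], [2], 9),
     (9, [], [0], 9), (9, [], [1], 9), (9, [2], [2], 10),
     (10, [0], [0], 10), (10, [1], [1], 10), (10, [2], [2], 10), (10, [3], [3], 7),
     (11, [0], [0], 11), (11, [1], [1], 11), (11, [], [2], 12),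
     (12, [0], [0], 12), (12, [1], [1], 12), (12, tab, [2], 13),
     (13, [0], [0], 13), (13, [], [2], 14),
     (14, [], [0], 14), (14, [], [1], 14), (14, [], [2], 14), (14, [], [3], 10),
     (7, [], fin, 15)]"

lemma finite_graph_edges: "finite (graph_edges tab fin ini)"
  by (simp add: graph_edges_def)

lemma card_graph_edges: "card (graph_edges tab fin ini) \<le> 28"
  unfolding graph_edges_def by (rule order_trans[OF card_length]) simp

text \<open>Edges at vertex 4 are left open, so that one analysis of the interpreter covers every
  input edge.\<close>

locale qgraph =
  fixes tab fin ini :: "nat list" and E :: "edge set"
  assumes E: "\<And>s u v t. s \<noteq> 4 \<Longrightarrow> (s, u, v, t) \<in> E \<longleftrightarrow> (s, u, v, t) \<in> graph_edges tab fin ini"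
begin

definition Acc :: "nat \<Rightarrow> nat \<times> nat list \<Rightarrow> bool" where
  "Acc n c \<longleftrightarrow> (\<exists>es. length es = n \<and> set es \<subseteq> E \<and> walk (fst c) es 15 \<and>
     snd c @ concat (map eU es) = concat (map eV es))"

lemma Acc_0: "Acc 0 (s, Q) \<longleftrightarrow> s = 15 \<and> Q = []"
  by (simp add: Acc_def)

lemma Acc_Suc: "Acc (Suc n) (s, Q) \<longleftrightarrow> (\<exists>u v t es. (s, u, v, t) \<in> E \<and> length es = n \<and> set es \<subseteq> E \<and> walk t es 15 \<and>
     Q @ u @ concat (map eU es) = v @ concat (map eV es))"
proof
  assume "Acc (Suc n) (s, Q)"
  then obtain e es where *: "length es = n" "set (e # es) \<subseteq> E" "walk s (e # es) 15"
    "Q @ concat (map eU (e # es)) = concat (map eV (e # es))"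
    unfolding Acc_def length_Suc_conv by auto
  obtain s' u v t where "e = (s', u, v, t)" by (cases e)
  with * show "\<exists>u v t es. (s, u, v, t) \<in> E \<and> length es = n \<and> set es \<subseteq> E \<and> walk t es 15 \<and>
     Q @ u @ concat (map eU es) = v @ concat (map eV es)" by auto
next
  assume "\<exists>u v t es. (s, u, v, t) \<in> E \<and> length es = n \<and> set es \<subseteq> E \<and> walk t es 15 \<and>
     Q @ u @ concat (map eU es) = v @ concat (map eV es)"
  then obtain u v t es where "(s, u, v, t) \<in> E" "length es = n" "set es \<subseteq> E" "walk t es 15"
     "Q @ u @ concat (map eU es) = v @ concat (map eV es)" by blast
  then show "Acc (Suc n) (s, Q)" unfolding Acc_def by (intro exI[of _ "(s, u, v, t) # es"]) simp
qed

text \<open>Acceptance is transported in both directions at once and with exact numbers of edges, so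
  one chain of steps serves soundness as well as completeness.\<close>

definition sim :: "nat \<Rightarrow> nat \<times> nat list \<Rightarrow> nat \<times> nat list \<Rightarrow> bool" where
  "sim k a b \<longleftrightarrow> (\<forall>n. Acc n a \<longleftrightarrow> k \<le> n \<and> Acc (n - k) b)"

definition sims where "sims a b \<longleftrightarrow> (\<exists>k. sim k a b)"
definition simplus where "simplus a b \<longleftrightarrow> (\<exists>k>0. sim k a b)"

lemma sim_trans: "sim j a b \<Longrightarrow> sim k b c \<Longrightarrow> sim (j + k) a c"
proof -
  assume "sim j a b" "sim k b c"
  then have a: "Acc n a \<longleftrightarrow> j \<le> n \<and> k \<le> n - j \<and> Acc (n - j - k) c" for n
    unfolding sim_def by blast
  show "sim (j + k) a c"
    unfolding sim_def a diff_diff_left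
  proof
    show "(j \<le> n \<and> k \<le> n - j \<and> Acc (n - (j + k)) c) \<longleftrightarrow> (j + k \<le> n \<and> Acc (n - (j + k)) c)" for n
      by (cases "Acc (n - (j + k)) c") (simp only: simp_thms, arith, simp)
  qed
qed

lemma sims_refl: "sims a a"
  unfolding sims_def sim_def by (rule exI[of _ 0]) simp

lemma sims_trans [trans]: "sims a b \<Longrightarrow> sims b c \<Longrightarrow> sims a c"
  unfolding sims_def using sim_trans by blast

lemma simp_sims [trans]: "simplus a b \<Longrightarrow> sims b c \<Longrightarrow> simplus a c"
  unfolding sims_def simplus_def by (metis add_gr_0 sim_trans)

lemma sims_simp [trans]: "sims a b \<Longrightarrow> simplus b c \<Longrightarrow> simplus a c"
  unfolding sims_def simplus_def by (metis add_gr_0 sim_trans)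

lemma simp_imp_sims: "simplus a b \<Longrightarrow> sims a b"
  unfolding sims_def simplus_def by blast

text \<open>The edges leaving s are deterministic on the queue x # Q, and no final edge applies.\<close>

lemma sim_step:
  assumes "s \<noteq> 15" "(s, u, [x], t) \<in> E"
    "\<And>u' v' t'. (s, u', v', t') \<in> E \<Longrightarrow> (\<exists>y. v' = [y] \<and> (y = x \<longrightarrow> u' = u \<and> t' = t)) \<or>
       u' = [] \<and> t' = 15 \<and> v' \<noteq> x # Q"
    "\<And>u v t. (15, u, v, t) \<notin> E"
  shows "simplus (s, x # Q) (t, Q @ u)"
proof -
  have "Acc (Suc m) (s, x # Q) \<longleftrightarrow> Acc m (t, Q @ u)" for m
  proof
    assume "Acc (Suc m) (s, x # Q)"
    then obtain u' v' t' es where *: "(s, u', v', t') \<in> E" "length es = m" "set es \<subseteq> E" "walk t' es 15"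
      "(x # Q) @ u' @ concat (map eU es) = v' @ concat (map eV es)" unfolding Acc_Suc by blast
    from assms(3)[OF *(1)] show "Acc m (t, Q @ u)"
    proof (elim disjE exE conjE)
      fix y assume "v' = [y]" "y = x \<longrightarrow> u' = u \<and> t' = t"
      with * show ?thesis unfolding Acc_def by (intro exI[of _ es]) simp
    next
      assume f: "u' = []" "t' = 15" "v' \<noteq> x # Q"
      \<comment> \<open>Vertex 15 has no exit, so the final edge would have to consume the whole
        queue.\<close>
      have "es = []"
      proof (cases es)
        case (Cons e es')
        then show ?thesis using *(3,4) f(2) assms(4) by (cases e) auto
      qed simp
      with * f show ?thesis by simp
    qed
  next
    assume "Acc m (t, Q @ u)"
    then obtain es where "length es = m" "set es \<subseteq> E" "walk t es 15"
      "(Q @ u) @ concat (map eU es) = concat (map eV es)" unfolding Acc_def by auto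
    with assms(2) show "Acc (Suc m) (s, x # Q)" unfolding Acc_Suc
      by (intro exI[of _ u] exI[of _ "[x]"] exI[of _ t] exI[of _ es]) simp
  qed
  moreover have "\<not> Acc 0 (s, x # Q)" by (simp add: Acc_0)
  ultimately have "Acc n (s, x # Q) \<longleftrightarrow> 1 \<le> n \<and> Acc (n - 1) (t, Q @ u)" for n
    by (cases n) simp_all
  then show ?thesis unfolding simplus_def sim_def by blast
qed

lemmas sim_step_Nil = sim_step[where u = "[]", unfolded append_Nil2]

lemma no_exit: "(15, u, v, t) \<notin> E"
  by (simp add: E graph_edges_def)

lemma out:
  "(5, u, v, t) \<in> E \<longleftrightarrow> u = [3] \<and> v = [0] \<and> t = 6"
  "(6, u, v, t) \<in> E \<longleftrightarrow> u = [0, 0, 1] \<and> v = [0] \<and> t = 6 \<or> u = ini \<and> v = [3] \<and> t = 7"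
  "(7, u, v, t) \<in> E \<longleftrightarrow> u = [] \<and> (v = [0] \<and> t = 8 \<or> v = [1] \<and> t = 11 \<or> v = fin \<and> t = 15)"
  "(8, u, v, t) \<in> E \<longleftrightarrow> u = [0] \<and> v = [0] \<and> t = 8 \<or> u = [1] \<and> v = [1] \<and> t = 8 \<or> u = [] \<and> v = [2] \<and> t = 9"
  "(9, u, v, t) \<in> E \<longleftrightarrow> u = [] \<and> v = [0] \<and> t = 9 \<or> u = [] \<and> v = [1] \<and> t = 9 \<or> u = [2] \<and> v = [2] \<and> t = 10"
  "(10, u, v, t) \<in> E \<longleftrightarrow> u = [0] \<and> v = [0] \<and> t = 10 \<or> u = [1] \<and> v = [1] \<and> t = 10 \<or>
     u = [2] \<and> v = [2] \<and> t = 10 \<or> u = [3] \<and> v = [3] \<and> t = 7"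
  "(11, u, v, t) \<in> E \<longleftrightarrow> u = [0] \<and> v = [0] \<and> t = 11 \<or> u = [1] \<and> v = [1] \<and> t = 11 \<or> u = [] \<and> v = [2] \<and> t = 12"
  "(12, u, v, t) \<in> E \<longleftrightarrow> u = [0] \<and> v = [0] \<and> t = 12 \<or> u = [1] \<and> v = [1] \<and> t = 12 \<or> u = tab \<and> v = [2] \<and> t = 13"
  "(13, u, v, t) \<in> E \<longleftrightarrow> u = [0] \<and> v = [0] \<and> t = 13 \<or> u = [] \<and> v = [2] \<and> t = 14"
  "(14, u, v, t) \<in> E \<longleftrightarrow> u = [] \<and> (v = [0] \<and> t = 14 \<or> v = [1] \<and> t = 14 \<or> v = [2] \<and> t = 14 \<or> v = [3] \<and> t = 10)"
  by (simp_all add: E graph_edges_def conj_disj_distribL)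

lemma step_write:
  "simplus (5, 0 # Q) (6, Q @ [3])" "simplus (6, 0 # Q) (6, Q @ [0, 0, 1])" "simplus (6, 3 # Q) (7, Q @ ini)"
  "simplus (8, 0 # Q) (8, Q @ [0])" "simplus (8, 1 # Q) (8, Q @ [1])" "simplus (9, 2 # Q) (10, Q @ [2])"
  "simplus (10, 0 # Q) (10, Q @ [0])" "simplus (10, 1 # Q) (10, Q @ [1])" "simplus (10, 2 # Q) (10, Q @ [2])"
  "simplus (10, 3 # Q) (7, Q @ [3])"
  "simplus (11, 0 # Q) (11, Q @ [0])" "simplus (11, 1 # Q) (11, Q @ [1])"
  "simplus (12, 0 # Q) (12, Q @ [0])" "simplus (12, 1 # Q) (12, Q @ [1])" "simplus (12, 2 # Q) (13, Q @ tab)"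
  "simplus (13, 0 # Q) (13, Q @ [0])"
  by (rule sim_step, simp, simp add: out, (simp add: out; elim disjE conjE; simp), rule no_exit)+

lemma step_delete:
  "simplus (8, 2 # Q) (9, Q)" "simplus (9, 0 # Q) (9, Q)" "simplus (9, 1 # Q) (9, Q)"
  "simplus (11, 2 # Q) (12, Q)" "simplus (13, 2 # Q) (14, Q)"
  "simplus (14, 0 # Q) (14, Q)" "simplus (14, 1 # Q) (14, Q)" "simplus (14, 2 # Q) (14, Q)" "simplus (14, 3 # Q) (10, Q)"
  by (rule sim_step_Nil, simp, simp add: out, (simp add: out; elim disjE conjE; simp), rule no_exit)+

lemma step_start:
  "0 # Q \<noteq> fin \<Longrightarrow> simplus (7, 0 # Q) (8, Q)" "1 # Q \<noteq> fin \<Longrightarrow> simplus (7, 1 # Q) (11, Q)"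
  by (rule sim_step_Nil, simp, simp add: out, (simp add: out; elim disjE conjE; simp), rule no_exit)+

lemma sims_copy:
  "(\<And>x Q. x \<in> set w \<Longrightarrow> sims (s, x # Q) (s, Q @ [x])) \<Longrightarrow> sims (s, w @ Q) (s, Q @ w)"
proof (induction w arbitrary: Q)
  case Nil
  then show ?case by (simp add: sims_refl)
next
  case (Cons x w)
  have "sims (s, x # w @ Q) (s, w @ Q @ [x])" using Cons.prems[of x "w @ Q"] by simp
  also have "sims \<dots> (s, (Q @ [x]) @ w)" by (rule Cons.IH) (use Cons.prems in simp)
  finally show ?case by simp
qed

lemma sims_delete:
  "(\<And>x Q. x \<in> set w \<Longrightarrow> sims (s, x # Q) (s, Q)) \<Longrightarrow> sims (s, w @ Q) (s, Q)"
proof (induction w)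
  case Nil
  then show ?case by (simp add: sims_refl)
next
  case (Cons x w)
  have "sims (s, x # w @ Q) (s, w @ Q)" using Cons.prems[of x "w @ Q"] by simp
  also have "sims \<dots> (s, Q)" by (rule Cons.IH) (use Cons.prems in simp)
  finally show ?case by simp
qed

lemma runs:
  "set w \<subseteq> {0, 1} \<Longrightarrow> sims (8, w @ Q) (8, Q @ w)"
  "set w \<subseteq> {0, 1} \<Longrightarrow> sims (9, w @ Q) (9, Q)"
  "set w \<subseteq> {0, 1, 2} \<Longrightarrow> sims (10, w @ Q) (10, Q @ w)"
  "set w \<subseteq> {0, 1} \<Longrightarrow> sims (11, w @ Q) (11, Q @ w)"
  "set w \<subseteq> {0, 1} \<Longrightarrow> sims (12, w @ Q) (12, Q @ w)"
  "set w \<subseteq> {0} \<Longrightarrow> sims (13, w @ Q) (13, Q @ w)"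
  "set w \<subseteq> {0, 1, 2} \<Longrightarrow> sims (14, w @ Q) (14, Q)"
  by ((rule sims_copy | rule sims_delete);
      use step_write[THEN simp_imp_sims] step_delete[THEN simp_imp_sims] in auto)+

end

text \<open>The last \<open>2\<close> closes the final word like all others, so that the scan of a
  word always stops at a \<open>2\<close>.\<close>

definition Tl :: "nat list list \<Rightarrow> nat list" where
  "Tl ps = concat (map (\<lambda>p. 2 # p) ps) @ [2, 3]"

lemma Tl_Cons: "Tl (p # ps) = 2 # p @ Tl ps"
  by (simp add: Tl_def)

lemma Tl_form: "\<forall>p\<in>set ps. set p \<subseteq> {0, 1} \<Longrightarrow> \<exists>R. Tl ps = 2 # R @ [3] \<and> set R \<subseteq> {0, 1, 2}"
proof (induction ps)
  case Nil
  then show ?case by (intro exI[of _ "[]"]) (simp add: Tl_def)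
next
  case (Cons p ps)
  then obtain R where R: "Tl ps = 2 # R @ [3]" "set R \<subseteq> {0, 1, 2}" by auto
  show ?case unfolding Tl_Cons R(1)
    by (rule exI[of _ "p @ 2 # R"]) (use R(2) Cons.prems in auto)
qed

lemma count_list_0: "x \<notin> set xs \<Longrightarrow> count_list xs x = 0"
  by (induction xs) auto

lemma count_Tl: "\<forall>p\<in>set ps. set p \<subseteq> {0, 1} \<Longrightarrow> count_list (Tl ps) 2 = Suc (length ps)"
proof (induction ps)
  case (Cons p ps)
  moreover have "count_list p 2 = 0" using Cons.prems by (intro count_list_0) auto
  ultimately show ?case by (simp add: Tl_Cons)
qed (simp add: Tl_def)

locale table = qgraph +
  fixes ps :: "nat list list"
  assumes tab: "tab = Tl ps"
    and words: "\<And>p. p \<in> set ps \<Longrightarrow> set p \<subseteq> {0, 1}"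
    and fin: "count_list fin 2 = Suc (length ps)"
begin

text \<open>\<open>fin\<close> has as many letters 2 as a full table; once a word is removed, the
  queue has too few of them for the final edge.\<close>

lemma shorter_neq_fin:
  assumes "set X \<subseteq> {0, 1}" "set qs \<subseteq> set ps" "length qs < length ps"
  shows "replicate N 0 @ 1 # X @ Tl qs \<noteq> fin"
proof
  assume eq: "replicate N 0 @ 1 # X @ Tl qs = fin"
  have "count_list X 2 = 0" "count_list (replicate N (0::nat)) 2 = 0"
    using assms(1) by (auto intro!: count_list_0)
  moreover have "count_list (Tl qs) 2 = Suc (length qs)"
    using count_Tl[of qs] words assms(2) by blast
  ultimately have "count_list (replicate N 0 @ 1 # X @ Tl qs) 2 = Suc (length qs)" by simp
  then show False using fin assms(3) unfolding eq by simp
qed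

text \<open>Vertex 7 consumes one leading zero, 8 moves the rest of the index and the cells behind
  the table, 9 deletes the first word, and 10 rotates the remaining table. Repetition makes the
  unary prefix an index into the table.\<close>

lemma pass_decrement:
  assumes "set X \<subseteq> {0, 1}" "set (p # qs) \<subseteq> set ps" "0 # replicate N 0 @ 1 # X @ Tl (p # qs) \<noteq> fin"
  shows "simplus (7, 0 # replicate N 0 @ 1 # X @ Tl (p # qs)) (7, replicate N 0 @ 1 # X @ Tl qs)"
proof -
  define w where "w = replicate N 0 @ 1 # X"
  have w: "set w \<subseteq> {0, 1}" using assms(1) by (auto simp: w_def)
  have p: "set p \<subseteq> {0, 1}" using words assms(2) by auto
  obtain R where R: "Tl qs = 2 # R @ [3]" "set R \<subseteq> {0, 1, 2}"
    using Tl_form[of qs] words assms(2) by (meson list.set_intros(2) subsetD)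
  have "simplus (7, 0 # w @ Tl (p # qs)) (8, w @ Tl (p # qs))"
    by (rule step_start(1)) (use assms(3) in \<open>simp add: w_def\<close>)
  also have "sims (8, w @ Tl (p # qs)) (8, Tl (p # qs) @ w)"
    by (rule runs(1)[OF w])
  also have "(8, Tl (p # qs) @ w) = (8 :: nat, 2 # p @ Tl qs @ w)" by (simp add: Tl_Cons)
  also have "sims \<dots> (9, p @ Tl qs @ w)" by (rule simp_imp_sims[OF step_delete(1)])
  also have "sims \<dots> (9, Tl qs @ w)" by (rule runs(2)[OF p])
  also have "(9, Tl qs @ w) = (9 :: nat, 2 # R @ 3 # w)" by (simp add: R(1))
  also have "sims \<dots> (10, (R @ 3 # w) @ [2])" by (rule simp_imp_sims[OF step_write(6)])
  also have "\<dots> = (10, R @ 3 # w @ [2])" by simp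
  also have "sims \<dots> (10, (3 # w @ [2]) @ R)" by (rule runs(3)[OF R(2)])
  also have "\<dots> = (10, 3 # w @ 2 # R)" by simp
  also have "sims \<dots> (7, (w @ 2 # R) @ [3])" by (rule simp_imp_sims[OF step_write(10)])
  finally show ?thesis by (simp add: w_def R(1))
qed

lemma decrement:
  assumes "set X \<subseteq> {0, 1}" "set qs \<subseteq> set ps" "N \<le> length qs" "length qs \<le> length ps"
    "length qs < length ps \<or> replicate N 0 @ 1 # X @ Tl qs \<noteq> fin"
  shows "sims (7, replicate N 0 @ 1 # X @ Tl qs) (7, 1 # X @ Tl (drop N qs)) \<and>
    1 # X @ Tl (drop N qs) \<noteq> fin"
  using assms(2-)
proof (induction N arbitrary: qs)
  case 0
  then show ?case using shorter_neq_fin[OF assms(1) 0(1), of 0] by (auto simp: sims_refl)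
next
  case (Suc N)
  then obtain p qs' where qs: "qs = p # qs'" by (cases qs) auto
  have neq: "0 # replicate N 0 @ 1 # X @ Tl (p # qs') \<noteq> fin"
    using Suc.prems(4) shorter_neq_fin[OF assms(1) Suc.prems(1), of "Suc N"] qs by auto
  have IH: "sims (7, replicate N 0 @ 1 # X @ Tl qs') (7, 1 # X @ Tl (drop N qs')) \<and>
    1 # X @ Tl (drop N qs') \<noteq> fin"
    by (rule Suc.IH) (use Suc.prems(1-3) qs in auto)
  have "sims (7, 0 # replicate N 0 @ 1 # X @ Tl (p # qs')) (7, replicate N 0 @ 1 # X @ Tl qs')"
    by (rule simp_imp_sims[OF pass_decrement[OF assms(1) _ neq]]) (use Suc.prems(1) qs in simp)
  from sims_trans[OF this] IH show ?case using qs by simp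
qed

text \<open>A leading 1 means that the selected entry is now first. Vertex 11 moves the cells behind
  the table, 12 moves \<open>h\<close> behind them and writes a fresh table, 13 saves \<sigma> at
  the end, 14 deletes the remnant of the old table, and 10 rotates \<sigma> to the front.\<close>

lemma pass_append:
  assumes "set X \<subseteq> {0, 1}" "set (h # \<sigma> # qs) \<subseteq> set ps" "set \<sigma> \<subseteq> {0}" "1 # X @ Tl (h # \<sigma> # qs) \<noteq> fin"
  shows "simplus (7, 1 # X @ Tl (h # \<sigma> # qs)) (7, \<sigma> @ X @ h @ Tl ps)"
proof -
  have h: "set h \<subseteq> {0, 1}" using words assms(2) by auto
  obtain R where R: "Tl qs = 2 # R @ [3]" "set R \<subseteq> {0, 1, 2}"
    using Tl_form[of qs] words assms(2) by (meson list.set_intros(2) subsetD)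
  obtain R' where R': "Tl ps = 2 # R' @ [3]" "set R' \<subseteq> {0, 1, 2}"
    using Tl_form[of ps] words by blast
  have X': "set (X @ h @ 2 # R') \<subseteq> {0, 1, 2}" using assms(1) h R'(2) by auto
  have "simplus (7, 1 # X @ Tl (h # \<sigma> # qs)) (11, X @ Tl (h # \<sigma> # qs))"
    by (rule step_start(2)) (use assms(4) in simp)
  also have "sims \<dots> (11, Tl (h # \<sigma> # qs) @ X)" by (rule runs(4)[OF assms(1)])
  also have "\<dots> = (11, 2 # h @ Tl (\<sigma> # qs) @ X)" by (simp add: Tl_Cons)
  also have "sims \<dots> (12, h @ Tl (\<sigma> # qs) @ X)" by (rule simp_imp_sims[OF step_delete(4)])
  also have "sims \<dots> (12, (Tl (\<sigma> # qs) @ X) @ h)" by (rule runs(5)[OF h])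
  also have "\<dots> = (12, 2 # \<sigma> @ Tl qs @ X @ h)" by (simp add: Tl_Cons)
  also have "sims \<dots> (13, (\<sigma> @ Tl qs @ X @ h) @ tab)" by (rule simp_imp_sims[OF step_write(15)])
  also have "\<dots> = (13, \<sigma> @ Tl qs @ X @ h @ tab)" by simp
  also have "sims \<dots> (13, (Tl qs @ X @ h @ tab) @ \<sigma>)" by (rule runs(6)[OF assms(3)])
  also have "\<dots> = (13, 2 # R @ 3 # X @ h @ tab @ \<sigma>)" by (simp add: R(1))
  also have "sims \<dots> (14, R @ 3 # X @ h @ tab @ \<sigma>)" by (rule simp_imp_sims[OF step_delete(5)])
  also have "sims \<dots> (14, 3 # X @ h @ tab @ \<sigma>)" by (rule runs(7)[OF R(2)])
  also have "sims \<dots> (10, X @ h @ tab @ \<sigma>)" by (rule simp_imp_sims[OF step_delete(9)])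
  also have "\<dots> = (10, (X @ h @ 2 # R') @ 3 # \<sigma>)" by (simp add: tab R'(1))
  also have "sims \<dots> (10, (3 # \<sigma>) @ (X @ h @ 2 # R'))" by (rule runs(3)[OF X'])
  also have "\<dots> = (10, 3 # \<sigma> @ X @ h @ 2 # R')" by simp
  also have "sims \<dots> (7, (\<sigma> @ X @ h @ 2 # R') @ [3])" by (rule simp_imp_sims[OF step_write(10)])
  finally show ?thesis by (simp add: R'(1))
qed

lemma table_step:
  assumes "set X \<subseteq> {0, 1}" "Suc N < length ps" "set (ps ! Suc N) \<subseteq> {0}" "replicate N 0 @ 1 # X @ Tl ps \<noteq> fin"
  shows "simplus (7, replicate N 0 @ 1 # X @ Tl ps) (7, ps ! Suc N @ X @ ps ! N @ Tl ps)"
proof -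
  have d: "drop N ps = ps ! N # ps ! Suc N # drop (Suc (Suc N)) ps"
    using assms(2) by (simp add: Cons_nth_drop_Suc)
  have "set (drop N ps) \<subseteq> set ps" by (rule set_drop_subset)
  moreover have dec: "sims (7, replicate N 0 @ 1 # X @ Tl ps) (7, 1 # X @ Tl (drop N ps)) \<and> 1 # X @ Tl (drop N ps) \<noteq> fin"
    by (rule decrement[OF assms(1)]) (use assms(2,4) in auto)
  ultimately have "simplus (7, 1 # X @ Tl (drop N ps)) (7, ps ! Suc N @ X @ ps ! N @ Tl ps)"
    unfolding d by (intro pass_append assms(1,3)) auto
  with dec show ?thesis using sims_simp by blast
qed

end

text \<open>A cell \<open>True\<close> puts two more zeros before its 1. The state prefix of 4q
  zeros and the first cell x thus fuse into 2(2q + x) zeros and a 1, the table index of the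
  transition.\<close>

definition enc :: "bool list \<Rightarrow> nat list" where
  "enc xs = concat (map (\<lambda>x. if x then [0, 0, 1] else [1]) xs)"

lemma enc_append: "enc (xs @ ys) = enc xs @ enc ys"
  by (simp add: enc_def)

lemma set_enc: "set (enc xs) \<subseteq> {0, 1}"
  by (auto simp: enc_def)

context machine
begin

text \<open>The entry for the state q and the cell x consists of the words number 2 (2 q + x) and
  2 (2 q + x) + 1 of the table.\<close>

definition pcs :: "nat list list" where
  "pcs = map (\<lambda>i. let r = d (i div 2 div 2) (odd (i div 2)) in
     if even i then enc (snd r) else replicate (4 * fst r) 0) [0..<4 * M]"

definition conf :: "nat \<times> bool list \<Rightarrow> nat list" where
  "conf c = replicate (4 * fst c) 0 @ enc (snd c) @ Tl pcs"

definition fin :: "nat list" where "fin = conf (qf, replicate K False)"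
definition ini :: "nat list" where "ini = enc (replicate K False) @ Tl pcs"

lemma words_pcs: "p \<in> set pcs \<Longrightarrow> set p \<subseteq> {0, 1}"
  using set_enc by (auto simp: pcs_def Let_def)

lemma count_fin: "count_list fin 2 = Suc (length pcs)"
proof -
  have "count_list (enc (replicate K False)) 2 = 0" "count_list (replicate (4 * qf) (0::nat)) 2 = 0"
    using set_enc[of "replicate K False"] by (auto intro!: count_list_0)
  then show ?thesis using count_Tl[of pcs] words_pcs by (simp add: fin_def conf_def)
qed

lemma conf_Cons: "conf (q, x # X) = replicate (2 * (2 * q + of_bool x)) 0 @ 1 # enc X @ Tl pcs"
  by (cases x) (simp_all add: conf_def enc_def replicate_add[symmetric] replicate_app_Cons_same numeral_2_eq_2)

text \<open>Compare leading zeros: \<open>fin\<close> has \<open>4 * qf\<close> of them because its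
  first cell, which exists by \<open>K > 0\<close>, is \<open>False\<close>.\<close>

lemma conf_eq_fin: "conf (q, x # X) = fin \<Longrightarrow> q = qf"
proof -
  assume eq: "conf (q, x # X) = fin"
  have K': "replicate K False = False # replicate (K - 1) False" using K by (cases K) auto
  have "length (takeWhile (\<lambda>n. n = 0) (conf (q, x # X))) = 2 * (2 * q + of_bool x)"
    by (simp add: conf_Cons takeWhile_append)
  moreover have "length (takeWhile (\<lambda>n. n = 0) fin) = 4 * qf"
    unfolding fin_def K' conf_Cons by (simp add: takeWhile_append)
  ultimately have "2 * (2 * q + of_bool x) = 4 * qf" using eq by simp
  then show "q = qf" by (cases x) simp_all
qed

end

locale machine_graph = machine + qgraph "Tl (machine.pcs P K)" "machine.fin P K" "machine.ini P K" E for E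
begin

sublocale table "Tl pcs" fin ini E pcs
  by unfold_locales (use words_pcs count_fin in auto)

lemma simulate_step:
  assumes "ok q"
  shows "simplus (7, conf (q, x # X)) (7, conf (fst (d q x), X @ snd (d q x)))"
proof -
  define n where "n = 2 * q + of_bool x"
  have n: "n div 2 = q" "odd n = x" "n < 2 * M" using assms by (auto simp: n_def ok_def)
  have nth: "pcs ! (2 * n) = enc (snd (d q x))" "pcs ! Suc (2 * n) = replicate (4 * fst (d q x)) 0"
    using n by (simp_all add: pcs_def Let_def)
  have "simplus (7, replicate (2 * n) 0 @ 1 # enc X @ Tl pcs)
      (7, pcs ! Suc (2 * n) @ enc X @ pcs ! (2 * n) @ Tl pcs)"
  proof (rule table_step[OF set_enc])
    show "Suc (2 * n) < length pcs" using n(3) by (simp add: pcs_def)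
    show "set (pcs ! Suc (2 * n)) \<subseteq> {0}" unfolding nth by auto
    show "replicate (2 * n) 0 @ 1 # enc X @ Tl pcs \<noteq> fin"
      using conf_eq_fin[of q x X] assms unfolding conf_Cons n_def ok_def by blast
  qed
  then show ?thesis unfolding nth conf_Cons n_def[symmetric] by (simp add: conf_def enc_append)
qed

lemma simulate_qr: "qr d ok k a b \<Longrightarrow> sims (7, conf a) (7, conf b) \<and> (k > 0 \<longrightarrow> simplus (7, conf a) (7, conf b))"
proof (induction k arbitrary: a)
  case 0
  then show ?case by (simp add: sims_refl)
next
  case (Suc k)
  obtain q x X where a: "a = (q, x # X)" using Suc.prems by (cases a; cases "snd a") auto
  have "simplus (7, conf a) (7, conf (fst (d q x), X @ snd (d q x)))"
    unfolding a by (rule simulate_step) (use Suc.prems a in simp)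
  moreover have "sims (7, conf (fst (d q x), X @ snd (d q x))) (7, conf b)"
    using Suc.IH Suc.prems a by simp
  ultimately show ?case using simp_sims simp_imp_sims by blast
qed

lemma simulate_instr:
  assumes "pc < length P" "istep (P ! pc) s = (pc', s')"
  shows "simplus (7, conf (stA pc 0, cells s 0 K)) (7, conf (stA pc' 0, cells s' 0 K))"
  using run_instr[OF assms] simulate_qr unfolding qrp_def by blast

text \<open>Each instruction uses up a positive number of edges of the accepting walk, whose length
  therefore bounds the run.\<close>

lemma reach_if_Acc:
  "Acc n (7, conf (stA pc 0, cells s 0 K)) \<Longrightarrow> pc \<le> length P \<Longrightarrow> \<exists>k u. reach P k (pc, s) (length P, u)"
proof (induction n arbitrary: pc s rule: less_induct)
  case (less n)
  show ?case
  proof (cases "pc = length P")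
    case True
    then show ?thesis by (intro exI[of _ 0] exI[of _ s]) simp
  next
    case False
    then have pc: "pc < length P" using less.prems by simp
    obtain pc' s' where i: "istep (P ! pc) s = (pc', s')" by (cases "istep (P ! pc) s")
    obtain k where k: "k > 0" "k \<le> n" "Acc (n - k) (7, conf (stA pc' 0, cells s' 0 K))"
      using simulate_instr[OF pc i] less.prems(1) unfolding simplus_def sim_def by blast
    have "pc' \<le> length P"
      using targets[OF nth_mem[OF pc]] i by (cases "P ! pc") (auto split: if_splits)
    then obtain j u where "reach P j (pc', s') (length P, u)"
      using less.IH[OF _ k(3)] k(1,2) by auto
    then show ?thesis using pc i by (intro exI[of _ "Suc j"] exI[of _ u]) simp
  qed
qed

lemma Acc_fin: "Acc 1 (7, fin)"
  unfolding Acc_def by (intro exI[of _ "[(7, [], fin, 15)]"]) (simp add: out)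

lemma Acc_if_reach:
  "reach P k (pc, s) (length P, \<lambda>r. 0) \<Longrightarrow> \<exists>n. Acc n (7, conf (stA pc 0, cells s 0 K))"
proof (induction k arbitrary: pc s)
  case 0
  have "cells (\<lambda>r. 0) 0 K = replicate K False"
    unfolding cells_def by (induction K) (simp_all add: replicate_append_same)
  then show ?case using 0 Acc_fin unfolding fin_def qf_def by (intro exI[of _ 1]) simp
next
  case (Suc k)
  obtain pc' s' where i: "istep (P ! pc) s = (pc', s')" by (cases "istep (P ! pc) s")
  have pc: "pc < length P" using Suc.prems by simp
  obtain n where n: "Acc n (7, conf (stA pc' 0, cells s' 0 K))" using Suc.IH[of pc' s'] Suc.prems i by auto
  obtain j where "sim j (7, conf (stA pc 0, cells s 0 K)) (7, conf (stA pc' 0, cells s' 0 K))"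
    using simulate_instr[OF pc i] unfolding simplus_def by blast
  then have "Acc (n + j) (7, conf (stA pc 0, cells s 0 K))" using n unfolding sim_def by simp
  then show ?case by blast
qed

text \<open>Vertex 5 writes the marker 3 behind the zeros, 6 replaces every zero by the code of a
  cell \<open>True\<close> until it meets the marker, and \<open>ini\<close> supplies the
  \<open>K\<close> terminators and the table. The start state is 0 and needs no prefix.\<close>

lemma load: "sims (5, replicate (Suc x) 0) (7, conf (stA 0 0, cells (input_store x) 0 K))"
proof -
  define a where "a = concat (replicate x [0, 0, 1 :: nat])"
  have "sims (6, replicate x 0 @ Y) (6, Y @ concat (replicate x [0, 0, 1]))" for Y
  proof (induction x arbitrary: Y)
    case 0
    then show ?case by (simp add: sims_refl)
  next
    case (Suc x)
    have "sims (6, 0 # replicate x 0 @ Y) (6, (replicate x 0 @ Y) @ [0, 0, 1])"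
      by (rule simp_imp_sims[OF step_write(2)])
    also have "\<dots> = (6, replicate x 0 @ (Y @ [0, 0, 1]))" by simp
    also have "sims \<dots> (6, (Y @ [0, 0, 1]) @ concat (replicate x [0, 0, 1]))" by (rule Suc.IH)
    finally show ?case by simp
  qed
  note copy = this
  have "sims (5, 0 # replicate x 0) (6, replicate x 0 @ [3])" by (rule simp_imp_sims[OF step_write(1)])
  also have "sims \<dots> (6, [3] @ a)" unfolding a_def by (rule copy)
  also have "\<dots> = (6, 3 # a)" by simp
  also have "sims \<dots> (7, a @ ini)" by (rule simp_imp_sims[OF step_write(3)])
  also have "a @ ini = conf (stA 0 0, cells (input_store x) 0 K)"
  proof -
    obtain K' where K': "K = Suc K'" using K by (cases K) auto
    have z: "cells (input_store x) (Suc 0) (Suc K') = replicate K' False" for K'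
      by (induction K') (simp_all add: cells_snoc input_store_def replicate_append_same)
    have "cells (input_store x) 0 K = replicate x True @ replicate K False"
      using cells_Cons[of 0 K "input_store x"] z[of K'] K K' by (simp add: input_store_def)
    moreover have "enc (replicate x True) = a" by (simp add: enc_def a_def)
    ultimately show ?thesis by (simp add: ini_def conf_def stA_def enc_append)
  qed
  finally show ?thesis by simp
qed

end

theorem graph_of_recf:
  "\<exists>G. finite G \<and> card G \<le> 28 \<and>
    (\<forall>(s, u, v, t)\<in>G. 5 \<le> s \<and> 6 \<le> t \<and> s < 15 \<and> t < 16 \<and> set u \<subseteq> {..<4} \<and> set v \<subseteq> {..<4} \<and> v \<noteq> []) \<and>
    (\<forall>x. (\<exists>y. eval f [x] y) \<longleftrightarrow>
      (\<exists>es. set es \<subseteq> insert (inp x) G \<and> walk 4 es 15 \<and> concat (map eU es) = concat (map eV es)))"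
proof -
  obtain P where P: "\<And>i. i \<in> set P \<Longrightarrow> itargets i \<subseteq> {..length P}"
    "\<And>x. (\<exists>y. eval f [x] y) \<longleftrightarrow> (\<exists>k u. reach P k (0, input_store x) (length P, u))"
    "\<And>x k u. reach P k (0, input_store x) (length P, u) \<Longrightarrow> u = (\<lambda>r. 0)"
    using counter_machine[of f] by blast
  have "finite (iregs i)" for i by (cases i) auto
  then have "finite (\<Union> (iregs ` set P))" by simp
  then obtain K0 where K0: "\<Union> (iregs ` set P) \<subseteq> {..<K0}" using finite_nat_iff_bounded by blast
  define K where "K = Suc K0"
  interpret machine P K
  proof
    show "iregs i \<subseteq> {..<K}" if "i \<in> set P" for i
      using K0 that by (force simp: K_def)
  qed (use P(1) in \<open>auto simp: K_def\<close>)
  define G where "G = graph_edges (Tl pcs) fin ini"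
  have Tl4: "set (Tl pcs) \<subseteq> {..<4}"
    using Tl_form[of pcs] words_pcs by fastforce
  have enc4: "set (enc xs) \<subseteq> {..<4}" for xs using set_enc[of xs] by auto
  have 4: "set fin \<subseteq> {..<4}" "set ini \<subseteq> {..<4}"
    using Tl4 enc4 by (auto simp: fin_def ini_def conf_def)
  have "fin \<noteq> []" using count_fin by auto
  then have "\<forall>(s, u, v, t)\<in>G. 5 \<le> s \<and> 6 \<le> t \<and> s < 15 \<and> t < 16 \<and> set u \<subseteq> {..<4} \<and> set v \<subseteq> {..<4} \<and> v \<noteq> []"
    unfolding G_def graph_edges_def using Tl4 4 by simp
  moreover have "(\<exists>y. eval f [x] y) \<longleftrightarrow>
      (\<exists>es. set es \<subseteq> insert (inp x) G \<and> walk 4 es 15 \<and> concat (map eU es) = concat (map eV es))" for x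
  proof -
    interpret machine_graph P K "insert (inp x) G"
      by unfold_locales (auto simp: inp_def G_def)
    have no4: "(4, u, v, t) \<notin> G" for u v t by (simp add: G_def graph_edges_def)
    have "(\<exists>es. set es \<subseteq> insert (inp x) G \<and> walk 4 es 15 \<and> concat (map eU es) = concat (map eV es))
        \<longleftrightarrow> (\<exists>n. Acc n (5, replicate (Suc x) 0))" (is "?L \<longleftrightarrow> ?R")
    proof
      assume ?L
      then obtain es where es: "set es \<subseteq> insert (inp x) G" "walk 4 es 15" "concat (map eU es) = concat (map eV es)"
        by blast
      then obtain s u v t es' where e: "es = (s, u, v, t) # es'" by (cases es) auto
      then have "s = 4" using es(2) by simp
      then have "(s, u, v, t) = inp x" using es(1) e no4 by auto
      then have "Acc (length es') (5, replicate (Suc x) 0)"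
        using es e unfolding Acc_def by (intro exI[of _ es']) (simp add: inp_def)
      then show ?R by blast
    next
      assume ?R
      then obtain es where "set es \<subseteq> insert (inp x) G" "walk 5 es 15"
        "replicate (Suc x) 0 @ concat (map eU es) = concat (map eV es)" unfolding Acc_def by auto
      then show ?L by (intro exI[of _ "inp x # es"]) (simp add: inp_def)
    qed
    also have "\<dots> \<longleftrightarrow> (\<exists>n. Acc n (7, conf (stA 0 0, cells (input_store x) 0 K)))"
    proof -
      obtain k where "sim k (5, replicate (Suc x) 0) (7, conf (stA 0 0, cells (input_store x) 0 K))"
        using load unfolding sims_def by blast
      then show ?thesis unfolding sim_def by (metis add_diff_cancel_right' le_add2)
    qed
    also have "\<dots> \<longleftrightarrow> (\<exists>k u. reach P k (0, input_store x) (length P, u))"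
      using reach_if_Acc[of _ 0 "input_store x"] Acc_if_reach[of _ 0 "input_store x"] P(3)[of _ x] by blast
    finally show ?thesis unfolding P(2) by blast
  qed
  ultimately show ?thesis
    using finite_graph_edges card_graph_edges unfolding G_def by (intro exI[of _ "graph_edges (Tl pcs) fin ini"]) simp
qed

section \<open>Codes of instances are recursive\<close>

definition computable :: "(nat \<Rightarrow> nat) \<Rightarrow> bool" where
  "computable F \<longleftrightarrow> (\<exists>f. \<forall>x. eval f [x] (F x))"

definition add_f :: recf where
  "add_f = Prec_f (Proj_f 0) (Comp_f Succ_f [Proj_f 1])"

lemma eval_add_f: "eval add_f [m, n] (m + n)"
proof (induction m)
  case 0
  show ?case by (simp add: add_f_def)
next
  case (Suc m)
  have "eval (Comp_f Succ_f [Proj_f 1]) [m, m + n, n] (Suc (m + n))"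
    by (rule eval.comp[of _ _ "[m + n]"]) simp_all
  with Suc show ?case unfolding add_f_def by (auto intro: eval.precS)
qed

text \<open>Triangular numbers are the nonlinear part of the Cantor pairing
  \<open>prod_encode\<close>.\<close>

definition triangle_f :: recf where
  "triangle_f = Prec_f Zero_f (Comp_f add_f [Proj_f 1, Comp_f Succ_f [Proj_f 0]])"

lemma eval_triangle_f: "eval triangle_f [n] (triangle n)"
proof (induction n)
  case 0
  show ?case by (simp add: triangle_f_def)
next
  case (Suc n)
  have "eval (Comp_f Succ_f [Proj_f 0]) [n, triangle n] (Suc n)"
    by (rule eval.comp[of _ _ "[n]"]) simp_all
  then have "eval (Comp_f add_f [Proj_f 1, Comp_f Succ_f [Proj_f 0]]) [n, triangle n] (triangle n + Suc n)"
    by (intro eval.comp[of _ _ "[triangle n, Suc n]"] eval_add_f) simp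
  with Suc show ?case unfolding triangle_f_def triangle_Suc by (rule eval.precS)
qed

lemma computable_id: "computable (\<lambda>x. x)"
  unfolding computable_def by (rule exI[of _ "Proj_f 0"]) simp

lemma computable_comp1:
  assumes "\<And>m. eval f [m] (H m)" "computable F"
  shows "computable (\<lambda>x. H (F x))"
proof -
  obtain a where a: "\<And>x. eval a [x] (F x)" using assms(2) unfolding computable_def by blast
  have "eval (Comp_f f [a]) [x] (H (F x))" for x
    by (rule eval.comp[of _ _ "[F x]"]) (use a assms(1) in simp_all)
  then show ?thesis unfolding computable_def by blast
qed

lemma computable_comp2:
  assumes "\<And>m n. eval f [m, n] (H m n)" "computable F" "computable G"
  shows "computable (\<lambda>x. H (F x) (G x))"
proof -
  obtain a b where a: "\<And>x. eval a [x] (F x)" and b: "\<And>x. eval b [x] (G x)"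
    using assms(2,3) unfolding computable_def by blast
  have "eval (Comp_f f [a, b]) [x] (H (F x) (G x))" for x
    by (rule eval.comp[of _ _ "[F x, G x]"]) (use a b assms(1) in simp_all)
  then show ?thesis unfolding computable_def by blast
qed

lemma computable_Suc: "computable F \<Longrightarrow> computable (\<lambda>x. Suc (F x))"
  by (rule computable_comp1[of Succ_f]) simp

lemma computable_add: "computable F \<Longrightarrow> computable G \<Longrightarrow> computable (\<lambda>x. F x + G x)"
  by (rule computable_comp2[OF eval_add_f])

lemma computable_const: "computable (\<lambda>x. n)"
proof (induction n)
  case 0
  show ?case unfolding computable_def by (rule exI[of _ Zero_f]) simp
qed (rule computable_Suc)

lemma computable_mult_const: "computable (\<lambda>x. k * x)"
proof (induction k)
  case 0
  show ?case using computable_const[of 0] by simp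
next
  case (Suc k)
  show ?case using computable_add[OF computable_id Suc] by simp
qed

lemma computable_prod_encode:
  "computable F \<Longrightarrow> computable G \<Longrightarrow> computable (\<lambda>x. prod_encode (F x, G x))"
  unfolding prod_encode_def prod.case
  by (intro computable_add computable_comp1[OF eval_triangle_f])

lemma computable_list_encode:
  "(\<And>F. F \<in> set Fs \<Longrightarrow> computable F) \<Longrightarrow> computable (\<lambda>x. list_encode (map (\<lambda>F. F x) Fs))"
proof (induction Fs)
  case Nil
  show ?case using computable_const[of 0] by simp
next
  case (Cons F Fs)
  have "computable F" "computable (\<lambda>x. list_encode (map (\<lambda>F. F x) Fs))" using Cons by simp_all
  from computable_Suc[OF computable_prod_encode[OF this]] show ?case by simp
qed

text \<open>\<open>int_encode\<close> is affine on the nonnegative and on the negative integers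
  separately; the sign condition keeps \<open>a + b * int x\<close> on one side for all
  \<open>x\<close>.\<close>

lemma computable_int_encode_linear:
  assumes "0 \<le> a \<and> 0 \<le> b \<or> a < 0 \<and> b \<le> 0"
  shows "computable (\<lambda>x. int_encode (a + b * int x))"
  using assms
proof (elim disjE conjE)
  assume "0 \<le> a" "0 \<le> b"
  then have "int_encode (a + b * int x) = 2 * nat a + (2 * nat b) * x" for x
    by (simp add: int_encode_def sum_encode_def nat_add_distrib nat_mult_distrib)
  then show ?thesis using computable_add[OF computable_const computable_mult_const] by simp
next
  assume "a < 0" "b \<le> 0"
  have "int_encode (a + b * int x) = Suc (2 * nat (- a - 1)) + (2 * nat (- b)) * x" for x
  proof -
    have "b * int x \<le> 0" using \<open>b \<le> 0\<close> by (simp add: mult_nonpos_nonneg)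
    then have "int_encode (a + b * int x) = Suc (2 * nat ((- a - 1) + (- b) * int x))"
      using \<open>a < 0\<close> by (simp add: int_encode_def sum_encode_def algebra_simps)
    also have "nat ((- a - 1) + (- b) * int x) = nat (- a - 1) + nat (- b) * x"
      using \<open>a < 0\<close> \<open>b \<le> 0\<close> nat_mult_distrib[of "- b" "int x"]
      by (subst nat_add_distrib) (simp_all add: mult_nonpos_nonneg)
    finally show ?thesis by simp
  qed
  moreover have "computable (\<lambda>x. Suc (2 * nat (- a - 1)) + (2 * nat (- b)) * x)"
    by (rule computable_add[OF computable_const computable_mult_const])
  ultimately show ?thesis by (simp only:)
qed

lemma computable_code_inpmat: "computable (\<lambda>x. code_mat (inpmat x))"
proof -
  define entry where "entry = (\<lambda>(i, j) x. int_encode (inpmat x $ of_nat i $ of_nat j))"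
  have lin: "computable (\<lambda>x. int_encode (- 11915 - 6000 * int x))" "computable (\<lambda>x. int_encode (1132 + 570 * int x))"
    "computable (\<lambda>x. int_encode (- 101688 - 51200 * int x))" "computable (\<lambda>x. int_encode (9661 + 4864 * int x))"
    using computable_int_encode_linear[of "- 11915" "- 6000"] computable_int_encode_linear[of 1132 570]
      computable_int_encode_linear[of "- 101688" "- 51200"] computable_int_encode_linear[of 9661 4864]
    by simp_all
  have "computable (entry (i, j))" if "i < 4" "j < 4" for i j
  proof -
    have "i = 0 \<or> i = 1 \<or> i = 2 \<or> i = 3" "j = 0 \<or> j = 1 \<or> j = 2 \<or> j = 3" using that by auto
    then show ?thesis
      by (elim disjE) (simp_all add: entry_def inpmat_eq lin computable_const)
  qed
  then have "computable F" if "F \<in> set (map entry (List.product [0..<4] [0..<4]))" for F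
    using that by auto
  from computable_list_encode[of "map entry (List.product [0..<4] [0..<4])", OF this] show ?thesis
    by (simp only: code_mat_def map_map comp_def entry_def case_prod_unfold)
qed

section \<open>Diagonalization\<close>

lemma not_decidable_48:
  "\<not> decidable_on code_mats {Ms. distinct Ms \<and> length Ms = 48} identity_in_semigroup"
proof
  assume "decidable_on code_mats {Ms. distinct Ms \<and> length Ms = 48} identity_in_semigroup"
  then obtain f where f: "\<And>Ms. distinct Ms \<Longrightarrow> length Ms = 48 \<Longrightarrow>
      eval f [code_mats Ms] (if identity_in_semigroup Ms then 1 else 0)"
    unfolding decidable_on_def by blast
  \<comment> \<open>By the recursion of \<open>list_encode\<close>, this is the code of
    \<open>inpmat x # Ms\<close> whenever \<open>x\<close> is the code of \<open>Ms\<close>.\<close>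
  define h where "h x = Suc (prod_encode (code_mat (inpmat x), x))" for x
  have "computable h"
    unfolding h_def by (intro computable_Suc computable_prod_encode computable_code_inpmat computable_id)
  then obtain H where H: "\<And>x. eval H [x] (h x)" unfolding computable_def by blast
  \<comment> \<open>The minimized function is constant in the search variable, so the search stops
    at 0 if \<open>f\<close> answers 0 on \<open>h x\<close> and diverges otherwise.\<close>
  define g where "g = Mn_f (Comp_f (Comp_f f [H]) [Proj_f 1])"
  have inner: "eval (Comp_f (Comp_f f [H]) [Proj_f 1]) [m, x] w \<longleftrightarrow> eval f [h x] w" for m x w
  proof
    assume "eval (Comp_f (Comp_f f [H]) [Proj_f 1]) [m, x] w"
    then obtain ys where "list_all2 (\<lambda>g. eval g [m, x]) [Proj_f 1] ys" "eval (Comp_f f [H]) ys w"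
      unfolding eval_simps(4)[of "Comp_f f [H]"] by blast
    then have "eval (Comp_f f [H]) [x] w" by (auto simp only: list_all2_Cons1 list_all2_Nil eval_simps(3)) simp
    then obtain zs where zs: "list_all2 (\<lambda>g. eval g [x]) [H] zs" "eval f zs w"
      unfolding eval_simps(4)[of f] by blast
    then have "zs = [h x]" using eval_deterministic[OF H[of x]] by (auto simp: list_all2_Cons1)
    with zs(2) show "eval f [h x] w" by simp
  next
    assume "eval f [h x] w"
    then have "eval (Comp_f f [H]) [x] w" by (rule eval.comp[of _ _ "[h x]", rotated]) (simp add: H)
    then show "eval (Comp_f (Comp_f f [H]) [Proj_f 1]) [m, x] w"
      by (rule eval.comp[of _ _ "[x]", rotated]) simp
  qed
  have g: "(\<exists>y. eval g [x] y) \<longleftrightarrow> eval f [h x] 0" for x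
  proof -
    have "(\<exists>y::nat. A \<and> (\<forall>m<y. B)) \<longleftrightarrow> A" for A B
      by (metis not_less0)
    then show ?thesis unfolding g_def eval_simps(8) inner .
  qed
  obtain G where G: "finite G" "card G \<le> 28"
    "\<forall>(s, u, v, t)\<in>G.
      5 \<le> s \<and> 6 \<le> t \<and> s < 15 \<and> t < 16 \<and> set u \<subseteq> {..<4} \<and> set v \<subseteq> {..<4} \<and> v \<noteq> []"
    "\<forall>x. (\<exists>y. eval g [x] y) \<longleftrightarrow>
      (\<exists>es. set es \<subseteq> insert (inp x) G \<and> walk 4 es 15 \<and> concat (map eU es) = concat (map eV es))"
    using graph_of_recf[of g] by (elim exE conjE)
  have "\<exists>Ms. distinct Ms \<and> length Ms = 47 \<and> (\<forall>x. inpmat x \<notin> set Ms \<and>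
    (identity_in_semigroup (inpmat x # Ms) \<longleftrightarrow>
      (\<exists>es. set es \<subseteq> insert (inp x) G \<and> walk 4 es 15 \<and> concat (map eU es) = concat (map eV es))))"
  proof (rule semigroup_of_graph[OF G(1)])
    show "card G \<le> 41" using G(2) by simp
  next
    fix s u v t assume "(s, u, v, t) \<in> G"
    from bspec[OF G(3) this] show "4 \<le> s \<and> 4 \<le> t \<and> s \<noteq> 15 \<and> s \<noteq> 16 \<and> t \<noteq> 16 \<and> t \<noteq> 5 \<and>
        set u \<subseteq> {..<4} \<and> set v \<subseteq> {..<4} \<and> v \<noteq> []" by simp
  qed
  then obtain Ms where Ms: "distinct Ms" "length Ms = 47" "\<forall>x. inpmat x \<notin> set Ms \<and>
      (identity_in_semigroup (inpmat x # Ms) \<longleftrightarrow> (\<exists>y. eval g [x] y))"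
    unfolding G(4)[rule_format, symmetric] by (elim exE conjE)
  define x where "x = code_mats Ms"
  have "code_mats (inpmat x # Ms) = h x"
    by (simp add: code_mats_def h_def x_def)
  moreover have "identity_in_semigroup (inpmat x # Ms) \<longleftrightarrow> eval f [h x] 0"
    using Ms(3) g by simp
  moreover have "eval f [code_mats (inpmat x # Ms)] (if identity_in_semigroup (inpmat x # Ms) then 1 else 0)"
    by (rule f) (use Ms in simp_all)
  ultimately have "eval f [h x] (if eval f [h x] 0 then 1 else 0)" by (simp only:)
  then show False
    using eval_deterministic[of f "[h x]" 1 0] by (cases "eval f [h x] 0") simp_all
qed

lemma decidable_on_subset: "decidable_on c D P \<Longrightarrow> D' \<subseteq> D \<Longrightarrow> decidable_on c D' P"
  unfolding decidable_on_def by blast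

theorem mainTheorem6:
  shows "\<not> decidable_on code_mats UNIV identity_in_semigroup
       \<and> \<not> decidable_on code_mats {Ms. distinct Ms \<and> length Ms = 48} identity_in_semigroup"
  using not_decidable_48 decidable_on_subset[OF _ subset_UNIV] by metis

end
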